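(* Let $m$ be a positive integer, let $K\in C^{[m]}(I^2)$ be independent of $\kappa$, let $f\in\tilde H^m_{\kappa,0}(I)$, and assume $1$ is not an eigenvalue of $\mathcal{K}$ for any $\kappa>1$, where $(\mathcal{K}u)(s)=\int_IK(s,t)e^{i\kappa|s-t|}u(t)\,dt$. Let $y$ be the solution of $y-\mathcal{K}y=f$. Then for sufficiently large $\kappa$ there exist a positive constant $c$ independent of $\kappa$ and $h_0>0$ such that for all partitions with mesh size $0<h<h_0$, the oscillation preserving Galerkin method has a unique solution $y_h\in V^m_{\kappa,h}$, and it satisfies $$\|y-y_h\|_2\le c\,h^m\,\|y\|_{\tilde H^m_{\kappa,0}}.$$
   Context: $I=[-1,1]$; $\kappa\in(1,\infty)$; functions are complex-valued; a $\kappa$-parameterized function is a family indexed by $\kappa>1$; "independent of $\kappa$" means a fixed function. $C^{[m]}(I^2)$: functions on $I^2$ with continuous $\partial_s^\alpha\partial_t^\beta$ derivatives, $\alpha,\beta\le m$. $\|u\|_2=(\int_I|u|^2)^{1/2}$, $(u,v)=\int_Iu\bar v$. $H^m(I)$ is the Sobolev space with $\|u\|_{H^m}=(\sum_{j=0}^m\|u^{(j)}\|_2^2)^{1/2}$. $H^m_{\kappa,0}(I)$: $\kappa$-parameterized $u\in H^m(I)$ with $\|u\|_{H^m}\le c$ for all $\kappa\ge\kappa_0$, some $c,\kappa_0>0$. $\tilde H^m_{\kappa,0}(I)=\{w_1e^{i\kappa t}+w_2e^{-i\kappa t}+w_3:w_j\in H^m_{\kappa,0}(I)\}$, with $\|u\|_{\tilde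 H^m_{\kappa,0}}=\inf\{(\sum_{j=1}^3\|w_j\|_{H^m}^2)^{1/2}:u=w_1e^{i\kappa\cdot}+w_2e^{-i\kappa\cdot}+w_3,\ w_j\in H^m_{\kappa,0}(I)\}$. Given a partition $-1=t_0<t_1<\dots<t_{N+1}=1$ with $h=\max_j(t_j-t_{j-1})$, $S_h^m$ is the space of $C^{m-2}(I)$ functions that are polynomials of degree less than $m$ on each $(t_{j-1},t_j)$ (splines of order $m$). $V^m_{\kappa,h}=\{w_1e^{i\kappa\cdot}+w_2e^{-i\kappa\cdot}+w_3:w_1,w_2,w_3\in S_h^m\}$. The oscillation preserving Galerkin method seeks $y_h\in V^m_{\kappa,h}$ with $(y_h,v_h)=(\mathcal{K}y_h,v_h)+(f,v_h)$ for all $v_h\in V^m_{\kappa,h}$, equivalently $y_h=\mathcal{P}_h\mathcal{K}y_h+\mathcal{P}_hf$ with $\mathcal{P}_h$ the $L^2(I)$-orthogonal projection onto $V^m_{\kappa,h}$. *)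

theory Defs
  imports "HOL-Analysis.Analysis" "HOL-Computational_Algebra.Polynomial"
begin

abbreviation II :: "real set" where "II \<equiv> {-1..1}"

definition L2_on :: "(real \<Rightarrow> complex) \<Rightarrow> bool" where
  "L2_on u \<longleftrightarrow> set_borel_measurable lborel II u \<and>
      set_integrable lborel II (\<lambda>t. (cmod (u t))^2)"

definition l2norm :: "(real \<Rightarrow> complex) \<Rightarrow> real" where
  "l2norm u = sqrt (LINT t:II|lborel. (cmod (u t))^2)"

definition l2inner :: "(real \<Rightarrow> complex) \<Rightarrow> (real \<Rightarrow> complex) \<Rightarrow> complex" where
  "l2inner u v = (LINT t:II|lborel. u t * cnj (v t))"

definition test_fn :: "(real \<Rightarrow> real) \<Rightarrow> bool" where
  "test_fn \<phi> \<longleftrightarrow>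
     (\<forall>k x. ((deriv ^^ k) \<phi> has_real_derivative (deriv ^^ Suc k) \<phi> x) (at x)) \<and>
     (\<exists>a b. -1 < a \<and> b < 1 \<and> (\<forall>x. x \<notin> {a..b} \<longrightarrow> \<phi> x = 0))"

definition sobolev_witness :: "nat \<Rightarrow> (real \<Rightarrow> complex) \<Rightarrow> (nat \<Rightarrow> real \<Rightarrow> complex) \<Rightarrow> bool" where
  "sobolev_witness m u g \<longleftrightarrow> g 0 = u \<and> (\<forall>j\<le>m. L2_on (g j)) \<and>
     (\<forall>j\<le>m. \<forall>\<phi>. test_fn \<phi> \<longrightarrow>
        (LINT x:II|lborel. u x * complex_of_real ((deriv ^^ j) \<phi> x))
          = (-1)^j * (LINT x:II|lborel. g j x * complex_of_real (\<phi> x)))"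

text \<open>Sobolev space H^m(I) and its norm (weak derivatives are unique a.e., so the
  infimum is over a set of one value).\<close>
definition in_H :: "nat \<Rightarrow> (real \<Rightarrow> complex) \<Rightarrow> bool" where
  "in_H m u \<longleftrightarrow> (\<exists>g. sobolev_witness m u g)"

definition H_norm :: "nat \<Rightarrow> (real \<Rightarrow> complex) \<Rightarrow> real" where
  "H_norm m u = Inf {sqrt (\<Sum>j\<le>m. (l2norm (g j))^2) | g. sobolev_witness m u g}"

definition in_H0 :: "nat \<Rightarrow> (real \<Rightarrow> real \<Rightarrow> complex) \<Rightarrow> bool" where
  "in_H0 m u \<longleftrightarrow> (\<forall>\<kappa>>1. in_H m (u \<kappa>)) \<and>
     (\<exists>c \<kappa>0. c > 0 \<and> \<kappa>0 > 0 \<and> (\<forall>\<kappa>\<ge>\<kappa>0. H_norm m (u \<kappa>) \<le> c))"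

definition osc_decomp :: "nat \<Rightarrow> (real \<Rightarrow> real \<Rightarrow> complex) \<Rightarrow>
     (real \<Rightarrow> real \<Rightarrow> complex) \<Rightarrow> (real \<Rightarrow> real \<Rightarrow> complex) \<Rightarrow> (real \<Rightarrow> real \<Rightarrow> complex) \<Rightarrow> bool" where
  "osc_decomp m u w1 w2 w3 \<longleftrightarrow> in_H0 m w1 \<and> in_H0 m w2 \<and> in_H0 m w3 \<and>
     (\<forall>\<kappa>>1. \<forall>t\<in>II. u \<kappa> t = w1 \<kappa> t * exp (\<i> * of_real \<kappa> * of_real t)
                          + w2 \<kappa> t * exp (- \<i> * of_real \<kappa> * of_real t) + w3 \<kappa> t)"

definition in_Ht :: "nat \<Rightarrow> (real \<Rightarrow> real \<Rightarrow> complex) \<Rightarrow> bool" where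
  "in_Ht m u \<longleftrightarrow> (\<exists>w1 w2 w3. osc_decomp m u w1 w2 w3)"

text \<open>Its norm at a given \<kappa>, extended-real valued (+\<infinity> if u has no admissible decomposition).\<close>
definition Ht_norm :: "nat \<Rightarrow> (real \<Rightarrow> real \<Rightarrow> complex) \<Rightarrow> real \<Rightarrow> ereal" where
  "Ht_norm m u \<kappa> = Inf {ereal (sqrt ((H_norm m (w1 \<kappa>))^2 + (H_norm m (w2 \<kappa>))^2 + (H_norm m (w3 \<kappa>))^2))
        | w1 w2 w3. osc_decomp m u w1 w2 w3}"

definition C_mixed :: "nat \<Rightarrow> (real \<Rightarrow> real \<Rightarrow> complex) \<Rightarrow> bool" where
  "C_mixed m K \<longleftrightarrow> (\<exists>D :: nat \<Rightarrow> nat \<Rightarrow> real \<Rightarrow> real \<Rightarrow> complex.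
     D 0 0 = K \<and>
     (\<forall>\<beta><m. \<forall>s\<in>II. \<forall>t\<in>II. ((\<lambda>t'. D 0 \<beta> s t') has_vector_derivative D 0 (Suc \<beta>) s t) (at t within II)) \<and>
     (\<forall>\<alpha><m. \<forall>\<beta>\<le>m. \<forall>s\<in>II. \<forall>t\<in>II. ((\<lambda>s'. D \<alpha> \<beta> s' t) has_vector_derivative D (Suc \<alpha>) \<beta> s t) (at s within II)) \<and>
     (\<forall>\<alpha>\<le>m. \<forall>\<beta>\<le>m. continuous_on (II \<times> II) (\<lambda>(s,t). D \<alpha> \<beta> s t)))"

definition Kop :: "(real \<Rightarrow> real \<Rightarrow> complex) \<Rightarrow> real \<Rightarrow> (real \<Rightarrow> complex) \<Rightarrow> real \<Rightarrow> complex" where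
  "Kop K \<kappa> u s = (LINT t:II|lborel. K s t * exp (\<i> * of_real \<kappa> * of_real \<bar>s - t\<bar>) * u t)"

definition Ck_on :: "nat \<Rightarrow> real set \<Rightarrow> (real \<Rightarrow> complex) \<Rightarrow> bool" where
  "Ck_on k S f \<longleftrightarrow> (\<exists>D :: nat \<Rightarrow> real \<Rightarrow> complex. D 0 = f \<and>
      (\<forall>j\<le>k. continuous_on S (D j)) \<and>
      (\<forall>j<k. \<forall>x\<in>S. (D j has_vector_derivative D (Suc j) x) (at x within S)))"

definition partition :: "nat \<Rightarrow> (nat \<Rightarrow> real) \<Rightarrow> bool" where
  "partition N t \<longleftrightarrow> t 0 = -1 \<and> t (Suc N) = 1 \<and> (\<forall>j\<le>N. t j < t (Suc j))"

definition mesh :: "nat \<Rightarrow> (nat \<Rightarrow> real) \<Rightarrow> real" where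
  "mesh N t = Max ((\<lambda>j. t (Suc j) - t j) ` {..N})"

definition spline :: "nat \<Rightarrow> nat \<Rightarrow> (nat \<Rightarrow> real) \<Rightarrow> (real \<Rightarrow> complex) \<Rightarrow> bool" where
  "spline m N t s \<longleftrightarrow>
     (\<forall>j\<le>N. \<exists>p :: complex poly. degree p < m \<and>
          (\<forall>x\<in>{t j<..<t (Suc j)}. s x = poly p (complex_of_real x))) \<and>
     (m \<ge> 2 \<longrightarrow> Ck_on (m - 2) II s)"

definition Vspace :: "nat \<Rightarrow> real \<Rightarrow> nat \<Rightarrow> (nat \<Rightarrow> real) \<Rightarrow> (real \<Rightarrow> complex) set" where
  "Vspace m \<kappa> N t = {(\<lambda>x. w1 x * exp (\<i> * of_real \<kappa> * of_real x)
                        + w2 x * exp (- \<i> * of_real \<kappa> * of_real x) + w3 x)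
          | w1 w2 w3. spline m N t w1 \<and> spline m N t w2 \<and> spline m N t w3}"

definition galerkin_sol :: "nat \<Rightarrow> (real \<Rightarrow> real \<Rightarrow> complex) \<Rightarrow> (real \<Rightarrow> complex) \<Rightarrow> real \<Rightarrow>
     nat \<Rightarrow> (nat \<Rightarrow> real) \<Rightarrow> (real \<Rightarrow> complex) \<Rightarrow> bool" where
  "galerkin_sol m K f \<kappa> N t yh \<longleftrightarrow> yh \<in> Vspace m \<kappa> N t \<and>
     (\<forall>v\<in>Vspace m \<kappa> N t. l2inner yh v = l2inner (Kop K \<kappa> yh) v + l2inner f v)"

end

theory Submission
  imports Defs
begin

text \<open>
  Split \<open>K = T1 + T2\<close> into the parts with \<open>t < s\<close> and \<open>s \<le> t\<close>. Both are Volterra operators, so \<open>I - T1\<close> and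
  \<open>I - T2\<close> are bounded below independently of \<open>\<kappa>\<close> (the oscillating factor has modulus one), while the kernel of
  \<open>T1 T2\<close> is an oscillatory integral of size \<open>O(1/\<kappa>)\<close>. Since \<open>(I - T1)(I - T2) = I - K + T1 T2\<close>, the operator
  \<open>I - K\<close> is bounded below uniformly for large \<open>\<kappa>\<close>.

  The approximation property is proved by duality. If \<open>g\<close> is orthogonal to the splines of order \<open>m\<close>, its iterated
  primitives \<open>F k\<close> vanish at the endpoint \<open>1\<close> for \<open>1 \<le> k \<le> m\<close> and \<open>F m\<close> vanishes at all knots, because
  \<open>F m\<close> at a knot is the integral of \<open>g\<close> against a truncated power. Rolle's theorem then makes the zeros of every
  \<open>F k\<close> dense at scale \<open>3^m h\<close>, so that \<open>F k\<close> is \<open>O(h)\<close> times \<open>F (k - 1)\<close> in norm, and integrating by parts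
  \<open>m\<close> times bounds the pairing of \<open>g\<close> with an \<open>H^m\<close> function by \<open>O(h^m)\<close>.

  For the error \<open>z = y - yh\<close> the residual \<open>r = z - K z\<close> is orthogonal to the Galerkin space, and
  \<open>(r, r) = (y, r) - (K z, r)\<close>. Duality bounds the first term by \<open>O(h^m)\<close> times the norm of \<open>r\<close>, and one integration
  by parts bounds the second by \<open>O(h)\<close> times the norms of \<open>z\<close> and \<open>r\<close>.
\<close>

text \<open>The obstacle is uniformity in \<kappa>: a compactness argument would bound the inverse
  of \<open>I - K\<close> for each \<kappa> separately, with no control as \<kappa> grows. The split
  at the diagonal works because of how phases combine. In \<open>T1 T2\<close> the exponents from
  the two sides of the diagonal add up to a phase with \<open>-2 \<kappa> t\<close> in the inner
  variable, whereas in the square of one Volterra part the inner variable cancels and nothing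
  oscillates.

  Duality is used because the three components of an element of the Galerkin space are neither
  unique nor orthogonal. Orthogonality to that space, however, decouples into three statements about
  plain splines, for the conjugate residual multiplied by 1, \<open>cis (\<kappa> x)\<close> and
  \<open>cis (- \<kappa> x)\<close>. The last two also allow the phase of the kernel to be moved
  onto the residual before integrating by parts, so that no factor \<kappa> is produced.

  A single stability estimate serves twice: for an element of the Galerkin space it gives
  uniqueness, hence existence in finite dimension, and for the error it gives the convergence
  rate.\<close>

definition LI :: "real measure" where "LI = restrict_space lborel II"

lemma space_LI [simp]: "space LI = II"
  by (simp add: LI_def space_restrict_space)

lemma sets_LI: "sets LI = sets (restrict_space borel II)"
  by (simp add: LI_def sets_restrict_space)

lemma borel_measurable_LI_iff:
  "f \<in> borel_measurable LI \<longleftrightarrow> set_borel_measurable lborel II f"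
  for f :: "real \<Rightarrow> 'a::real_normed_vector"
  unfolding LI_def set_borel_measurable_def by (subst borel_measurable_restrict_space_iff) auto

lemma set_integral_LI: "(LINT t:II|lborel. f t) = (LINT t|LI. f t)"
  for f :: "real \<Rightarrow> 'a::{banach, second_countable_topology}"
  unfolding LI_def set_lebesgue_integral_def by (subst integral_restrict_space) auto

lemma set_integrable_LI: "set_integrable lborel II f \<longleftrightarrow> integrable LI f"
  for f :: "real \<Rightarrow> 'a::{banach, second_countable_topology}"
  unfolding LI_def set_integrable_def by (subst integrable_restrict_space) auto

lemma AE_LI_iff: "(AE x in lborel. x \<in> II \<longrightarrow> P x) \<longleftrightarrow> (AE x in LI. P x)"
  unfolding LI_def by (subst AE_restrict_space_iff) auto

text \<open>Finite total mass makes bounded measurable functions integrable and provides the product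
  measure for Fubini, on which all kernel estimates rest.\<close>

interpretation LI: finite_measure LI
proof
  show "emeasure LI (space LI) \<noteq> \<infinity>"
    unfolding space_LI unfolding LI_def by (subst emeasure_restrict_space) auto
qed

interpretation LI2: pair_sigma_finite LI LI ..

lemma measure_LI: "A \<in> sets borel \<Longrightarrow> A \<subseteq> II \<Longrightarrow> measure LI A = measure lborel A"
  unfolding LI_def by (rule measure_restrict_space) auto

lemma measure_LI_II [simp]: "measure LI II = 2"
  by (subst measure_LI) auto

lemma integral_LI_const: "(LINT t|LI. c) = 2 *\<^sub>R c"
  for c :: "'a::{banach, second_countable_topology}"
  by simp

lemma measurable_id_LI [measurable]: "(\<lambda>x. x) \<in> borel_measurable LI"
  unfolding LI_def by (rule measurable_restrict_space1) simp

lemma borel_measurable_LI_of_borel: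
  "f \<in> borel_measurable borel \<Longrightarrow> f \<in> borel_measurable LI"
  unfolding LI_def by (rule measurable_restrict_space1) simp

lemma continuous_on_borel_measurable_LI:
  "continuous_on II f \<Longrightarrow> f \<in> borel_measurable LI"
  for f :: "real \<Rightarrow> 'a::real_normed_vector"
  unfolding borel_measurable_LI_iff set_borel_measurable_def
  using borel_measurable_continuous_on_indicator[of II f] by simp

lemma integrable_LI_bounded:
  fixes f :: "real \<Rightarrow> 'a::{banach, second_countable_topology}"
  assumes "f \<in> borel_measurable LI" and "\<And>x. x \<in> II \<Longrightarrow> norm (f x) \<le> B"
  shows "integrable LI f"
  using assms by (intro LI.integrable_const_bound[where B = B]) auto

lemma integrable_LI_continuous: "continuous_on II f \<Longrightarrow> integrable LI f"
  for f :: "real \<Rightarrow> 'a::{banach, second_countable_topology}"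
proof -
  assume f: "continuous_on II f"
  have "compact (f ` II)"
    using f by (intro compact_continuous_image) auto
  then obtain B where "\<And>x. x \<in> II \<Longrightarrow> norm (f x) \<le> B"
    by (meson bounded_iff compact_imp_bounded imageI)
  then show ?thesis
    using continuous_on_borel_measurable_LI[OF f] integrable_LI_bounded by blast
qed

lemma integrable_LI_mult_bounded:
  fixes f u :: "real \<Rightarrow> 'a::{real_normed_algebra, banach, second_countable_topology}"
  assumes f: "f \<in> borel_measurable LI" "\<And>x. x \<in> II \<Longrightarrow> norm (f x) \<le> B" and u: "integrable LI u"
  shows "integrable LI (\<lambda>x. f x * u x)"
proof (rule Bochner_Integration.integrable_bound)
  show "integrable LI (\<lambda>x. B * norm (u x))"
    using u by auto
  show "(\<lambda>x. f x * u x) \<in> borel_measurable LI"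
    using f u by auto
  show "AE x in LI. norm (f x * u x) \<le> norm (B * norm (u x))"
  proof (rule AE_I2)
    fix x assume "x \<in> space LI"
    then have "norm (f x) \<le> B"
      using f by auto
    then have "norm (f x) * norm (u x) \<le> B * norm (u x)"
      by (intro mult_right_mono) auto
    also have "\<dots> \<le> norm (B * norm (u x))"
      by simp
    finally show "norm (f x * u x) \<le> norm (B * norm (u x))"
      using norm_mult_ineq order_trans by blast
  qed
qed

section \<open>Square integrable functions\<close>

lemma L2_on_iff: "L2_on u \<longleftrightarrow> u \<in> borel_measurable LI \<and> integrable LI (\<lambda>t. (cmod (u t))^2)"
  by (simp add: L2_on_def borel_measurable_LI_iff set_integrable_LI)

lemma l2norm_LI: "l2norm u = sqrt (LINT t|LI. (cmod (u t))^2)"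
  by (simp add: l2norm_def set_integral_LI)

lemma l2inner_LI: "l2inner u v = (LINT t|LI. u t * cnj (v t))"
  by (simp add: l2inner_def set_integral_LI)

lemma L2_measurable: "L2_on u \<Longrightarrow> u \<in> borel_measurable LI"
  by (simp add: L2_on_iff)

lemma L2_sq_integrable: "L2_on u \<Longrightarrow> integrable LI (\<lambda>t. (cmod (u t))^2)"
  by (simp add: L2_on_iff)

lemma l2norm_nonneg [simp]: "l2norm u \<ge> 0"
  by (simp add: l2norm_LI)

lemma l2norm_sq: "(l2norm u)^2 = (LINT t|LI. (cmod (u t))^2)"
  by (simp add: l2norm_LI)

lemma L2_onI:
  assumes "u \<in> borel_measurable LI" "integrable LI g" "\<And>x. x \<in> II \<Longrightarrow> (cmod (u x))^2 \<le> g x"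
  shows "L2_on u"
  unfolding L2_on_iff
proof
  show "integrable LI (\<lambda>t. (cmod (u t))^2)"
    using assms by (intro Bochner_Integration.integrable_bound[OF assms(2)]) (auto intro!: AE_I2 order_trans[OF _ abs_ge_self])
qed (use assms in auto)

lemma L2_bounded:
  assumes "u \<in> borel_measurable LI" "\<And>x. x \<in> II \<Longrightarrow> cmod (u x) \<le> B"
  shows "L2_on u"
  by (rule L2_onI[where g = "\<lambda>_. B^2"]) (use assms in \<open>auto intro: power_mono\<close>)

lemma L2_mult_bounded:
  assumes "f \<in> borel_measurable LI" "\<And>x. x \<in> II \<Longrightarrow> cmod (f x) \<le> B" "L2_on u"
  shows "L2_on (\<lambda>x. f x * u x)"
proof (rule L2_onI[where g = "\<lambda>x. B^2 * (cmod (u x))^2"])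
  show "(\<lambda>x. f x * u x) \<in> borel_measurable LI"
    using assms L2_measurable[OF assms(3)] by simp
  show "integrable LI (\<lambda>x. B^2 * (cmod (u x))^2)"
    using L2_sq_integrable[OF assms(3)] by auto
  fix x :: real assume "x \<in> II"
  then have "cmod (f x) \<le> B"
    using assms by auto
  then show "(cmod (f x * u x))^2 \<le> B^2 * (cmod (u x))^2"
    by (auto simp: norm_mult power_mult_distrib intro!: mult_right_mono power_mono)
qed

lemma L2_cmult: "L2_on u \<Longrightarrow> L2_on (\<lambda>x. c * u x)"
  by (rule L2_mult_bounded[where B = "cmod c"]) auto

lemma sq_add_le: "(cmod (a + b))^2 \<le> 2 * (cmod a)^2 + 2 * (cmod b)^2"
proof -
  have "(cmod (a + b))^2 \<le> (cmod a + cmod b)^2"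
    by (intro power_mono norm_triangle_ineq) auto
  also have "\<dots> \<le> 2 * (cmod a)^2 + 2 * (cmod b)^2"
    using sum_squares_bound[of "cmod a" "cmod b"] by (simp add: power2_sum)
  finally show ?thesis .
qed

lemma L2_add: "L2_on u \<Longrightarrow> L2_on v \<Longrightarrow> L2_on (\<lambda>x. u x + v x)"
  using L2_sq_integrable[of u] L2_sq_integrable[of v] L2_measurable[of u] L2_measurable[of v]
  by (intro L2_onI[where g = "\<lambda>x. 2 * (cmod (u x))^2 + 2 * (cmod (v x))^2"]) (auto simp: sq_add_le)

lemma L2_diff: "L2_on u \<Longrightarrow> L2_on v \<Longrightarrow> L2_on (\<lambda>x. u x - v x)"
  using L2_add[of u "\<lambda>x. (-1) * v x"] L2_cmult[of v "-1"] by simp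

lemma L2_cnj: "L2_on u \<Longrightarrow> L2_on (\<lambda>x. cnj (u x))"
  by (auto simp: L2_on_iff intro!: borel_measurable_continuous_onI continuous_intros
      measurable_compose[where f = u and g = cnj and N = borel])

lemma L2_zero [simp]: "L2_on (\<lambda>x. 0)"
  by (rule L2_bounded[where B = 0]) auto

lemma L2_sum: "(\<And>i. i \<in> S \<Longrightarrow> L2_on (f i)) \<Longrightarrow> L2_on (\<lambda>x. \<Sum>i\<in>S. f i x)"
  by (induction S rule: infinite_finite_induct) (auto intro: L2_add)

lemma L2_cong_AE:
  assumes "L2_on u" "v \<in> borel_measurable LI" "AE x in LI. u x = v x"
  shows "L2_on v"
proof -
  have "integrable LI (\<lambda>t. (cmod (v t))^2) \<longleftrightarrow> integrable LI (\<lambda>t. (cmod (u t))^2)"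
    using assms L2_measurable[OF assms(1)] by (intro integrable_cong_AE) auto
  then show ?thesis
    using assms by (auto simp: L2_on_iff)
qed

lemma L2_cong: "(\<And>x. x \<in> II \<Longrightarrow> u x = v x) \<Longrightarrow> L2_on u \<longleftrightarrow> L2_on v"
  unfolding L2_on_iff
  by (intro conj_cong measurable_cong Bochner_Integration.integrable_cong) auto

lemma l2norm_cong: "(\<And>x. x \<in> II \<Longrightarrow> u x = v x) \<Longrightarrow> l2norm u = l2norm v"
  unfolding l2norm_LI by (intro arg_cong[where f = sqrt] Bochner_Integration.integral_cong) auto

lemma integrable_prod_aux:
  assumes "L2_on u" "L2_on v"
  shows "integrable LI (\<lambda>x. cmod (u x) * cmod (v x))"
proof (rule Bochner_Integration.integrable_bound)
  show "integrable LI (\<lambda>x. (cmod (u x))^2 + (cmod (v x))^2)"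
    using assms L2_sq_integrable by auto
  show "(\<lambda>x. cmod (u x) * cmod (v x)) \<in> borel_measurable LI"
    using assms[THEN L2_measurable] by simp
  show "AE x in LI. norm (cmod (u x) * cmod (v x)) \<le> norm ((cmod (u x))^2 + (cmod (v x))^2)"
  proof (rule AE_I2)
    fix x
    have "cmod (u x) * cmod (v x) \<le> (cmod (u x))^2 + (cmod (v x))^2"
      using sum_squares_bound[of "cmod (u x)" "cmod (v x)"]
        mult_nonneg_nonneg[OF norm_ge_zero[of "u x"] norm_ge_zero[of "v x"]]
      unfolding mult.assoc by linarith
    then show "norm (cmod (u x) * cmod (v x)) \<le> norm ((cmod (u x))^2 + (cmod (v x))^2)"
      by (simp add: abs_mult)
  qed
qed

lemma L2_mult_integrable:
  assumes "L2_on u" "L2_on v"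
  shows "integrable LI (\<lambda>x. u x * v x)"
proof (rule Bochner_Integration.integrable_bound[OF integrable_prod_aux[OF assms]])
  show "(\<lambda>x. u x * v x) \<in> borel_measurable LI"
    using L2_measurable[OF assms(1)] L2_measurable[OF assms(2)] by simp
qed (auto simp: norm_mult)

lemma L2_integrable: "L2_on u \<Longrightarrow> integrable LI u"
  using L2_mult_integrable[of u "\<lambda>_. 1"] L2_bounded[of "\<lambda>_. 1" 1] by simp

text \<open>Discriminant argument: the integral of \<open>(s |u| - |v|)^2\<close> is nonnegative for
  every real \<open>s\<close>. The version with absolute values inside the integral is the one that
  the triangle inequality and the L1 bound need.\<close>

lemma l2_Cauchy_Schwarz_abs:
  assumes "L2_on u" "L2_on v"
  shows "(LINT x|LI. cmod (u x) * cmod (v x)) \<le> l2norm u * l2norm v"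
proof -
  define a b c where "a = l2norm u" and "b = l2norm v" and "c = (LINT x|LI. cmod (u x) * cmod (v x))"
  have key: "2 * s * c \<le> s^2 * a^2 + b^2" for s :: real
  proof -
    have "(LINT x|LI. 2 * s * (cmod (u x) * cmod (v x))) \<le> (LINT x|LI. s^2 * (cmod (u x))^2 + (cmod (v x))^2)"
      using assms L2_sq_integrable integrable_prod_aux[OF assms] sum_squares_bound[of "s * cmod (u x)" "cmod (v x)" for x]
      by (intro integral_mono) (auto simp: power_mult_distrib algebra_simps)
    then show ?thesis
      using assms L2_sq_integrable by (simp add: a_def b_def c_def l2norm_sq)
  qed
  have nn: "a \<ge> 0" "b \<ge> 0" "c \<ge> 0"
    by (auto simp: a_def b_def c_def intro!: integral_nonneg_AE)
  have "c^2 \<le> (a * b)^2"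
  proof (cases "a = 0")
    case True
    have "c = 0"
    proof (rule ccontr)
      \<comment> \<open>With \<open>a = 0\<close> the inequality bounds \<open>2 s c\<close> by
        \<open>b^2\<close> for all \<open>s\<close>; this \<open>s\<close> makes the left side
        \<open>2 (b^2 + 1)\<close>.\<close>
      assume "c \<noteq> 0"
      then have "2 * ((b^2 + 1) / c) * c = 2 * (b^2 + 1)"
        by simp
      then show False
        using key[of "(b^2 + 1) / c"] True zero_le_power2[of b] by simp
    qed
    then show ?thesis
      by simp
  next
    case False
    \<comment> \<open>The choice \<open>s = q / a = c / a^2\<close> is the optimal one in
      \<open>key\<close>.\<close>
    define q where "q = c / a"
    have c: "c = q * a"
      using False by (simp add: q_def)
    have "2 * (q / a) * c = 2 * q^2" "(q / a)^2 * a^2 = q^2"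
      using False by (auto simp: c power2_eq_square)
    then have "q^2 \<le> b^2"
      using key[of "q / a"] by simp
    then have "q^2 * a^2 \<le> b^2 * a^2"
      by (intro mult_right_mono) auto
    then show ?thesis
      by (simp add: c power_mult_distrib mult.commute)
  qed
  then have "c \<le> a * b"
    by (rule power2_le_imp_le) (use nn in auto)
  then show ?thesis
    by (simp add: a_def b_def c_def)
qed

lemma l2_Cauchy_Schwarz:
  assumes "L2_on u" "L2_on v"
  shows "cmod (LINT x|LI. u x * v x) \<le> l2norm u * l2norm v"
proof -
  have "cmod (LINT x|LI. u x * v x) \<le> (LINT x|LI. cmod (u x * v x))"
    by simp
  then show ?thesis
    using l2_Cauchy_Schwarz_abs[OF assms] by (simp add: norm_mult)
qed

lemma l2norm_mono:
  assumes "L2_on v" "u \<in> borel_measurable LI" "\<And>x. x \<in> II \<Longrightarrow> cmod (u x) \<le> cmod (v x)"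
  shows "l2norm u \<le> l2norm v"
proof -
  have "(LINT x|LI. (cmod (u x))^2) \<le> (LINT x|LI. (cmod (v x))^2)"
    using assms L2_sq_integrable L2_onI[of u "\<lambda>x. (cmod (v x))^2"] by (intro integral_mono) (auto intro: power_mono)
  then show ?thesis
    by (simp add: l2norm_LI)
qed

lemma l2norm_cmult: "l2norm (\<lambda>x. c * u x) = cmod c * l2norm u"
  by (simp add: l2norm_LI norm_mult power_mult_distrib real_sqrt_mult)

lemma l2norm_mult_le:
  assumes "L2_on u" "f \<in> borel_measurable LI" "\<And>x. x \<in> II \<Longrightarrow> cmod (f x) \<le> B" "B \<ge> 0"
  shows "l2norm (\<lambda>x. f x * u x) \<le> B * l2norm u"
proof -
  have "l2norm (\<lambda>x. f x * u x) \<le> l2norm (\<lambda>x. complex_of_real B * u x)"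
    using assms L2_measurable[OF assms(1)] by (intro l2norm_mono L2_cmult) (auto simp: norm_mult mult_right_mono)
  then show ?thesis
    using assms by (simp add: l2norm_cmult)
qed

lemma l2norm_triangle:
  assumes "L2_on u" "L2_on v"
  shows "l2norm (\<lambda>x. u x + v x) \<le> l2norm u + l2norm v"
proof -
  have "(l2norm (\<lambda>x. u x + v x))^2 \<le> (LINT x|LI. (cmod (u x))^2 + 2 * (cmod (u x) * cmod (v x)) + (cmod (v x))^2)"
    unfolding l2norm_sq
  proof (rule integral_mono)
    show "integrable LI (\<lambda>x. (cmod (u x + v x))^2)"
      using assms L2_sq_integrable L2_add by auto
    show "integrable LI (\<lambda>x. (cmod (u x))^2 + 2 * (cmod (u x) * cmod (v x)) + (cmod (v x))^2)"
      using assms L2_sq_integrable integrable_prod_aux[OF assms] by auto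
    fix x
    have "(cmod (u x + v x))^2 \<le> (cmod (u x) + cmod (v x))^2"
      by (intro power_mono norm_triangle_ineq) auto
    then show "(cmod (u x + v x))^2 \<le> (cmod (u x))^2 + 2 * (cmod (u x) * cmod (v x)) + (cmod (v x))^2"
      by (simp add: power2_sum)
  qed
  also have "\<dots> = (l2norm u)^2 + 2 * (LINT x|LI. cmod (u x) * cmod (v x)) + (l2norm v)^2"
    using assms L2_sq_integrable integrable_prod_aux[OF assms] by (simp add: l2norm_sq)
  also have "\<dots> \<le> (l2norm u + l2norm v)^2"
    using l2_Cauchy_Schwarz_abs[OF assms] by (simp add: power2_sum)
  finally show ?thesis
    by (rule power2_le_imp_le) auto
qed

lemma l2norm_eq_0_AE:
  assumes "L2_on u" "l2norm u = 0"
  shows "AE x in LI. u x = 0"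
proof -
  have "(LINT x|LI. (cmod (u x))^2) = 0"
    using assms(2) l2norm_sq[of u] by simp
  then show ?thesis
    using integral_nonneg_eq_0_iff_AE[OF L2_sq_integrable[OF assms(1)]] by auto
qed

text \<open>The factor 2 rounds up \<open>sqrt 2\<close>, the norm of the constant function
  1.\<close>

lemma integral_abs_le_l2norm:
  assumes "L2_on u"
  shows "(LINT x|LI. cmod (u x)) \<le> 2 * l2norm u"
proof -
  have "l2norm (\<lambda>_. 1) \<le> 2"
    by (simp add: l2norm_LI real_le_lsqrt)
  then have "l2norm u * l2norm (\<lambda>_. 1) \<le> l2norm u * 2"
    by (rule mult_left_mono) simp
  then show ?thesis
    using l2_Cauchy_Schwarz_abs[OF assms L2_bounded[of "\<lambda>_. 1" 1]] by simp
qed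

text \<open>Multiplication by a unimodular factor is an isometry, so passing to an oscillating
  multiple of the residual costs no constant depending on \<kappa>.\<close>

lemma l2norm_cis_mult:
  assumes "L2_on u"
  shows "L2_on (\<lambda>x. cis (c * x) * u x)" "l2norm (\<lambda>x. cis (c * x) * u x) = l2norm u"
proof -
  have "(\<lambda>x. cis (c * x)) \<in> borel_measurable LI"
    by (intro continuous_on_borel_measurable_LI continuous_intros)
  then show "L2_on (\<lambda>x. cis (c * x) * u x)"
    by (rule L2_mult_bounded[where B = 1]) (use assms in auto)
  show "l2norm (\<lambda>x. cis (c * x) * u x) = l2norm u"
    by (simp add: l2norm_LI norm_mult)
qed

lemma l2inner_diff:
  assumes "L2_on u" "L2_on v" "L2_on w"
  shows "l2inner (\<lambda>x. u x - v x) w = l2inner u w - l2inner v w"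
  unfolding l2inner_LI left_diff_distrib
  by (intro Bochner_Integration.integral_diff L2_mult_integrable assms L2_cnj)

lemma l2inner_cong:
  assumes "L2_on u" "L2_on v" "L2_on w" "AE x in LI. u x = v x"
  shows "l2inner u w = l2inner v w"
  unfolding l2inner_LI
proof (rule integral_cong_AE)
  show "(\<lambda>x. u x * cnj (w x)) \<in> borel_measurable LI" "(\<lambda>x. v x * cnj (w x)) \<in> borel_measurable LI"
    by (intro borel_measurable_integrable L2_mult_integrable assms L2_cnj)+
  show "AE x in LI. u x * cnj (w x) = v x * cnj (w x)"
    using assms(4) by eventually_elim simp
qed

section \<open>Bounded kernels and primitives\<close>

lemma measurable_fst_LI [measurable]: "fst \<in> borel_measurable (LI \<Otimes>\<^sub>M LI)"
  using measurable_compose[OF measurable_fst measurable_id_LI] by simp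

lemma measurable_snd_LI [measurable]: "snd \<in> borel_measurable (LI \<Otimes>\<^sub>M LI)"
  using measurable_compose[OF measurable_snd measurable_id_LI] by simp

lemma AE_LI_neq: "AE x in LI. x \<noteq> c"
  using AE_lborel_singleton[of c] unfolding AE_LI_iff[symmetric] by auto

lemma AE_LI_finite: "finite S \<Longrightarrow> AE x in LI. x \<notin> S"
  using AE_not_in[OF finite_imp_null_set_lborel[of S]] unfolding AE_LI_iff[symmetric] by auto

lemma kernel_section_measurable:
  assumes "case_prod k \<in> borel_measurable (LI \<Otimes>\<^sub>M LI)" "s \<in> II"
  shows "(\<lambda>t. k s t) \<in> borel_measurable LI"
  using measurable_compose[OF measurable_Pair1' assms(1), of s] assms(2) by simp

lemma kernel_section_measurable2:
  assumes "case_prod k \<in> borel_measurable (LI \<Otimes>\<^sub>M LI)" "t \<in> II"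
  shows "(\<lambda>s. k s t) \<in> borel_measurable LI"
  using measurable_compose[OF measurable_Pair2' assms(1), of t] assms(2) by simp

lemma kernel_product_integrable:
  fixes u v :: "real \<Rightarrow> 'a::{real_normed_field, banach, second_countable_topology}"
  assumes k: "case_prod k \<in> borel_measurable (LI \<Otimes>\<^sub>M LI)" "\<And>s t. s \<in> II \<Longrightarrow> t \<in> II \<Longrightarrow> norm (k s t) \<le> B"
    and u: "integrable LI u" and v: "integrable LI v"
  shows "integrable (LI \<Otimes>\<^sub>M LI) (\<lambda>(s, t). v s * (k s t * u t))"
proof -
  have [measurable]: "u \<in> borel_measurable LI" "v \<in> borel_measurable LI"
    using u v by auto
  have [measurable]: "(\<lambda>z. k (fst z) (snd z)) \<in> borel_measurable (LI \<Otimes>\<^sub>M LI)"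
    using k(1) by (simp add: case_prod_beta')
  have "integrable (LI \<Otimes>\<^sub>M LI) (\<lambda>z. v (fst z) * u (snd z))"
    by (rule LI2.Fubini_integrable) (use u v in \<open>auto simp: norm_mult\<close>)
  then have *: "integrable (LI \<Otimes>\<^sub>M LI) (\<lambda>z. B * norm (v (fst z) * u (snd z)))"
    by auto
  show ?thesis
    unfolding case_prod_beta'
  proof (rule Bochner_Integration.integrable_bound[OF *])
    show "AE z in LI \<Otimes>\<^sub>M LI. norm (v (fst z) * (k (fst z) (snd z) * u (snd z))) \<le> norm (B * norm (v (fst z) * u (snd z)))"
    proof (rule AE_I2)
      fix z assume "z \<in> space (LI \<Otimes>\<^sub>M LI)"
      then have "norm (k (fst z) (snd z)) \<le> B"
        using k(2)[of "fst z" "snd z"] by (auto simp: space_pair_measure)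
      then have "norm (k (fst z) (snd z)) * norm (v (fst z) * u (snd z)) \<le> B * norm (v (fst z) * u (snd z))"
        by (rule mult_right_mono) simp
      then show "norm (v (fst z) * (k (fst z) (snd z) * u (snd z))) \<le> norm (B * norm (v (fst z) * u (snd z)))"
        by (simp add: norm_mult mult_ac abs_mult order_trans[OF _ mult_right_mono[OF abs_ge_self]])
    qed
  qed measurable
qed

text \<open>Fubini, with \<open>B |v s| |u t|\<close> as dominating function. It serves to move an
  operator onto the other factor of a pairing, and to find the kernel of a composition.\<close>

lemma kernel_swap:
  fixes u v :: "real \<Rightarrow> 'a::{real_normed_field, banach, second_countable_topology}"
  assumes k: "case_prod k \<in> borel_measurable (LI \<Otimes>\<^sub>M LI)" "\<And>s t. s \<in> II \<Longrightarrow> t \<in> II \<Longrightarrow> norm (k s t) \<le> B"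
    and u: "integrable LI u" and v: "integrable LI v"
  shows "(LINT s|LI. v s * (LINT t|LI. k s t * u t)) = (LINT t|LI. u t * (LINT s|LI. k s t * v s))"
proof -
  have "(LINT s|LI. (LINT t|LI. v s * (k s t * u t))) = (LINT t|LI. (LINT s|LI. v s * (k s t * u t)))"
    using LI2.integral_fst[OF kernel_product_integrable[OF assms]]
      LI2.integral_snd[OF kernel_product_integrable[OF assms]] by simp
  also have "\<dots> = (LINT t|LI. (LINT s|LI. u t * (k s t * v s)))"
    by (intro Bochner_Integration.integral_cong) (auto simp: mult_ac)
  finally show ?thesis
    by simp
qed

lemma kernel_integrable:
  fixes u :: "real \<Rightarrow> 'a::{real_normed_field, banach, second_countable_topology}"
  assumes k: "case_prod k \<in> borel_measurable (LI \<Otimes>\<^sub>M LI)" "\<And>s t. s \<in> II \<Longrightarrow> t \<in> II \<Longrightarrow> norm (k s t) \<le> B"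
    and u: "integrable LI u"
  shows "integrable LI (\<lambda>s. LINT t|LI. k s t * u t)"
  using LI2.integrable_fst[OF kernel_product_integrable[OF k u, of "\<lambda>_. 1"]] by simp

lemma kernel_section_integrable:
  fixes u :: "real \<Rightarrow> 'a::{real_normed_field, banach, second_countable_topology}"
  assumes k: "case_prod k \<in> borel_measurable (LI \<Otimes>\<^sub>M LI)" "\<And>s t. s \<in> II \<Longrightarrow> t \<in> II \<Longrightarrow> norm (k s t) \<le> B"
    and u: "integrable LI u" and s: "s \<in> II"
  shows "integrable LI (\<lambda>t. k s t * u t)"
  by (rule integrable_LI_mult_bounded[OF kernel_section_measurable[OF k(1) s]]) (use k s u in auto)

lemma kernel_bound:
  fixes u :: "real \<Rightarrow> 'a::{real_normed_field, banach, second_countable_topology}"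
  assumes k: "case_prod k \<in> borel_measurable (LI \<Otimes>\<^sub>M LI)" "\<And>s t. s \<in> II \<Longrightarrow> t \<in> II \<Longrightarrow> norm (k s t) \<le> B"
    and u: "integrable LI u" and s: "s \<in> II"
  shows "norm (LINT t|LI. k s t * u t) \<le> B * (LINT t|LI. norm (u t))"
proof -
  have "norm (LINT t|LI. k s t * u t) \<le> (LINT t|LI. norm (k s t * u t))"
    by simp
  also have "\<dots> \<le> (LINT t|LI. B * norm (u t))"
    using k(2)[OF s]
    by (intro integral_mono integrable_norm kernel_section_integrable[OF assms] integrable_mult_right u)
       (auto simp: norm_mult mult_right_mono)
  finally show ?thesis
    by simp
qed

lemma kernel_L2:
  assumes k: "case_prod k \<in> borel_measurable (LI \<Otimes>\<^sub>M LI)" "\<And>s t. s \<in> II \<Longrightarrow> t \<in> II \<Longrightarrow> cmod (k s t) \<le> B"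
    and u: "integrable LI u"
  shows "L2_on (\<lambda>s. LINT t|LI. k s t * u t)"
  using kernel_integrable[OF assms] kernel_bound[OF assms] by (intro L2_bounded) auto

section \<open>Primitives and integration by parts\<close>

definition prim :: "(real \<Rightarrow> complex) \<Rightarrow> real \<Rightarrow> complex" where
  "prim g x = (LINT t|LI. (if t \<le> x then g t else 0))"

lemma triangle_kernel_measurable [measurable]:
  "(\<lambda>(s, t). if t \<le> s then 1 else (0::'a::real_normed_field)) \<in> borel_measurable (LI \<Otimes>\<^sub>M LI)"
  unfolding case_prod_beta' by measurable

text \<open>With the triangle kernel, taking the primitive is one of the bounded kernel operators
  above, so integrability and Fubini carry over.\<close>

lemma prim_kernel: "prim g x = (LINT t|LI. (if t \<le> x then 1 else 0) * g t)"
  unfolding prim_def by (intro Bochner_Integration.integral_cong) auto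

lemma integrable_cut [intro]:
  fixes g :: "real \<Rightarrow> 'a::{real_normed_field, banach, second_countable_topology}"
  assumes "integrable LI g"
  shows "integrable LI (\<lambda>t. if t \<le> x then g t else 0)"
proof -
  have "integrable LI (\<lambda>t. (if t \<le> x then 1 else 0) * g t)"
    by (rule integrable_LI_mult_bounded[where B = 1]) (use assms in auto)
  also have "(\<lambda>t. (if t \<le> x then 1 else 0) * g t) = (\<lambda>t. if t \<le> x then g t else 0)"
    by auto
  finally show ?thesis .
qed

lemma prim_integrable: "integrable LI g \<Longrightarrow> integrable LI (prim g)"
  using kernel_integrable[OF triangle_kernel_measurable, of 1 g] by (simp add: prim_kernel[abs_def])

lemma prim_measurable: "integrable LI g \<Longrightarrow> prim g \<in> borel_measurable LI"
  using prim_integrable by auto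

lemma prim_bound:
  assumes "integrable LI g" shows "cmod (prim g x) \<le> (LINT t|LI. cmod (g t))"
proof -
  have "cmod (prim g x) \<le> (LINT t|LI. cmod (if t \<le> x then g t else 0))"
    unfolding prim_def by simp
  also have "\<dots> \<le> (LINT t|LI. cmod (g t))"
    using integrable_norm[OF integrable_cut[OF assms, of x]] assms by (intro integral_mono) auto
  finally show ?thesis .
qed

lemma prim_L2: "integrable LI g \<Longrightarrow> L2_on (prim g)"
  by (rule L2_bounded[OF prim_measurable prim_bound])

lemma prim_m1: "integrable LI g \<Longrightarrow> prim g (-1) = 0"
proof -
  assume g: "integrable LI g"
  have "prim g (-1) = (LINT t|LI. 0)"
    unfolding prim_def
  proof (rule integral_cong_AE)
    show "AE t in LI. (if t \<le> -1 then g t else 0) = 0"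
      using AE_LI_neq[of "-1"] AE_space[of LI] by eventually_elim auto
  qed (use g in auto)
  then show ?thesis
    by simp
qed

text \<open>The two cut-offs differ only between \<open>x\<close> and \<open>y\<close>. The window
  centred at \<open>x\<close> is larger than that interval, but once its radius is fixed it is
  symmetric in \<open>x\<close> and \<open>t\<close>, as the Poincare estimate below
  requires.\<close>

lemma prim_diff_bound:
  assumes g: "integrable LI g"
  shows "cmod (prim g x - prim g y) \<le> (LINT t|LI. (if \<bar>t - x\<bar> \<le> \<bar>x - y\<bar> then cmod (g t) else 0))"
proof -
  have [measurable]: "g \<in> borel_measurable LI"
    using g by auto
  have *: "(\<lambda>t. if \<bar>t - x\<bar> \<le> \<bar>x - y\<bar> then cmod (g t) else 0) = (\<lambda>t. (if \<bar>t - x\<bar> \<le> \<bar>x - y\<bar> then 1 else 0) * cmod (g t))"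
    by auto
  have int: "integrable LI (\<lambda>t. if \<bar>t - x\<bar> \<le> \<bar>x - y\<bar> then cmod (g t) else 0)"
    unfolding * by (rule integrable_LI_mult_bounded[where B = 1]) (use g in auto)
  have "prim g x - prim g y = (LINT t|LI. (if t \<le> x then g t else 0) - (if t \<le> y then g t else 0))"
    unfolding prim_def using g by (simp add: integrable_cut)
  also have "cmod \<dots> \<le> (LINT t|LI. cmod ((if t \<le> x then g t else 0) - (if t \<le> y then g t else 0)))"
    by simp
  also have "\<dots> \<le> (LINT t|LI. (if \<bar>t - x\<bar> \<le> \<bar>x - y\<bar> then cmod (g t) else 0))"
    by (rule integral_mono[OF _ int]) (use g in \<open>auto simp: integrable_cut\<close>)
  finally show ?thesis .
qed

lemma prim_eq_integral:
  assumes g: "integrable LI g" and x: "x \<in> II"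
  shows "g integrable_on II" "prim g x = integral {-1..x} g"
proof -
  have gi: "set_integrable lborel II g"
    using g by (simp add: set_integrable_LI)
  then show "g integrable_on II"
    by (rule set_borel_integral_eq_integral(1))
  have gx: "set_integrable lborel {-1..x} g"
    by (rule set_integrable_subset[OF gi]) (use x in auto)
  have "prim g x = (LINT t:II|lborel. (if t \<le> x then g t else 0))"
    by (simp add: prim_def set_integral_LI)
  also have "\<dots> = (LINT t:{-1..x}|lborel. g t)"
    unfolding set_lebesgue_integral_def using x
    by (intro Bochner_Integration.integral_cong) (auto split: split_indicator)
  also have "\<dots> = integral {-1..x} g"
    by (rule set_borel_integral_eq_integral(2)[OF gx])
  finally show "prim g x = integral {-1..x} g" .
qed

lemma prim_continuous_on:
  assumes g: "integrable LI g"
  shows "continuous_on II (prim g)"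
proof -
  have "continuous_on II (\<lambda>x. integral {-1..x} g)"
    by (rule indefinite_integral_continuous_1) (use prim_eq_integral(1)[OF g, of 0] in auto)
  then show ?thesis
    by (rule continuous_on_eq) (use prim_eq_integral(2)[OF g] in auto)
qed

lemma prim_has_vector_derivative:
  assumes g: "continuous_on II g" and x: "x \<in> II"
  shows "(prim g has_vector_derivative g x) (at x within II)"
proof (rule has_vector_derivative_transform[OF x _ integral_has_vector_derivative[OF g x]])
  show "prim g y = integral {-1..y} g" if "y \<in> II" for y
    by (rule prim_eq_integral(2)[OF integrable_LI_continuous[OF g] that])
qed

lemma prim_of_derivative:
  assumes a: "continuous_on II a" and A: "\<And>x. x \<in> II \<Longrightarrow> (A has_vector_derivative a x) (at x within II)"
    and x: "x \<in> II"
  shows "A x = A (-1) + prim a x"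
proof -
  have "(a has_integral (A x - A (-1))) {-1..x}"
  proof (rule fundamental_theorem_of_calculus)
    show "(A has_vector_derivative a y) (at y within {-1..x})" if "y \<in> {-1..x}" for y
      by (rule has_vector_derivative_within_subset[OF A]) (use x that in auto)
  qed (use x in auto)
  then have "integral {-1..x} a = A x - A (-1)"
    by (rule integral_unique)
  then show ?thesis
    by (simp add: prim_eq_integral(2)[OF integrable_LI_continuous[OF a] x])
qed

text \<open>Integrable \<open>a\<close> and \<open>g\<close> have primitives that are differentiable
  only almost everywhere, so the identity comes from Fubini on the triangle
  \<open>r \<le> s \<le> x\<close> and not from differentiating a product. The constant \<alpha> is
  the value at -1 of the absolutely continuous factor.\<close>

lemma integration_by_parts_cut:
  assumes a: "integrable LI a" and g: "integrable LI g"
  shows "(LINT s|LI. (if s \<le> x then (\<alpha> + prim a s) * g s else 0))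
       + (LINT s|LI. (if s \<le> x then a s * prim g s else 0)) = (\<alpha> + prim a x) * prim g x"
proof -
  let ?g = "\<lambda>s. if s \<le> x then g s else 0"
  let ?k = "\<lambda>s r. if r \<le> s then 1 else (0::complex)"
  have gi: "integrable LI ?g" and ai: "integrable LI (\<lambda>s. if s \<le> x then a s else 0)"
    using g a by auto
  have i1: "integrable LI (\<lambda>s. ?g s * prim a s)"
    using integrable_LI_mult_bounded[OF prim_measurable[OF a] prim_bound[OF a] gi] by (simp add: mult.commute)
  have i2: "integrable LI (\<lambda>s. if s \<le> x then a s * prim g s else 0)"
    using integrable_LI_mult_bounded[OF prim_measurable[OF g] prim_bound[OF g] ai]
    by (rule Bochner_Integration.integrable_cong[THEN iffD1, OF refl, rotated]) (auto simp: mult.commute)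
  have i3: "integrable LI (\<lambda>r. a r * (LINT s|LI. ?k s r * ?g s))"
  proof -
    have "integrable LI (\<lambda>r. (LINT s|LI. v s * (?k s r * a r)))" if "integrable LI v" for v
      using LI2.integrable_snd[OF kernel_product_integrable[OF triangle_kernel_measurable _ a that, of 1]] by simp
    from this[OF gi] show ?thesis
      by (rule Bochner_Integration.integrable_cong[THEN iffD1, OF refl, rotated])
         (simp only: integral_mult_right_zero[symmetric] mult_ac)
  qed
  have swap: "(LINT s|LI. ?g s * prim a s) = (LINT r|LI. a r * (LINT s|LI. ?k s r * ?g s))"
    using kernel_swap[OF triangle_kernel_measurable _ a gi, of 1] by (simp add: prim_kernel)
  \<comment> \<open>For \<open>r \<le> x\<close> the inner integral of \<open>g\<close> runs over
    \<open>[r, x]\<close>, and \<open>prim g r\<close> supplies \<open>[-1, r]\<close>; they overlap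
    in a single point.\<close>
  have key: "a r * (LINT s|LI. ?k s r * ?g s) + (if r \<le> x then a r * prim g r else 0)
      = (if r \<le> x then a r else 0) * prim g x" for r
  proof (cases "r \<le> x")
    case True
    have "(LINT s|LI. ?k s r * ?g s) + prim g r = (LINT s|LI. ?k s r * ?g s + (if s \<le> r then g s else 0))"
      unfolding prim_def
      by (subst Bochner_Integration.integral_add)
         (use g gi in \<open>auto intro!: integrable_LI_mult_bounded[where B = 1]\<close>)
    also have "\<dots> = (LINT s|LI. ?g s)"
    proof (rule integral_cong_AE)
      have [measurable]: "g \<in> borel_measurable LI"
        using g by auto
      show "(\<lambda>s. ?k s r * ?g s + (if s \<le> r then g s else 0)) \<in> borel_measurable LI"
        by measurable
      show "?g \<in> borel_measurable LI"
        by measurable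
      show "AE s in LI. ?k s r * ?g s + (if s \<le> r then g s else 0) = ?g s"
        by (rule AE_mp[OF AE_LI_neq[of r]], rule AE_I2) (use True in auto)
    qed
    also have "\<dots> = prim g x"
      by (simp add: prim_def)
    finally show ?thesis
      using True by (simp add: distrib_left[symmetric])
  next
    case False
    have "(LINT s|LI. ?k s r * ?g s) = (LINT s|LI. 0)"
      using False by (intro Bochner_Integration.integral_cong) auto
    then show ?thesis
      using False by simp
  qed
  have 1: "(LINT s|LI. (if s \<le> x then (\<alpha> + prim a s) * g s else 0)) = \<alpha> * prim g x + (LINT s|LI. ?g s * prim a s)"
  proof -
    have "(LINT s|LI. (if s \<le> x then (\<alpha> + prim a s) * g s else 0)) = (LINT s|LI. \<alpha> * ?g s + ?g s * prim a s)"
      by (intro Bochner_Integration.integral_cong) (auto simp: algebra_simps)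
    then show ?thesis
      using gi i1 by (simp add: prim_def)
  qed
  have "(LINT s|LI. ?g s * prim a s) + (LINT s|LI. (if s \<le> x then a s * prim g s else 0))
      = (LINT r|LI. a r * (LINT s|LI. ?k s r * ?g s) + (if r \<le> x then a r * prim g r else 0))"
    unfolding swap by (rule Bochner_Integration.integral_add[OF i3 i2, symmetric])
  also have "\<dots> = (LINT r|LI. (if r \<le> x then a r else 0) * prim g x)"
    by (intro Bochner_Integration.integral_cong key refl)
  also have "\<dots> = prim a x * prim g x"
    by (simp add: prim_def)
  finally show ?thesis
    unfolding 1 by (simp add: algebra_simps)
qed

lemma integration_by_parts:
  assumes "integrable LI a" "integrable LI g"
  shows "(LINT s|LI. (\<alpha> + prim a s) * g s) + (LINT s|LI. a s * prim g s) = (\<alpha> + prim a 1) * prim g 1"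
proof -
  have "(LINT s|LI. (if s \<le> 1 then (\<alpha> + prim a s) * g s else 0)) = (LINT s|LI. (\<alpha> + prim a s) * g s)"
    "(LINT s|LI. (if s \<le> 1 then a s * prim g s else 0)) = (LINT s|LI. a s * prim g s)"
    by (auto intro!: Bochner_Integration.integral_cong)
  then show ?thesis
    using integration_by_parts_cut[OF assms, of 1 \<alpha>] by simp
qed

section \<open>A lower bound for the integral operator, uniform in the frequency\<close>

lemma continuous_kernel_measurable:
  fixes k :: "real \<Rightarrow> real \<Rightarrow> 'a::real_normed_vector"
  assumes "continuous_on (II \<times> II) (case_prod k)"
  shows "case_prod k \<in> borel_measurable (LI \<Otimes>\<^sub>M LI)"
proof -
  have m: "(\<lambda>z. indicator (II \<times> II) z *\<^sub>R case_prod k z) \<in> borel_measurable borel"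
    by (rule borel_measurable_continuous_on_indicator[OF _ assms])
       (auto intro!: borel_closed closed_Times)
  have id: "(\<lambda>z. (fst z, snd z)) \<in> borel_measurable (LI \<Otimes>\<^sub>M LI)"
    unfolding borel_prod[symmetric] by (intro measurable_Pair measurable_fst_LI measurable_snd_LI)
  have "(\<lambda>z. indicator (II \<times> II) z *\<^sub>R case_prod k z) \<in> borel_measurable (LI \<Otimes>\<^sub>M LI)"
    using measurable_compose[OF id m] by simp
  then show ?thesis
    by (rule measurable_cong[THEN iffD1, rotated]) (auto simp: space_pair_measure)
qed

lemma l2norm_le_sup:
  assumes "u \<in> borel_measurable LI" "\<And>x. x \<in> II \<Longrightarrow> cmod (u x) \<le> c"
  shows "l2norm u \<le> 2 * c"
proof -
  have c: "c \<ge> 0"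
    using order_trans[OF norm_ge_zero assms(2)[of 0]] by simp
  have "l2norm u \<le> l2norm (\<lambda>_. complex_of_real c)"
    using assms c by (intro l2norm_mono L2_bounded[where B = c]) auto
  also have "\<dots> = sqrt 2 * c"
    using c by (simp add: l2norm_LI real_sqrt_mult)
  also have "\<dots> \<le> 2 * c"
    using c by (intro mult_right_mono) (auto simp: real_le_lsqrt)
  finally show ?thesis .
qed

text \<open>A Volterra operator has norm at most one half with respect to a suitable exponential weight,
  whatever the size of its kernel.\<close>

lemma weighted_lower_bound:
  fixes \<omega> :: "real \<Rightarrow> real"
  assumes k: "case_prod k \<in> borel_measurable (LI \<Otimes>\<^sub>M LI)" "\<And>s t. s \<in> II \<Longrightarrow> t \<in> II \<Longrightarrow> cmod (k s t) \<le> B * \<theta> s t"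
    and \<theta>: "case_prod \<theta> \<in> borel_measurable (LI \<Otimes>\<^sub>M LI)" "\<And>s t. 0 \<le> \<theta> s t" "\<And>s t. \<theta> s t \<le> 1"
    and \<omega>: "\<omega> \<in> borel_measurable LI" "\<And>s. s \<in> II \<Longrightarrow> a \<le> \<omega> s" "\<And>s. s \<in> II \<Longrightarrow> \<omega> s \<le> b" "0 < a"
    and dom: "\<And>t. t \<in> II \<Longrightarrow> 8 * B^2 * (LINT s|LI. \<theta> s t * (\<omega> s)^2) \<le> (\<omega> t)^2"
    and B: "B \<ge> 0" and u: "L2_on u"
  shows "l2norm u \<le> 2 * b / a * l2norm (\<lambda>s. u s - (LINT t|LI. k s t * u t))"
proof -
  define T where "T = (\<lambda>s. LINT t|LI. k s t * u t)"
  define w where "w = (\<lambda>s. complex_of_real (\<omega> s))"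
  have k1: "cmod (k s t) \<le> B" if "s \<in> II" "t \<in> II" for s t
    using k(2)[OF that] mult_left_mono[OF \<theta>(3)[of s t] B] by simp
  have wm: "w \<in> borel_measurable LI"
    using \<omega>(1) by (simp add: w_def)
  have wb: "cmod (w s) \<le> b" "cmod (w s) = \<omega> s" "\<omega> s > 0" if "s \<in> II" for s
    using \<omega>(2-4) that unfolding w_def by fastforce+
  have b: "b \<ge> 0"
    using order_trans[OF norm_ge_zero wb(1)[of 0]] by simp
  have TL2: "L2_on T"
    unfolding T_def by (rule kernel_L2[OF k(1) k1 L2_integrable[OF u]])
  have \<theta>1: "norm (\<theta> s t) \<le> 1" for s t
    using \<theta>(2,3)[of s t] by simp
  have sqi: "integrable LI (\<lambda>t. (cmod (u t))^2)"
    by (rule L2_sq_integrable[OF u])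
  have \<omega>i: "integrable LI (\<lambda>s. (\<omega> s)^2)"
  proof (rule integrable_LI_bounded)
    show "norm ((\<omega> s)^2) \<le> b^2" if "s \<in> II" for s
      using wb[OF that] by (auto intro!: power_mono)
  qed (use \<omega>(1) in auto)
  \<comment> \<open>Cauchy-Schwarz against the constant 1, whose squared norm is 2. Since \<theta>
    takes values in \<open>[0, 1]\<close>, its square can be replaced by \<theta>.\<close>
  have pt: "(cmod (T s))^2 \<le> 2 * B^2 * (LINT t|LI. \<theta> s t * (cmod (u t))^2)" if s: "s \<in> II" for s
  proof -
    have L: "L2_on (\<lambda>t. k s t * u t)"
      by (rule L2_mult_bounded[OF kernel_section_measurable[OF k(1) s] k1[OF s] u])
    have "cmod (T s) \<le> l2norm (\<lambda>t. k s t * u t) * l2norm (\<lambda>_. 1)"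
      using l2_Cauchy_Schwarz[OF L L2_bounded[of "\<lambda>_. 1" 1]] by (simp add: T_def)
    then have "(cmod (T s))^2 \<le> (l2norm (\<lambda>t. k s t * u t) * l2norm (\<lambda>_. 1))^2"
      by (rule power_mono) simp
    also have "\<dots> = 2 * (LINT t|LI. (cmod (k s t * u t))^2)"
      unfolding power_mult_distrib l2norm_sq by simp
    also have "\<dots> \<le> 2 * (LINT t|LI. B^2 * (\<theta> s t * (cmod (u t))^2))"
    proof (intro mult_left_mono integral_mono)
      show "integrable LI (\<lambda>t. (cmod (k s t * u t))^2)"
        by (rule L2_sq_integrable[OF L])
      show "integrable LI (\<lambda>t. B^2 * (\<theta> s t * (cmod (u t))^2))"
        by (intro integrable_mult_right kernel_section_integrable[OF \<theta>(1) \<theta>1 sqi s])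
      fix t assume t: "t \<in> space LI"
      have "(cmod (k s t))^2 \<le> (B * \<theta> s t)^2"
        using k(2)[OF s, of t] t by (intro power_mono) auto
      also have "\<dots> \<le> B^2 * \<theta> s t"
        unfolding power_mult_distrib
        by (rule mult_left_mono) (use \<theta>(2,3)[of s t] in \<open>auto simp: power2_eq_square mult_left_le\<close>)
      finally have "(cmod (k s t))^2 * (cmod (u t))^2 \<le> B^2 * \<theta> s t * (cmod (u t))^2"
        by (rule mult_right_mono) simp
      then show "(cmod (k s t * u t))^2 \<le> B^2 * (\<theta> s t * (cmod (u t))^2)"
        by (simp add: norm_mult power_mult_distrib mult_ac)
    qed simp
    finally show ?thesis
      by simp
  qed
  have wu: "L2_on (\<lambda>s. w s * u s)" and wT: "L2_on (\<lambda>s. w s * T s)" and wd: "L2_on (\<lambda>s. w s * (u s - T s))"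
    by (intro L2_mult_bounded[OF wm wb(1)] u TL2 L2_diff; assumption)+
  \<comment> \<open>After Fubini the weight appears integrated against \<theta> in \<open>s\<close>,
    where \<open>dom\<close> bounds it by its value at \<open>t\<close>. The 8 in \<open>dom\<close>
    turns \<open>2 B^2\<close> into the factor 1/4, so the weighted norm of \<open>T u\<close> is at
    most half that of \<open>u\<close> and can be absorbed.\<close>
  have "(l2norm (\<lambda>s. w s * T s))^2 \<le> (LINT s|LI. (\<omega> s)^2 * (2 * B^2 * (LINT t|LI. \<theta> s t * (cmod (u t))^2)))"
    unfolding l2norm_sq
  proof (rule integral_mono[OF L2_sq_integrable[OF wT]])
    have "integrable LI (\<lambda>s. (\<omega> s)^2 * (LINT t|LI. \<theta> s t * (cmod (u t))^2))"
    proof (rule integrable_LI_mult_bounded[OF _ _ kernel_integrable[OF \<theta>(1) \<theta>1 sqi]])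
      show "norm ((\<omega> s)^2) \<le> b^2" if "s \<in> II" for s
        using wb[OF that] by (auto intro!: power_mono)
    qed (use \<omega>(1) in auto)
    then have "integrable LI (\<lambda>s. 2 * B^2 * ((\<omega> s)^2 * (LINT t|LI. \<theta> s t * (cmod (u t))^2)))"
      by (rule integrable_mult_right)
    then show "integrable LI (\<lambda>s. (\<omega> s)^2 * (2 * B^2 * (LINT t|LI. \<theta> s t * (cmod (u t))^2)))"
      by (simp only: mult_ac)
    fix s assume "s \<in> space LI"
    then show "(cmod (w s * T s))^2 \<le> (\<omega> s)^2 * (2 * B^2 * (LINT t|LI. \<theta> s t * (cmod (u t))^2))"
      using pt[of s] wb[of s] by (auto simp: norm_mult power_mult_distrib intro!: mult_left_mono)
  qed
  also have "\<dots> = 2 * B^2 * (LINT s|LI. (\<omega> s)^2 * (LINT t|LI. \<theta> s t * (cmod (u t))^2))"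
    by (simp only: mult.left_commute[of "(\<omega> _)^2"] integral_mult_right_zero)
  also have "\<dots> = 2 * B^2 * (LINT t|LI. (cmod (u t))^2 * (LINT s|LI. \<theta> s t * (\<omega> s)^2))"
    using kernel_swap[OF \<theta>(1) \<theta>1 sqi \<omega>i] by simp
  also have "\<dots> = (LINT t|LI. 2 * B^2 * ((cmod (u t))^2 * (LINT s|LI. \<theta> s t * (\<omega> s)^2)))"
    by simp
  also have "\<dots> \<le> (LINT t|LI. (cmod (w t * u t))^2 / 4)"
  proof (rule integral_mono')
    show "integrable LI (\<lambda>t. (cmod (w t * u t))^2 / 4)"
      using L2_sq_integrable[OF wu] by simp
    fix t assume "t \<in> space LI"
    then have t: "t \<in> II"
      by simp
    have "(cmod (u t))^2 * (8 * B^2 * (LINT s|LI. \<theta> s t * (\<omega> s)^2)) \<le> (cmod (u t))^2 * (\<omega> t)^2"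
      by (intro mult_left_mono dom t) simp
    then show "2 * B^2 * ((cmod (u t))^2 * (LINT s|LI. \<theta> s t * (\<omega> s)^2)) \<le> (cmod (w t * u t))^2 / 4"
      using wb[OF t] by (simp add: norm_mult power_mult_distrib mult_ac)
  qed simp
  also have "\<dots> = (l2norm (\<lambda>s. w s * u s) / 2)^2"
    by (simp add: power_divide l2norm_sq)
  finally have "l2norm (\<lambda>s. w s * T s) \<le> l2norm (\<lambda>s. w s * u s) / 2"
    by (rule power2_le_imp_le) simp
  moreover have "l2norm (\<lambda>s. w s * u s) \<le> l2norm (\<lambda>s. w s * (u s - T s)) + l2norm (\<lambda>s. w s * T s)"
    using l2norm_triangle[OF wd wT] by (simp add: algebra_simps)
  ultimately have *: "l2norm (\<lambda>s. w s * u s) \<le> 2 * l2norm (\<lambda>s. w s * (u s - T s))"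
    by simp
  \<comment> \<open>Returning to the unweighted norm on both sides costs the ratio
    \<open>b / a\<close>.\<close>
  have "inverse (w s) * (w s * u s) = u s" if "s \<in> II" for s
    using wb(3)[OF that] by (simp add: w_def)
  then have "l2norm u = l2norm (\<lambda>s. inverse (w s) * (w s * u s))"
    by (intro l2norm_cong) metis
  also have "\<dots> \<le> inverse a * l2norm (\<lambda>s. w s * u s)"
  proof (rule l2norm_mult_le[OF wu])
    show "cmod (inverse (w s)) \<le> inverse a" if "s \<in> II" for s
      using \<omega>(2)[OF that] wb(2)[OF that] \<omega>(4) by (simp add: norm_inverse le_imp_inverse_le)
  qed (use wm \<omega>(4) in auto)
  also have "\<dots> \<le> inverse a * (2 * (b * l2norm (\<lambda>s. u s - T s)))"
    using * l2norm_mult_le[OF L2_diff[OF u TL2] wm wb(1) b] \<omega>(4) by (intro mult_left_mono) auto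
  finally show ?thesis
    unfolding T_def by (simp add: field_simps)
qed

text \<open>This verifies the domination condition on exponential weights. The sign of
  \<open>c\<close> is left open because the two Volterra parts need weights of opposite
  monotonicity.\<close>

lemma exp_cut_integral:
  fixes c :: real
  assumes "t \<in> II"
  shows "(LINT s|LI. (if s \<le> t then c * exp (c * s) else 0)) = exp (c * t) - exp (- c)"
proof -
  have "complex_of_real (exp (c * t)) = complex_of_real (exp (c * (-1))) + prim (\<lambda>s. complex_of_real (c * exp (c * s))) t"
  proof (rule prim_of_derivative[OF _ _ assms])
    show "((\<lambda>x. complex_of_real (exp (c * x))) has_vector_derivative complex_of_real (c * exp (c * x))) (at x within II)" for x
      by (rule has_vector_derivative_of_real) (auto intro!: derivative_eq_intros simp: has_real_derivative_iff_has_vector_derivative[symmetric])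
  qed (auto intro!: continuous_intros)
  moreover have "prim (\<lambda>s. complex_of_real (c * exp (c * s))) t = complex_of_real (LINT s|LI. (if s \<le> t then c * exp (c * s) else 0))"
    unfolding prim_def integral_complex_of_real[symmetric] by (intro Bochner_Integration.integral_cong) auto
  ultimately have "complex_of_real (exp (c * t)) = complex_of_real (exp (- c) + (LINT s|LI. (if s \<le> t then c * exp (c * s) else 0)))"
    by simp
  then show ?thesis
    unfolding of_real_eq_iff by simp
qed

lemma exp_integral: "(LINT s|LI. c * exp (c * s)) = exp c - exp (- c)" for c :: real
proof -
  have "(LINT s|LI. c * exp (c * s)) = (LINT s|LI. (if s \<le> 1 then c * exp (c * s) else 0))"
    by (intro Bochner_Integration.integral_cong) auto
  then show ?thesis
    using exp_cut_integral[of 1 c] by simp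
qed

text \<open>For a kernel living on \<open>s \<le> t\<close> the weight must increase: the integral
  of \<open>c exp (c s)\<close> over \<open>s \<le> t\<close> is below \<open>exp (c t)\<close>,
  which is the domination condition for \<open>c = 8 B^2\<close>. The weight
  \<open>exp (c s / 2)\<close> varies by a factor \<open>exp c\<close> over the interval, whence the
  constant.\<close>

lemma volterra_lower_bound_right:
  assumes k: "case_prod k \<in> borel_measurable (LI \<Otimes>\<^sub>M LI)" "\<And>s t. s \<in> II \<Longrightarrow> t \<in> II \<Longrightarrow> cmod (k s t) \<le> B"
    and supp: "\<And>s t. t < s \<Longrightarrow> k s t = 0"
    and B: "B > 0" and u: "L2_on u"
  shows "l2norm u \<le> 2 * exp (8 * B^2) * l2norm (\<lambda>s. u s - (LINT t|LI. k s t * u t))"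
proof -
  define c where "c = 8 * B^2"
  have c: "c > 0"
    using B by (simp add: c_def)
  have "l2norm u \<le> 2 * exp (c / 2) / exp (- (c / 2)) * l2norm (\<lambda>s. u s - (LINT t|LI. k s t * u t))"
  proof (rule weighted_lower_bound[where \<omega> = "\<lambda>s. exp (c * s / 2)" and \<theta> = "\<lambda>s t. if s \<le> t then 1 else 0" and B = B, OF k(1)])
    show "(\<lambda>(s, t). if s \<le> t then 1 else (0::real)) \<in> borel_measurable (LI \<Otimes>\<^sub>M LI)"
      unfolding case_prod_beta' by measurable
    show "exp (- (c / 2)) \<le> exp (c * s / 2)" "exp (c * s / 2) \<le> exp (c / 2)" if "s \<in> II" for s
    proof -
      have "c * (-1) \<le> c * s" "c * s \<le> c * 1"
        by (rule mult_left_mono; use that c in simp)+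
      then show "exp (- (c / 2)) \<le> exp (c * s / 2)" "exp (c * s / 2) \<le> exp (c / 2)"
        by auto
    qed
    fix t :: real assume t: "t \<in> II"
    have "8 * B^2 * (LINT s|LI. (if s \<le> t then 1 else 0) * (exp (c * s / 2))^2)
        = (LINT s|LI. (if s \<le> t then c * exp (c * s) else 0))"
      unfolding c_def[symmetric] integral_mult_right_zero[symmetric]
      by (intro Bochner_Integration.integral_cong) (auto simp: exp_double[symmetric])
    also have "\<dots> \<le> (exp (c * t / 2))^2"
      by (simp add: exp_cut_integral[OF t] exp_double[symmetric])
    finally show "8 * B^2 * (LINT s|LI. (if s \<le> t then 1 else 0) * (exp (c * s / 2))^2) \<le> (exp (c * t / 2))^2" .
  qed (use k(2) supp B u in \<open>auto simp: borel_measurable_LI_of_borel\<close>)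
  also have "2 * exp (c / 2) / exp (- (c / 2)) = 2 * exp c"
    by (simp add: exp_minus field_simps exp_double[symmetric] power2_eq_square[symmetric])
  finally show ?thesis
    by (simp add: c_def)
qed

text \<open>Mirror image: on \<open>t < s\<close> the decreasing weight satisfies the domination
  condition.\<close>

lemma volterra_lower_bound_left:
  assumes k: "case_prod k \<in> borel_measurable (LI \<Otimes>\<^sub>M LI)" "\<And>s t. s \<in> II \<Longrightarrow> t \<in> II \<Longrightarrow> cmod (k s t) \<le> B"
    and supp: "\<And>s t. s \<le> t \<Longrightarrow> k s t = 0"
    and B: "B > 0" and u: "L2_on u"
  shows "l2norm u \<le> 2 * exp (8 * B^2) * l2norm (\<lambda>s. u s - (LINT t|LI. k s t * u t))"
proof -
  define c where "c = 8 * B^2"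
  have c: "c > 0"
    using B by (simp add: c_def)
  have "l2norm u \<le> 2 * exp (c / 2) / exp (- (c / 2)) * l2norm (\<lambda>s. u s - (LINT t|LI. k s t * u t))"
  proof (rule weighted_lower_bound[where \<omega> = "\<lambda>s. exp (- c * s / 2)" and \<theta> = "\<lambda>s t. if s \<le> t then 0 else 1" and B = B, OF k(1)])
    show "(\<lambda>(s, t). if s \<le> t then 0 else (1::real)) \<in> borel_measurable (LI \<Otimes>\<^sub>M LI)"
      unfolding case_prod_beta' by measurable
    show "exp (- (c / 2)) \<le> exp (- c * s / 2)" "exp (- c * s / 2) \<le> exp (c / 2)" if "s \<in> II" for s
    proof -
      have "c * (-1) \<le> c * s" "c * s \<le> c * 1"
        by (rule mult_left_mono; use that c in simp)+
      then show "exp (- (c / 2)) \<le> exp (- c * s / 2)" "exp (- c * s / 2) \<le> exp (c / 2)"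
        by auto
    qed
    fix t :: real assume t: "t \<in> II"
    have i: "integrable LI (\<lambda>s. - c * exp (- c * s))"
      by (intro integrable_LI_continuous continuous_intros)
    \<comment> \<open>The part \<open>s > t\<close> is written as cut integral minus full integral
      of \<open>- c exp (- c s)\<close>, so that the formulas for exponent \<open>- c\<close>
      apply.\<close>
    have "8 * B^2 * (LINT s|LI. (if s \<le> t then 0 else 1) * (exp (- c * s / 2))^2)
        = (LINT s|LI. (if s \<le> t then - c * exp (- c * s) else 0) - (- c * exp (- c * s)))"
      unfolding c_def[symmetric] integral_mult_right_zero[symmetric]
      by (intro Bochner_Integration.integral_cong) (auto simp: exp_double[symmetric])
    also have "\<dots> = exp (- c * t) - exp c - (exp (- c) - exp c)"
      using exp_cut_integral[OF t, of "- c"] exp_integral[of "- c"]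
      by (subst Bochner_Integration.integral_diff[OF integrable_cut[OF i] i]) simp
    also have "\<dots> \<le> (exp (- c * t / 2))^2"
      by (simp add: exp_double[symmetric])
    finally show "8 * B^2 * (LINT s|LI. (if s \<le> t then 0 else 1) * (exp (- c * s / 2))^2) \<le> (exp (- c * t / 2))^2" .
  qed (use k(2) supp B u in \<open>auto simp: borel_measurable_LI_of_borel\<close>)
  also have "2 * exp (c / 2) / exp (- (c / 2)) = 2 * exp c"
    by (simp add: exp_minus field_simps exp_double[symmetric] power2_eq_square[symmetric])
  finally show ?thesis
    by (simp add: c_def)
qed

section \<open>Splitting the kernel at the diagonal\<close>

locale C1_kernel =
  fixes K Ks Kt :: "real \<Rightarrow> real \<Rightarrow> complex" and B :: real
  assumes B_pos: "B > 0"
    and cont: "continuous_on (II \<times> II) (case_prod K)" "continuous_on (II \<times> II) (case_prod Ks)"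
      "continuous_on (II \<times> II) (case_prod Kt)"
    and deriv_s: "\<And>s t. s \<in> II \<Longrightarrow> t \<in> II \<Longrightarrow> ((\<lambda>s'. K s' t) has_vector_derivative Ks s t) (at s within II)"
    and deriv_t: "\<And>s t. s \<in> II \<Longrightarrow> t \<in> II \<Longrightarrow> ((\<lambda>t'. K s t') has_vector_derivative Kt s t) (at t within II)"
    and bounds: "\<And>s t. s \<in> II \<Longrightarrow> t \<in> II \<Longrightarrow> cmod (K s t) \<le> B"
      "\<And>s t. s \<in> II \<Longrightarrow> t \<in> II \<Longrightarrow> cmod (Ks s t) \<le> B"
      "\<And>s t. s \<in> II \<Longrightarrow> t \<in> II \<Longrightarrow> cmod (Kt s t) \<le> B"
begin

lemma cont_section:
  assumes "x \<in> II"
  shows "continuous_on II (\<lambda>s. K s x)" "continuous_on II (\<lambda>t. K x t)"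
    "continuous_on II (\<lambda>s. Ks s x)" "continuous_on II (\<lambda>t. Kt x t)"
proof -
  have p: "continuous_on II (\<lambda>s. (s, x))" "continuous_on II (\<lambda>t. (x, t))"
    by (auto intro!: continuous_intros)
  have "(\<lambda>s. (s, x)) ` II \<subseteq> II \<times> II" "(\<lambda>t. (x, t)) ` II \<subseteq> II \<times> II"
    using assms by auto
  then show "continuous_on II (\<lambda>s. K s x)" "continuous_on II (\<lambda>t. K x t)"
    "continuous_on II (\<lambda>s. Ks s x)" "continuous_on II (\<lambda>t. Kt x t)"
    using continuous_on_compose2[OF cont(1) p(1)] continuous_on_compose2[OF cont(1) p(2)]
      continuous_on_compose2[OF cont(2) p(1)] continuous_on_compose2[OF cont(3) p(2)] by auto
qed

text \<open>On either side of the diagonal the phase \<open>|s - t|\<close> is linear. The diagonal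
  itself goes to \<open>k2\<close>, so the two kernels add up to the original one
  everywhere.\<close>

definition k1 :: "real \<Rightarrow> real \<Rightarrow> real \<Rightarrow> complex" where
  "k1 \<kappa> s t = (if s \<le> t then 0 else K s t * cis (\<kappa> * (s - t)))"

definition k2 :: "real \<Rightarrow> real \<Rightarrow> real \<Rightarrow> complex" where
  "k2 \<kappa> s t = (if s \<le> t then K s t * cis (\<kappa> * (t - s)) else 0)"

lemma k_measurable:
  "case_prod (k1 \<kappa>) \<in> borel_measurable (LI \<Otimes>\<^sub>M LI)" "case_prod (k2 \<kappa>) \<in> borel_measurable (LI \<Otimes>\<^sub>M LI)"
proof -
  have [measurable]: "(\<lambda>z. K (fst z) (snd z)) \<in> borel_measurable (LI \<Otimes>\<^sub>M LI)"
    using continuous_kernel_measurable[OF cont(1)] by (simp add: case_prod_beta')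
  have [measurable]: "(\<lambda>z. cis (\<kappa> * (fst z - snd z))) \<in> borel_measurable (LI \<Otimes>\<^sub>M LI)"
    "(\<lambda>z. cis (\<kappa> * (snd z - fst z))) \<in> borel_measurable (LI \<Otimes>\<^sub>M LI)"
  proof -
    have "continuous_on (II \<times> II) (\<lambda>z. cis (\<kappa> * (fst z - snd z)))" "continuous_on (II \<times> II) (\<lambda>z. cis (\<kappa> * (snd z - fst z)))"
      by (intro continuous_intros)+
    from this(1)[THEN continuous_kernel_measurable[of "\<lambda>s t. cis (\<kappa> * (s - t))", unfolded case_prod_beta']]
      this(2)[THEN continuous_kernel_measurable[of "\<lambda>s t. cis (\<kappa> * (t - s))", unfolded case_prod_beta']]
    show "(\<lambda>z. cis (\<kappa> * (fst z - snd z))) \<in> borel_measurable (LI \<Otimes>\<^sub>M LI)"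
      "(\<lambda>z. cis (\<kappa> * (snd z - fst z))) \<in> borel_measurable (LI \<Otimes>\<^sub>M LI)" .
  qed
  show "case_prod (k1 \<kappa>) \<in> borel_measurable (LI \<Otimes>\<^sub>M LI)" "case_prod (k2 \<kappa>) \<in> borel_measurable (LI \<Otimes>\<^sub>M LI)"
    unfolding case_prod_beta' k1_def k2_def by measurable
qed

lemma k_bound: "s \<in> II \<Longrightarrow> t \<in> II \<Longrightarrow> cmod (k1 \<kappa> s t) \<le> B" "s \<in> II \<Longrightarrow> t \<in> II \<Longrightarrow> cmod (k2 \<kappa> s t) \<le> B"
  using bounds(1)[of s t] B_pos by (auto simp: k1_def k2_def norm_mult)

definition T1 :: "real \<Rightarrow> (real \<Rightarrow> complex) \<Rightarrow> real \<Rightarrow> complex" where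
  "T1 \<kappa> u s = (LINT t|LI. k1 \<kappa> s t * u t)"

definition T2 :: "real \<Rightarrow> (real \<Rightarrow> complex) \<Rightarrow> real \<Rightarrow> complex" where
  "T2 \<kappa> u s = (LINT t|LI. k2 \<kappa> s t * u t)"

lemma T_L2: "integrable LI u \<Longrightarrow> L2_on (T1 \<kappa> u)" "integrable LI u \<Longrightarrow> L2_on (T2 \<kappa> u)"
  unfolding T1_def[abs_def] T2_def[abs_def] by (rule kernel_L2[OF k_measurable(1) k_bound(1)] kernel_L2[OF k_measurable(2) k_bound(2)]; assumption)+

lemma Kop_eq:
  assumes "integrable LI u" "s \<in> II"
  shows "Kop K \<kappa> u s = T1 \<kappa> u s + T2 \<kappa> u s"
proof -
  have "Kop K \<kappa> u s = (LINT t|LI. K s t * exp (\<i> * of_real \<kappa> * of_real \<bar>s - t\<bar>) * u t)"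
    by (simp add: Kop_def set_integral_LI)
  also have "\<dots> = (LINT t|LI. k1 \<kappa> s t * u t + k2 \<kappa> s t * u t)"
    by (intro Bochner_Integration.integral_cong) (auto simp: k1_def k2_def cis_conv_exp abs_real_def mult_ac)
  also have "\<dots> = T1 \<kappa> u s + T2 \<kappa> u s"
    unfolding T1_def T2_def using assms
    by (intro Bochner_Integration.integral_add kernel_section_integrable[OF k_measurable(1) k_bound(1)]
         kernel_section_integrable[OF k_measurable(2) k_bound(2)])
  finally show ?thesis .
qed

lemma Kop_L2: "L2_on u \<Longrightarrow> L2_on (Kop K \<kappa> u)"
  using L2_add[OF T_L2(1) T_L2(2), OF L2_integrable L2_integrable, of u u \<kappa> \<kappa>]
    L2_cong[of "Kop K \<kappa> u" "\<lambda>s. T1 \<kappa> u s + T2 \<kappa> u s"] Kop_eq[OF L2_integrable] by blast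

text \<open>This is the kernel of \<open>T1 T2\<close> at \<open>(s, \<tau>)\<close>. Both factors
  are nonzero only for \<open>t < s\<close> and \<open>t \<le> \<tau>\<close>, where the phases
  \<open>\<kappa> (s - t)\<close> and \<open>\<kappa> (\<tau> - t)\<close> add. The integrand is a
  C1 amplitude times an oscillation of frequency \<open>2 \<kappa>\<close> in \<open>t\<close>, and
  one integration by parts gains \<open>1 / \<kappa>\<close>.\<close>

lemma oscillating_kernel_bound:
  assumes \<kappa>: "\<kappa> > 0" and s: "s \<in> II" and \<tau>: "\<tau> \<in> II"
  shows "cmod (LINT t|LI. k2 \<kappa> t \<tau> * k1 \<kappa> s t) \<le> 5 * B^2 / \<kappa>"
proof -
  \<comment> \<open>The common support of both factors is \<open>t \<le> c\<close>, up to the single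
    point \<open>t = s\<close>.\<close>
  define c where "c = min s \<tau>"
  have c: "c \<in> II"
    using s \<tau> by (auto simp: c_def)
  define A where "A = (\<lambda>t. K t \<tau> * K s t)"
  define a where "a = (\<lambda>t. Ks t \<tau> * K s t + K t \<tau> * Kt s t)"
  define g where "g = (\<lambda>t. cis (- 2 * \<kappa> * t))"
  have ac: "continuous_on II a"
    unfolding a_def using cont_section[OF s] cont_section[OF \<tau>] by (intro continuous_intros)
  have ai: "integrable LI a"
    by (rule integrable_LI_continuous[OF ac])
  have gc: "continuous_on II g"
    unfolding g_def by (intro continuous_intros)
  have gi: "integrable LI g"
    by (rule integrable_LI_continuous[OF gc])
  have A: "A x = A (-1) + prim a x" if "x \<in> II" for x
  proof (rule prim_of_derivative[OF ac _ that])
    show "(A has_vector_derivative a x) (at x within II)" if "x \<in> II" for x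
      unfolding A_def a_def
      using has_vector_derivative_mult[OF deriv_s[OF that \<tau>] deriv_t[OF s that]]
      by (simp add: add.commute)
  qed
  have BB: "x * y \<le> B^2" if "x \<le> B" "y \<le> B" "y \<ge> 0" for x y
    using mult_mono[OF that(1,2)] that(3) B_pos by (simp add: power2_eq_square)
  have Ab: "cmod (A x) \<le> B^2" if "x \<in> II" for x
    unfolding A_def norm_mult by (intro BB bounds s \<tau> that norm_ge_zero)
  have ab: "cmod (a x) \<le> 2 * B^2" if "x \<in> II" for x
  proof -
    have "cmod (a x) \<le> cmod (Ks x \<tau>) * cmod (K s x) + cmod (K x \<tau>) * cmod (Kt s x)"
      unfolding a_def by (rule order_trans[OF norm_triangle_ineq]) (simp add: norm_mult)
    also have "\<dots> \<le> B^2 + B^2"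
      by (intro add_mono BB bounds s \<tau> that norm_ge_zero)
    finally show ?thesis
      by simp
  qed
  have pg: "cmod (prim g x) \<le> 1 / \<kappa>" if "x \<in> II" for x
  proof -
    \<comment> \<open>Explicit antiderivative of \<open>g\<close>, of modulus
      \<open>1 / (2 \<kappa>)\<close>; the difference of two values gives
      \<open>1 / \<kappa>\<close>.\<close>
    define G where "G = (\<lambda>t. cis (- 2 * \<kappa> * t) * (\<i> / (2 * \<kappa>)))"
    have "(G has_vector_derivative g t) (at t within II)" for t
    proof -
      have "((\<lambda>z. exp (- 2 * \<i> * \<kappa> * z) * (\<i> / (2 * \<kappa>))) has_field_derivative exp (- 2 * \<i> * \<kappa> * of_real t)) (at (of_real t))"
        using \<kappa> by (auto intro!: derivative_eq_intros)
      from has_vector_derivative_real_field[OF this, of II] show ?thesis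
        by (simp add: G_def g_def cis_conv_exp mult_ac)
    qed
    then have "G x = G (-1) + prim g x"
      using prim_of_derivative[OF gc _ that] by blast
    then have "prim g x = G x - G (-1)"
      by simp
    then have "cmod (prim g x) \<le> cmod (G x) + cmod (G (-1))"
      using norm_triangle_ineq4 by metis
    also have "\<dots> = 1 / \<kappa>"
      using \<kappa> by (simp add: G_def norm_mult norm_divide)
    finally show ?thesis .
  qed
  have "(LINT t|LI. k2 \<kappa> t \<tau> * k1 \<kappa> s t) = (LINT t|LI. cis (\<kappa> * (s + \<tau>)) * (if t \<le> c then (A (-1) + prim a t) * g t else 0))"
  proof (rule integral_cong_AE)
    show "(\<lambda>t. k2 \<kappa> t \<tau> * k1 \<kappa> s t) \<in> borel_measurable LI"
      by (intro borel_measurable_times kernel_section_measurable[OF k_measurable(1) s] kernel_section_measurable2[OF k_measurable(2) \<tau>])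
    have [measurable]: "prim a \<in> borel_measurable LI" "g \<in> borel_measurable LI"
      using prim_measurable[OF ai] gi by auto
    show "(\<lambda>t. cis (\<kappa> * (s + \<tau>)) * (if t \<le> c then (A (-1) + prim a t) * g t else 0)) \<in> borel_measurable LI"
      by measurable
    have "k2 \<kappa> t \<tau> * k1 \<kappa> s t = cis (\<kappa> * (s + \<tau>)) * (if t \<le> c then (A (-1) + prim a t) * g t else 0)"
      if "t \<in> II" "t \<noteq> s" for t
    proof -
      have "cis (\<kappa> * (\<tau> - t)) * cis (\<kappa> * (s - t)) = cis (\<kappa> * (s + \<tau>)) * g t"
        by (simp add: g_def cis_mult algebra_simps)
      then show ?thesis
        unfolding A[OF \<open>t \<in> II\<close>, symmetric] using \<open>t \<noteq> s\<close>
        by (auto simp: k1_def k2_def A_def c_def mult_ac)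
    qed
    then have "AE t in LI. t \<noteq> s \<longrightarrow> k2 \<kappa> t \<tau> * k1 \<kappa> s t = cis (\<kappa> * (s + \<tau>)) * (if t \<le> c then (A (-1) + prim a t) * g t else 0)"
      by (intro AE_I2) simp
    then show "AE t in LI. k2 \<kappa> t \<tau> * k1 \<kappa> s t = cis (\<kappa> * (s + \<tau>)) * (if t \<le> c then (A (-1) + prim a t) * g t else 0)"
      by (rule AE_mp[OF AE_LI_neq[of s]])
  qed
  also have "cmod \<dots> = cmod (LINT t|LI. (if t \<le> c then (A (-1) + prim a t) * g t else 0))"
    by (simp add: norm_mult)
  also have "(LINT t|LI. (if t \<le> c then (A (-1) + prim a t) * g t else 0))
      = A c * prim g c - (LINT t|LI. (if t \<le> c then a t * prim g t else 0))"
    using integration_by_parts_cut[OF ai gi, of c "A (-1)"] A[OF c] by (simp add: algebra_simps)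
  also have "cmod \<dots> \<le> cmod (A c * prim g c) + cmod (LINT t|LI. (if t \<le> c then a t * prim g t else 0))"
    by (rule norm_triangle_ineq4)
  \<comment> \<open>One unit of \<open>B^2 / \<kappa>\<close> from the boundary term, and four from
    the derivative bound \<open>2 B^2\<close> over an interval of length 2: hence the 5.\<close>
  also have "\<dots> \<le> B^2 * (1 / \<kappa>) + (LINT t|LI. 2 * B^2 * (1 / \<kappa>))"
  proof (rule add_mono)
    show "cmod (A c * prim g c) \<le> B^2 * (1 / \<kappa>)"
      unfolding norm_mult using \<kappa> by (intro mult_mono Ab pg c) auto
    have "cmod (LINT t|LI. (if t \<le> c then a t * prim g t else 0)) \<le> (LINT t|LI. cmod (if t \<le> c then a t * prim g t else 0))"
      by simp
    also have "\<dots> \<le> (LINT t|LI. 2 * B^2 * (1 / \<kappa>))"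
    proof (rule integral_mono')
      fix t assume "t \<in> space LI"
      then have "cmod (a t) * cmod (prim g t) \<le> 2 * B^2 * (1 / \<kappa>)"
        by (intro mult_mono ab pg) (auto simp: \<kappa>)
      then show "cmod (if t \<le> c then a t * prim g t else 0) \<le> 2 * B^2 * (1 / \<kappa>)"
        using \<kappa> by (auto simp: norm_mult)
    qed (use \<kappa> in auto)
    finally show "cmod (LINT t|LI. (if t \<le> c then a t * prim g t else 0)) \<le> (LINT t|LI. 2 * B^2 * (1 / \<kappa>))" .
  qed
  finally show ?thesis
    by (simp add: integral_LI_const)
qed

text \<open>The constant 20 is the 5 of the kernel bound, doubled in passing from the L1 to the L2
  norm of \<open>u\<close> and doubled again in passing from the supremum to the L2 norm of the
  result.\<close>

lemma T1_T2_small: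
  assumes \<kappa>: "\<kappa> > 0" and u: "L2_on u"
  shows "l2norm (T1 \<kappa> (T2 \<kappa> u)) \<le> 20 * B^2 / \<kappa> * l2norm u"
proof -
  have ui: "integrable LI u"
    by (rule L2_integrable[OF u])
  have "cmod (T1 \<kappa> (T2 \<kappa> u) s) \<le> 10 * B^2 / \<kappa> * l2norm u" if s: "s \<in> II" for s
  proof -
    have k1i: "integrable LI (k1 \<kappa> s)"
      by (rule integrable_LI_bounded[OF kernel_section_measurable[OF k_measurable(1) s] k_bound(1)[OF s]])
    define J where "J = (\<lambda>\<tau>. LINT t|LI. k2 \<kappa> t \<tau> * k1 \<kappa> s t)"
    have J: "cmod (J \<tau>) \<le> 5 * B^2 / \<kappa>" if "\<tau> \<in> II" for \<tau>
      unfolding J_def by (rule oscillating_kernel_bound[OF \<kappa> s that])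
    have "T1 \<kappa> (T2 \<kappa> u) s = (LINT \<tau>|LI. u \<tau> * J \<tau>)"
      unfolding T1_def T2_def J_def by (rule kernel_swap[OF k_measurable(2) k_bound(2) ui k1i])
    also have "cmod \<dots> \<le> (LINT \<tau>|LI. cmod (u \<tau> * J \<tau>))"
      by (rule integral_norm_bound)
    also have "\<dots> \<le> (LINT \<tau>|LI. 5 * B^2 / \<kappa> * cmod (u \<tau>))"
    proof (rule integral_mono')
      show "integrable LI (\<lambda>\<tau>. 5 * B^2 / \<kappa> * cmod (u \<tau>))"
        by (intro integrable_mult_right integrable_norm ui)
    next
      fix \<tau> assume "\<tau> \<in> space LI"
      then have "\<tau> \<in> II"
        by simp
      from mult_right_mono[OF J[OF this] norm_ge_zero[of "u \<tau>"]]
      show "cmod (u \<tau> * J \<tau>) \<le> 5 * B^2 / \<kappa> * cmod (u \<tau>)"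
        unfolding norm_mult by (simp only: mult.commute)
      show "0 \<le> 5 * B^2 / \<kappa> * cmod (u \<tau>)"
        using \<kappa> by simp
    qed
    also have "\<dots> = 5 * B^2 / \<kappa> * (LINT \<tau>|LI. cmod (u \<tau>))"
      by simp
    also have "\<dots> \<le> 5 * B^2 / \<kappa> * (2 * l2norm u)"
      using \<kappa> by (intro mult_left_mono integral_abs_le_l2norm[OF u]) auto
    finally show ?thesis
      by simp
  qed
  from l2norm_le_sup[OF L2_measurable[OF T_L2(1)[OF L2_integrable[OF T_L2(2)[OF ui]]]] this]
  show ?thesis
    by simp
qed

text \<open>The two Volterra bounds are chained, each costing a factor \<open>C\<close>. The
  threshold for \<kappa> makes the contribution \<open>20 B^2 C^2 / \<kappa>\<close> of
  \<open>T1 T2\<close> at most 1/2; absorbing it doubles \<open>C^2\<close>.\<close>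

lemma Kop_lower_bound:
  defines "C \<equiv> 2 * exp (8 * B^2)"
  assumes \<kappa>: "\<kappa> \<ge> 40 * B^2 * C^2" and u: "L2_on u"
  shows "l2norm u \<le> 2 * C^2 * l2norm (\<lambda>s. u s - Kop K \<kappa> u s)"
proof -
  have C: "C > 0"
    by (simp add: C_def)
  have "0 < 40 * B^2 * C^2"
    using B_pos C by simp
  then have k0: "\<kappa> > 0"
    using \<kappa> by linarith
  have ui: "integrable LI u"
    by (rule L2_integrable[OF u])
  have T2u: "L2_on (T2 \<kappa> u)"
    by (rule T_L2(2)[OF ui])
  define v where "v = (\<lambda>s. u s - T2 \<kappa> u s)"
  have v: "L2_on v"
    unfolding v_def by (rule L2_diff[OF u T2u])
  have Tu: "L2_on (T1 \<kappa> (T2 \<kappa> u))"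
    by (rule T_L2(1)[OF L2_integrable[OF T2u]])
  have r: "L2_on (\<lambda>s. u s - Kop K \<kappa> u s)"
    by (rule L2_diff[OF u Kop_L2[OF u]])
  have 1: "l2norm u \<le> C * l2norm v"
    unfolding C_def v_def T2_def
    by (rule volterra_lower_bound_right[OF k_measurable(2) k_bound(2) _ B_pos u]) (auto simp: k2_def)
  have 2: "l2norm v \<le> C * l2norm (\<lambda>s. v s - T1 \<kappa> v s)"
    unfolding C_def T1_def
    by (rule volterra_lower_bound_left[OF k_measurable(1) k_bound(1) _ B_pos v]) (auto simp: k1_def)
  \<comment> \<open>The factorization of \<open>I - K + T1 T2\<close>, applied to \<open>u\<close>
    with \<open>v = (I - T2) u\<close>.\<close>
  have "v s - T1 \<kappa> v s = (u s - Kop K \<kappa> u s) + T1 \<kappa> (T2 \<kappa> u) s" if s: "s \<in> II" for s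
  proof -
    have "T1 \<kappa> v s = T1 \<kappa> u s - T1 \<kappa> (T2 \<kappa> u) s"
      unfolding T1_def v_def right_diff_distrib
      by (intro Bochner_Integration.integral_diff kernel_section_integrable[OF k_measurable(1) k_bound(1) _ s] ui L2_integrable[OF T2u])
    then show ?thesis
      by (simp add: v_def Kop_eq[OF ui s])
  qed
  then have "l2norm (\<lambda>s. v s - T1 \<kappa> v s) = l2norm (\<lambda>s. (u s - Kop K \<kappa> u s) + T1 \<kappa> (T2 \<kappa> u) s)"
    by (intro l2norm_cong) auto
  also have "\<dots> \<le> l2norm (\<lambda>s. u s - Kop K \<kappa> u s) + 20 * B^2 / \<kappa> * l2norm u"
    using l2norm_triangle[OF r Tu] T1_T2_small[OF k0 u] by linarith
  finally have 3: "l2norm (\<lambda>s. v s - T1 \<kappa> v s) \<le> l2norm (\<lambda>s. u s - Kop K \<kappa> u s) + 20 * B^2 / \<kappa> * l2norm u" .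
  have "l2norm u \<le> C * (C * (l2norm (\<lambda>s. u s - Kop K \<kappa> u s) + 20 * B^2 / \<kappa> * l2norm u))"
    by (rule order_trans[OF 1 mult_left_mono[OF order_trans[OF 2 mult_left_mono[OF 3]]]]) (use C in auto)
  also have "\<dots> = C^2 * l2norm (\<lambda>s. u s - Kop K \<kappa> u s) + (20 * B^2 * C^2 / \<kappa>) * l2norm u"
    by (simp add: power2_eq_square algebra_simps)
  also have "\<dots> \<le> C^2 * l2norm (\<lambda>s. u s - Kop K \<kappa> u s) + 1 / 2 * l2norm u"
    using \<kappa> k0 by (intro add_left_mono mult_right_mono) (auto simp: field_simps)
  finally show ?thesis
    by simp
qed

end

lemma C_mixed_imp_C1_kernel:
  assumes "C_mixed m K" "m > 0"
  obtains Ks Kt B where "C1_kernel K Ks Kt B"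
proof -
  obtain D where D:
    "D 0 0 = K"
    "\<forall>\<beta><m. \<forall>s\<in>II. \<forall>t\<in>II. ((\<lambda>t'. D 0 \<beta> s t') has_vector_derivative D 0 (Suc \<beta>) s t) (at t within II)"
    "\<forall>\<alpha><m. \<forall>\<beta>\<le>m. \<forall>s\<in>II. \<forall>t\<in>II. ((\<lambda>s'. D \<alpha> \<beta> s' t) has_vector_derivative D (Suc \<alpha>) \<beta> s t) (at s within II)"
    "\<forall>\<alpha>\<le>m. \<forall>\<beta>\<le>m. continuous_on (II \<times> II) (\<lambda>(s,t). D \<alpha> \<beta> s t)"
    using assms(1) unfolding C_mixed_def by (elim exE conjE) (rule that)
  note D = D(1) D(2-4)[rule_format]
  have ex: "\<exists>B. \<forall>s\<in>II. \<forall>t\<in>II. cmod (D \<alpha> \<beta> s t) \<le> B" if "\<alpha> \<le> m" "\<beta> \<le> m" for \<alpha> \<beta>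
  proof -
    have "compact ((\<lambda>(s,t). D \<alpha> \<beta> s t) ` (II \<times> II))"
      by (intro compact_continuous_image D(4) that compact_Times) auto
    then obtain B where B: "\<forall>z \<in> (\<lambda>(s,t). D \<alpha> \<beta> s t) ` (II \<times> II). cmod z \<le> B"
      using compact_imp_bounded bounded_iff by blast
    then have "\<forall>s\<in>II. \<forall>t\<in>II. cmod (D \<alpha> \<beta> s t) \<le> B"
      by (simp add: image_iff)
    then show ?thesis
      by (rule exI)
  qed
  obtain B0 where B0: "\<forall>s\<in>II. \<forall>t\<in>II. cmod (D 0 0 s t) \<le> B0"
    using ex[of 0 0] assms(2) by auto
  obtain B1 where B1: "\<forall>s\<in>II. \<forall>t\<in>II. cmod (D 1 0 s t) \<le> B1"
    using ex[of 1 0] assms(2) by auto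
  obtain B2 where B2: "\<forall>s\<in>II. \<forall>t\<in>II. cmod (D 0 1 s t) \<le> B2"
    using ex[of 0 1] assms(2) by auto
  \<comment> \<open>One constant for the kernel and both first derivatives, so that the operator
    bounds see the kernel through \<open>B\<close> alone; the 1 in the maximum ensures
    \<open>B > 0\<close>.\<close>
  have "C1_kernel K (D 1 0) (D 0 1) (max 1 (max B0 (max B1 B2)))"
  proof
    fix s t :: real assume st: "s \<in> II" "t \<in> II"
    show "((\<lambda>s'. K s' t) has_vector_derivative D 1 0 s t) (at s within II)"
      using D(3)[of 0 0 s t] D(1) assms(2) st by simp
    show "((\<lambda>t'. K s t') has_vector_derivative D 0 1 s t) (at t within II)"
      using D(2)[of 0 s t] D(1) assms(2) st by simp
    show "cmod (K s t) \<le> max 1 (max B0 (max B1 B2))" "cmod (D 1 0 s t) \<le> max 1 (max B0 (max B1 B2))"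
      "cmod (D 0 1 s t) \<le> max 1 (max B0 (max B1 B2))"
      using B0[rule_format, OF st] B1[rule_format, OF st] B2[rule_format, OF st] D(1) by (auto simp: le_max_iff_disj)
  next
    show "continuous_on (II \<times> II) (case_prod K)" "continuous_on (II \<times> II) (case_prod (D 1 0))"
      "continuous_on (II \<times> II) (case_prod (D 0 1))"
      using D(4)[of 0 0] D(4)[of 1 0] D(4)[of 0 1] assms(2) unfolding D(1) by simp_all
  qed simp
  then show thesis
    by (rule that)
qed

section \<open>Test functions and weak derivatives\<close>

text \<open>The smoothness half of \<open>test_fn\<close>, kept apart from the support condition so
  that bumps and antiderivatives can be treated before their support is placed inside the
  interval.\<close>

definition smooth_fun :: "(real \<Rightarrow> real) \<Rightarrow> bool" where
  "smooth_fun f \<longleftrightarrow> (\<forall>k x. ((deriv ^^ k) f has_real_derivative (deriv ^^ Suc k) f x) (at x))"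

text \<open>A family closed under differentiation consists of smooth functions. This avoids any
  formula for derivatives of higher order.\<close>

lemma smooth_fun_invariant:
  assumes "f \<in> S" and S: "\<And>f. f \<in> S \<Longrightarrow> \<exists>f'\<in>S. \<forall>x. (f has_real_derivative f' x) (at x)"
  shows "smooth_fun f"
proof -
  have d: "deriv f \<in> S \<and> (\<forall>x. (f has_real_derivative deriv f x) (at x))" if f: "f \<in> S" for f
  proof -
    obtain f' where f': "f' \<in> S" "\<And>x. (f has_real_derivative f' x) (at x)"
      using S[OF f] by blast
    then have "deriv f = f'"
      by (auto intro!: DERIV_imp_deriv)
    then show ?thesis
      using f' by blast
  qed
  have "(deriv ^^ k) f \<in> S" for k
    by (induction k) (auto simp: \<open>f \<in> S\<close> d)
  then show ?thesis
    unfolding smooth_fun_def using d by auto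
qed

lemma smooth_fun_antideriv:
  assumes g: "smooth_fun g" and f: "\<And>x. (f has_real_derivative g x) (at x)"
  shows "smooth_fun f"
proof -
  have df: "deriv f = g"
    using f by (auto intro!: DERIV_imp_deriv)
  have s: "(deriv ^^ Suc k) f = (deriv ^^ k) g" for k
    by (simp only: funpow_Suc_right o_apply df)
  show ?thesis
    unfolding smooth_fun_def
  proof (intro allI)
    fix k x
    show "((deriv ^^ k) f has_real_derivative (deriv ^^ Suc k) f x) (at x)"
    proof (cases k)
      case 0
      then show ?thesis
        using f df by simp
    next
      case (Suc n)
      then show ?thesis
        using g unfolding Suc s smooth_fun_def by blast
    qed
  qed
qed

lemma smooth_fun_deriv: "smooth_fun f \<Longrightarrow> smooth_fun (deriv f)"
  unfolding smooth_fun_def by (metis comp_apply funpow_Suc_right)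

lemma smooth_fun_has_deriv: "smooth_fun f \<Longrightarrow> (f has_real_derivative deriv f x) (at x)"
  unfolding smooth_fun_def by (metis funpow_0 funpow_simps_right(2) comp_apply)

lemma smooth_fun_lincomb:
  assumes "smooth_fun f" "smooth_fun g"
  shows "smooth_fun (\<lambda>x. a * f x + b * g x)"
proof (rule smooth_fun_invariant[where S = "{\<lambda>x. a * f x + b * g x | f g. smooth_fun f \<and> smooth_fun g}"])
  fix h assume "h \<in> {\<lambda>x. a * f x + b * g x | f g. smooth_fun f \<and> smooth_fun g}"
  then obtain f g where h: "h = (\<lambda>x. a * f x + b * g x)" and fg: "smooth_fun f" "smooth_fun g"
    by blast
  show "\<exists>h'\<in>{\<lambda>x. a * f x + b * g x | f g. smooth_fun f \<and> smooth_fun g}. \<forall>x. (h has_real_derivative h' x) (at x)"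
  proof (intro bexI allI)
    show "(\<lambda>x. a * deriv f x + b * deriv g x) \<in> {\<lambda>x. a * f x + b * g x | f g. smooth_fun f \<and> smooth_fun g}"
      using smooth_fun_deriv fg by blast
    show "(h has_real_derivative a * deriv f x + b * deriv g x) (at x)" for x
      unfolding h by (intro DERIV_add DERIV_cmult smooth_fun_has_deriv fg)
  qed
qed (use assms in blast)

text \<open>Derivatives of the bump function \<open>exp (- e / ((x - a) * (b - x)))\<close> stay in this family.\<close>

definition bump :: "real \<Rightarrow> real \<Rightarrow> real \<Rightarrow> real poly \<Rightarrow> nat \<Rightarrow> real \<Rightarrow> real" where
  "bump e a b p k x = (if a < x \<and> x < b
     then poly p x / ((x - a) * (b - x)) ^ k * exp (- e / ((x - a) * (b - x))) else 0)"

text \<open>A single term of the exponential series, \<open>y^n / n! \<le> exp y\<close> with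
  \<open>y = e / q\<close>. Taking \<open>n = k + 2\<close> leaves two spare powers of
  \<open>q\<close>, which give quadratic decay at the ends of the support.\<close>

lemma power_exp_bound:
  assumes "(0::real) < e" "0 < q"
  shows "exp (- e / q) / q ^ k \<le> fact (k + 2) / e ^ (k + 2) * q^2"
proof -
  define y where "y = e / q"
  have y: "y > 0"
    using assms by (simp add: y_def)
  define n F where "n = k + 2" and "F = (fact n :: real)"
  have F: "F > 0"
    by (simp add: F_def)
  have "(\<Sum>i\<in>{n}. inverse (fact i) *\<^sub>R y ^ i) \<le> suminf (\<lambda>i. inverse (fact i) *\<^sub>R y ^ i)"
    by (rule sum_le_suminf[OF summable_exp_generic]) (use y in auto)
  then have "y ^ n \<le> F * exp y"
    using F by (simp add: exp_def F_def[symmetric] field_simps)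
  then have "exp (- y) * y ^ n \<le> exp (- y) * (F * exp y)"
    by (rule mult_left_mono) simp
  also have "\<dots> = F"
    by (simp add: exp_minus)
  finally have "exp (- y) * y ^ n \<le> F" .
  then have "exp (- e / q) * (e ^ n / q ^ n) \<le> F"
    by (simp add: y_def power_divide)
  then have "exp (- e / q) / q ^ n \<le> F / e ^ n"
    using assms by (simp add: pos_le_divide_eq mult.commute)
  then have "exp (- e / q) / q ^ n * q^2 \<le> F / e ^ n * q^2"
    by (rule mult_right_mono) simp
  moreover have "exp (- e / q) / q ^ n * q^2 = exp (- e / q) / q ^ k"
    using assms by (simp add: n_def power_add power2_eq_square)
  ultimately show ?thesis
    by (simp only: F_def n_def)
qed

text \<open>Handles the points where two formulas are glued: the ends of a bump and the knot of a
  truncated power.\<close>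

lemma DERIV_zero_of_quadratic_bound:
  fixes f :: "real \<Rightarrow> real"
  assumes "f c = 0" "d > 0" "\<And>x. \<bar>x - c\<bar> < d \<Longrightarrow> \<bar>f x\<bar> \<le> C * (x - c)^2"
  shows "(f has_real_derivative 0) (at c)"
proof -
  have "(\<lambda>x. (f x - f c) / (x - c)) \<midarrow>c\<rightarrow> 0"
  proof (rule Lim_null_comparison)
    show "\<forall>\<^sub>F x in at c. norm ((f x - f c) / (x - c)) \<le> C * \<bar>x - c\<bar>"
      unfolding eventually_at
    proof (intro exI[of _ d] conjI ballI impI \<open>d > 0\<close>)
      fix x assume x: "x \<noteq> c \<and> dist x c < d"
      then have "\<bar>f x\<bar> \<le> C * \<bar>x - c\<bar> * \<bar>x - c\<bar>"
        using assms(3)[of x] by (simp add: dist_real_def power2_eq_square)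
      then show "norm ((f x - f c) / (x - c)) \<le> C * \<bar>x - c\<bar>"
        using x assms(1) by (simp add: divide_le_eq)
    qed
    have "((\<lambda>x. C * \<bar>x - c\<bar>) \<longlongrightarrow> C * \<bar>c - c\<bar>) (at c)"
      by (intro tendsto_intros)
    then show "((\<lambda>x. C * \<bar>x - c\<bar>) \<longlongrightarrow> 0) (at c)"
      by simp
  qed
  then show ?thesis
    unfolding has_field_derivative_iff .
qed

text \<open>Inside the support the quotient and chain rules stay within the family; at its ends the
  quadratic decay of the exponential factor gives derivative 0.\<close>

lemma bump_has_derivative:
  assumes e: "e > 0" and ab: "a < b"
  shows "\<exists>p' k'. \<forall>x. (bump e a b p k has_real_derivative bump e a b p' k' x) (at x)"
proof -
  define Q where "Q = [:- (a * b), a + b, -1:]"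
  define q where "q = (\<lambda>x. (x - a) * (b - x))"
  have Q: "poly Q x = q x" for x
    by (simp add: Q_def q_def algebra_simps)
  \<comment> \<open>Numerator of the derivative of \<open>p / q^k exp (- e / q)\<close> over the
    common denominator \<open>q^(k + 2)\<close>.\<close>
  define p' where "p' = pderiv p * Q^2 - smult (of_nat k) (p * pderiv Q * Q) + smult e (p * pderiv Q)"
  obtain P where P: "\<And>x. x \<in> {a..b} \<Longrightarrow> \<bar>poly p x\<bar> \<le> P"
  proof -
    have "compact (poly p ` {a..b})"
      by (intro compact_continuous_image continuous_intros) auto
    then show thesis
      using that by (metis bounded_iff compact_imp_bounded imageI real_norm_def)
  qed
  have P0: "P \<ge> 0"
    using P[of a] ab by auto
  define Z where "Z = P * (fact (k + 2) / e ^ (k + 2))"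
  have Z: "Z \<ge> 0"
    unfolding Z_def using P0 e by simp
  define C where "C = Z * (b - a)^2"
  have C0: "C \<ge> 0"
    using Z by (auto simp: C_def)
  have est: "\<bar>bump e a b p k x\<bar> \<le> Z * (q x)^2" for x
  proof (cases "a < x \<and> x < b")
    case True
    then have qx: "q x > 0"
      by (simp add: q_def)
    have "bump e a b p k x = poly p x / q x ^ k * exp (- e / q x)"
      using True by (simp add: bump_def q_def)
    then have "\<bar>bump e a b p k x\<bar> = \<bar>poly p x\<bar> * (exp (- e / q x) / q x ^ k)"
      using qx by (simp add: abs_mult)
    also have "\<dots> \<le> P * (fact (k + 2) / e ^ (k + 2) * (q x)^2)"
      using P[of x] True P0 qx by (intro mult_mono power_exp_bound e) auto
    finally show ?thesis
      unfolding Z_def by (simp only: mult.assoc)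
  next
    case False
    then have "bump e a b p k x = 0"
      by (auto simp: bump_def)
    then show ?thesis
      using Z by simp
  qed
  have bnd: "\<bar>bump e a b p k x\<bar> \<le> C * (x - a)^2" "\<bar>bump e a b p k x\<bar> \<le> C * (x - b)^2" for x
  proof -
    have "\<bar>bump e a b p k x\<bar> \<le> C * (x - a)^2 \<and> \<bar>bump e a b p k x\<bar> \<le> C * (x - b)^2"
    proof (cases "a < x \<and> x < b")
      case True
      have "(q x)^2 \<le> (b - a)^2 * (x - a)^2"
        unfolding q_def power_mult_distrib[symmetric] using True
        by (intro power_mono) (auto simp: mult.commute[of "x - a"] intro!: mult_right_mono)
      moreover have "(q x)^2 \<le> (b - a)^2 * (b - x)^2"
        unfolding q_def power_mult_distrib[symmetric] using True
        by (intro power_mono) (auto intro!: mult_right_mono)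
      ultimately have "Z * (q x)^2 \<le> Z * ((b - a)^2 * (x - a)^2)" "Z * (q x)^2 \<le> Z * ((b - a)^2 * (b - x)^2)"
        using Z by (auto intro!: mult_left_mono)
      then show ?thesis
        using order_trans[OF est[of x]] unfolding C_def by (simp only: mult.assoc power2_commute[of x b])
    next
      case False
      then have "bump e a b p k x = 0"
        by (auto simp: bump_def)
      then show ?thesis
        using C0 by simp
    qed
    then show "\<bar>bump e a b p k x\<bar> \<le> C * (x - a)^2" "\<bar>bump e a b p k x\<bar> \<le> C * (x - b)^2"
      by auto
  qed
  have "(bump e a b p k has_real_derivative bump e a b p' (k + 2) x) (at x)" for x
  proof -
    consider "x = a" | "x = b" | "x < a \<or> b < x" | "a < x" "x < b"
      by linarith
    then show ?thesis
    proof cases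
      case 1
      have "(bump e a b p k has_real_derivative 0) (at a)"
        by (rule DERIV_zero_of_quadratic_bound[OF _ zero_less_one bnd(1)]) (simp add: bump_def)
      then show ?thesis
        using 1 by (simp add: bump_def)
    next
      case 2
      have "(bump e a b p k has_real_derivative 0) (at b)"
        by (rule DERIV_zero_of_quadratic_bound[OF _ zero_less_one bnd(2)]) (simp add: bump_def)
      then show ?thesis
        using 2 by (simp add: bump_def)
    next
      case 3
      have "((\<lambda>_. 0) has_real_derivative 0) (at x)"
        by simp
      moreover have "open ({..<a} \<union> {b<..})"
        by auto
      ultimately have "(bump e a b p k has_real_derivative 0) (at x)"
        by (rule has_field_derivative_transform_within_open[where S = "{..<a} \<union> {b<..}"]) (use 3 in \<open>auto simp: bump_def\<close>)
      then show ?thesis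
        using 3 by (auto simp: bump_def)
    next
      case 4
      then have qx: "q x > 0"
        by (simp add: q_def)
      have dq: "(q has_real_derivative poly (pderiv Q) x) (at x)"
        using poly_DERIV[of Q x] unfolding Q .
      have "((\<lambda>x. poly p x / q x ^ k * exp (- e / q x)) has_real_derivative
           poly p' x / q x ^ (k + 2) * exp (- e / q x)) (at x)"
      proof -
        have "((\<lambda>x. poly p x / q x ^ k * exp (- e / q x)) has_real_derivative
          ((poly (pderiv p) x * q x ^ k - poly p x * (of_nat k * (poly (pderiv Q) x * q x ^ (k - Suc 0)))) / (q x ^ k * q x ^ k)) * exp (- e / q x)
           + exp (- e / q x) * (e * poly (pderiv Q) x / (q x * q x)) * (poly p x / q x ^ k)) (at x)"
        proof (rule DERIV_mult[OF DERIV_divide[OF poly_DERIV DERIV_power[OF dq]]])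
          show "((\<lambda>x. exp (- e / q x)) has_real_derivative exp (- e / q x) * (e * poly (pderiv Q) x / (q x * q x))) (at x)"
            using qx by (auto intro!: derivative_eq_intros dq)
        qed (use qx in simp)
        moreover have "((poly (pderiv p) x * q x ^ k - poly p x * (of_nat k * (poly (pderiv Q) x * q x ^ (k - Suc 0)))) / (q x ^ k * q x ^ k)) * exp (- e / q x)
           + exp (- e / q x) * (e * poly (pderiv Q) x / (q x * q x)) * (poly p x / q x ^ k) = poly p' x / q x ^ (k + 2) * exp (- e / q x)"
        proof -
          \<comment> \<open>The factor \<open>of_nat k\<close> keeps this true for
            \<open>k = 0\<close>, where the exponent is truncated.\<close>
          have k: "of_nat k * q x ^ (k - Suc 0) * q x = of_nat k * q x ^ k"
            by (cases k) auto
          have "(poly (pderiv p) x * q x ^ k - poly p x * (of_nat k * (poly (pderiv Q) x * q x ^ (k - Suc 0)))) / (q x ^ k * q x ^ k)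
            = (poly (pderiv p) x * (q x)^2 - of_nat k * (poly p x * poly (pderiv Q) x * q x)) / q x ^ (k + 2)"
          proof -
            have "(poly (pderiv p) x * q x ^ k - poly p x * (of_nat k * (poly (pderiv Q) x * q x ^ (k - Suc 0)))) * q x ^ (k + 2)
              = (poly (pderiv p) x * q x ^ k - poly p x * (of_nat k * (poly (pderiv Q) x * q x ^ (k - Suc 0)))) * q x * (q x ^ k * q x)"
              by (simp add: power_add power2_eq_square)
            also have "(poly (pderiv p) x * q x ^ k - poly p x * (of_nat k * (poly (pderiv Q) x * q x ^ (k - Suc 0)))) * q x
              = poly (pderiv p) x * q x ^ k * q x - poly p x * poly (pderiv Q) x * (of_nat k * q x ^ (k - Suc 0) * q x)"
              by (simp add: algebra_simps)
            also have "\<dots> * (q x ^ k * q x) = (poly (pderiv p) x * (q x)^2 - of_nat k * (poly p x * poly (pderiv Q) x * q x)) * (q x ^ k * q x ^ k)"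
              unfolding k by (simp add: algebra_simps power2_eq_square)
            finally show ?thesis
              using qx by (simp add: frac_eq_eq)
          qed
          then show ?thesis
            using qx by (simp add: p'_def Q power_add power2_eq_square add_divide_distrib distrib_left distrib_right mult_ac)
        qed
        ultimately show ?thesis
          by simp
      qed
      then have "(bump e a b p k has_real_derivative poly p' x / q x ^ (k + 2) * exp (- e / q x)) (at x)"
        by (rule has_field_derivative_transform_within_open[where S = "{a<..<b}"]) (use 4 in \<open>auto simp: bump_def q_def\<close>)
      then show ?thesis
        using 4 by (simp add: bump_def q_def)
    qed
  qed
  then show ?thesis
    by blast
qed

lemma smooth_bump: "e > 0 \<Longrightarrow> a < b \<Longrightarrow> smooth_fun (bump e a b p k)"
  by (rule smooth_fun_invariant[where S = "{bump e a b p k | p k. True}"]) (use bump_has_derivative in blast)+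

lemma bump_outside: "x \<le> a \<or> b \<le> x \<Longrightarrow> bump e a b p k x = 0"
  by (auto simp: bump_def)

lemma bump_le_1: "e > 0 \<Longrightarrow> \<bar>bump e a b 1 0 x\<bar> \<le> 1"
  by (auto simp: bump_def)

lemma smooth_fun_continuous: "smooth_fun f \<Longrightarrow> continuous_on S f"
  by (meson DERIV_continuous_on has_field_derivative_at_within smooth_fun_has_deriv)

lemma smooth_fun_measurable: "smooth_fun f \<Longrightarrow> f \<in> borel_measurable borel"
  by (intro borel_measurable_continuous_onI smooth_fun_continuous)

lemma test_fn_iff:
  "test_fn \<phi> \<longleftrightarrow> smooth_fun \<phi> \<and> (\<exists>a b. -1 < a \<and> b < 1 \<and> (\<forall>x. x \<notin> {a..b} \<longrightarrow> \<phi> x = 0))"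
  by (simp add: test_fn_def smooth_fun_def)

lemma test_fn_deriv:
  assumes "test_fn \<phi>"
  shows "test_fn (deriv \<phi>)"
proof -
  obtain a b where ab: "-1 < a" "b < 1" and z: "\<And>x. x \<notin> {a..b} \<Longrightarrow> \<phi> x = 0" and s: "smooth_fun \<phi>"
    using assms unfolding test_fn_iff by auto
  have "deriv \<phi> x = 0" if "x \<notin> {a..b}" for x
  proof -
    have "((\<lambda>_. 0) has_real_derivative 0) (at x)"
      by simp
    then have "(\<phi> has_real_derivative 0) (at x)"
      by (rule has_field_derivative_transform_within_open[where S = "- {a..b}"]) (use that z in auto)
    then show ?thesis
      by (rule DERIV_imp_deriv)
  qed
  then show ?thesis
    unfolding test_fn_iff using smooth_fun_deriv[OF s] ab by blast
qed

text \<open>Vanishing mean is what makes the primitive return to 0 on the right of the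
  support.\<close>

lemma test_fn_antiderivative:
  assumes \<psi>: "smooth_fun \<psi>" "\<And>x. x < a \<or> b < x \<Longrightarrow> \<psi> x = 0" and ab: "-1 < a" "a < b" "b < 1"
    and mean: "(LINT x|LI. \<psi> x) = 0"
  shows "\<exists>\<phi>. test_fn \<phi> \<and> deriv \<phi> = \<psi>"
proof -
  \<comment> \<open>Starting well to the left of -1 makes every point of \<open>[a, b]\<close>
    interior to \<open>{-3..3}\<close>, so the fundamental theorem gives two-sided derivatives
    there.\<close>
  define \<phi> where "\<phi> = (\<lambda>x. integral {-3..x} \<psi>)"
  have cont: "continuous_on S \<psi>" for S
    by (rule smooth_fun_continuous[OF \<psi>(1)])
  have \<phi>a: "\<phi> x = 0" if "x < a" for x
  proof -
    have "\<phi> x = integral {-3..x} (\<lambda>_. 0)"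
      unfolding \<phi>_def by (rule Henstock_Kurzweil_Integration.integral_cong) (use that \<psi>(2) in auto)
    then show ?thesis
      by simp
  qed
  have ab0: "(\<psi> has_integral 0) {a..b}"
  proof -
    have "set_integrable lborel II \<psi>"
      unfolding set_integrable_LI by (rule integrable_LI_continuous[OF cont])
    from set_borel_integral_eq_integral[OF this] have "(\<psi> has_integral 0) II"
      using mean by (simp add: set_integral_LI has_integral_iff)
    then have "(\<psi> has_integral 0) UNIV"
      by (rule has_integral_on_superset) (use \<psi>(2) ab in auto)
    moreover have "\<psi> = (\<lambda>x. if x \<in> {a..b} then \<psi> x else 0)"
      using \<psi>(2) by (auto simp: fun_eq_iff)
    ultimately have "((\<lambda>x. if x \<in> {a..b} then \<psi> x else 0) has_integral 0) UNIV"
      by simp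
    then show ?thesis
      unfolding has_integral_restrict_UNIV .
  qed
  have \<phi>b: "\<phi> x = 0" if "b < x" for x
    unfolding \<phi>_def
    by (rule integral_unique[OF has_integral_on_superset[OF ab0]]) (use \<psi>(2) ab that in auto)
  have d: "(\<phi> has_real_derivative \<psi> x) (at x)" for x
  proof -
    consider "x < a" | "b < x" | "-3 < x" "x < 3"
      using ab by linarith
    then show ?thesis
    proof cases
      case 1
      have "((\<lambda>_. 0) has_real_derivative 0) (at x)"
        by simp
      then have "(\<phi> has_real_derivative 0) (at x)"
        by (rule has_field_derivative_transform_within_open[where S = "{..<a}"]) (use 1 \<phi>a in auto)
      then show ?thesis
        using 1 \<psi>(2) by simp
    next
      case 2
      have "((\<lambda>_. 0) has_real_derivative 0) (at x)"
        by simp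
      then have "(\<phi> has_real_derivative 0) (at x)"
        by (rule has_field_derivative_transform_within_open[where S = "{b<..}"]) (use 2 \<phi>b in auto)
      then show ?thesis
        using 2 \<psi>(2) by simp
    next
      case 3
      have "(\<phi> has_real_derivative \<psi> x) (at x within {-3..3})"
        unfolding \<phi>_def by (rule integral_has_real_derivative[OF cont]) (use 3 in auto)
      then show ?thesis
        using 3 at_within_interior[of x "{-3..3}"] by simp
    qed
  qed
  have "deriv \<phi> = \<psi>"
    using d by (auto intro!: DERIV_imp_deriv)
  moreover have "test_fn \<phi>"
    unfolding test_fn_iff using smooth_fun_antideriv[OF \<psi>(1) d] \<phi>a \<phi>b ab
    by (intro conjI exI[of _ a] exI[of _ b]) auto
  ultimately show ?thesis
    by blast
qed

section \<open>The du Bois-Reymond lemma\<close>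

lemma AE_zero_of_prim_zero:
  assumes u: "integrable LI u" and p: "\<And>x. x \<in> II \<Longrightarrow> prim u x = 0"
  shows "AE x in LI. u x = 0"
proof -
  define U where "U = (\<lambda>x. indicator II x *\<^sub>R u x)"
  have U: "integrable lborel U"
    using u unfolding U_def set_integrable_LI[symmetric] set_integrable_def .
  have base: "(LINT x:{..c}|lborel. U x) = 0" for c
  proof -
    have e: "(LINT x:{..c}|lborel. U x) = prim u c" for c
    proof -
      have "(LINT x:{..c}|lborel. U x) = (LINT t:II|lborel. (if t \<le> c then u t else 0))"
        unfolding set_lebesgue_integral_def U_def
        by (intro Bochner_Integration.integral_cong) (auto split: split_indicator)
      then show ?thesis
        by (simp add: prim_def set_integral_LI)
    qed
    consider "c < -1" | "c \<in> II" | "c > 1"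
      by fastforce
    then show ?thesis
    proof cases
      case 1
      then have "prim u c = (LINT t|LI. 0)"
        unfolding prim_def by (intro Bochner_Integration.integral_cong) auto
      then show ?thesis
        by (simp add: e)
    next
      case 3
      then have "prim u c = prim u 1"
        unfolding prim_def by (intro Bochner_Integration.integral_cong) auto
      then show ?thesis
        using p[of 1] by (simp add: e)
    qed (use p e in simp)
  qed
  have tot: "(LINT x:UNIV|lborel. U x) = 0"
  proof -
    have "(LINT x:UNIV|lborel. U x) = (LINT x:{..1}|lborel. U x)"
      unfolding set_lebesgue_integral_def U_def
      by (intro Bochner_Integration.integral_cong) (auto split: split_indicator)
    then show ?thesis
      using base by simp
  qed
  have si: "set_integrable lborel A U" if "A \<in> sets borel" for A
    unfolding set_integrable_def using that U by (intro integrable_mult_indicator) auto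
  \<comment> \<open>Rays are stable under intersection and generate the Borel sets, so the Dynkin
    argument extends \<open>base\<close> to all of them; \<open>tot\<close> is what the complement
    step needs.\<close>
  have all: "(LINT x:A|lborel. U x) = 0" if "A \<in> sets borel" for A
  proof -
    have A: "A \<in> sigma_sets UNIV (range (\<lambda>c. {..c::real}))"
      using that unfolding borel_eq_atMost by (simp add: sets_measure_of)
    have "Int_stable (range (\<lambda>c. {..c::real}))" "range (\<lambda>c. {..c::real}) \<subseteq> Pow UNIV"
      by (auto simp: Int_stable_def)
    from this A show ?thesis
    proof (induction rule: sigma_sets_induct_disjoint)
      case (basic A)
      then show ?case
        using base by auto
    next
      case empty
      show ?case
        by (simp add: set_lebesgue_integral_def)
    next
      case (compl A)
      then have A: "A \<in> sets borel"
        unfolding borel_eq_atMost by (simp add: sets_measure_of)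
      have "(LINT x:A \<union> (UNIV - A)|lborel. U x) = (LINT x:A|lborel. U x) + (LINT x:UNIV - A|lborel. U x)"
        by (rule set_integral_Un) (use A si in auto)
      then show ?case
        using compl tot by simp
    next
      case (union A)
      then have A: "A i \<in> sets borel" for i
        unfolding borel_eq_atMost by (auto simp: sets_measure_of)
      have "(LINT x:(\<Union>i. A i)|lborel. U x) = (\<Sum>i. (LINT x:(A i)|lborel. U x))"
        by (rule lebesgue_integral_countable_add)
           (use A union(1) in \<open>auto intro!: si simp: disjoint_family_on_def\<close>)
      then show ?case
        using union by simp
    qed
  qed
  have "AE x in lborel. U x = 0"
    by (rule sigma_finite_measure.density_zero[OF lborel.sigma_finite_measure_axioms U]) (simp add: all)
  then have "AE x in lborel. x \<in> II \<longrightarrow> u x = 0"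
    by eventually_elim (auto simp: U_def)
  then show ?thesis
    by (simp only: AE_LI_iff)
qed

text \<open>Bumps that exhaust the interval \<open>(-1, x)\<close> from inside and converge to its indicator.\<close>

definition bump_seq :: "real \<Rightarrow> nat \<Rightarrow> real \<Rightarrow> real" where
  "bump_seq x n = bump (1 / real (Suc n)) (-1 + (x + 1) / real (n + 3)) (x - (x + 1) / real (n + 3)) 1 0"

text \<open>The offset 3 keeps each margin at most a third of the length \<open>x + 1\<close>, so
  two margins leave a nonempty interval.\<close>

lemma bump_seq_interval:
  assumes "-1 < x"
  shows "-1 < -1 + (x + 1) / real (n + 3)" "-1 + (x + 1) / real (n + 3) < x - (x + 1) / real (n + 3)"
    "x - (x + 1) / real (n + 3) < x"
proof -
  define d where "d = (x + 1) / real (n + 3)"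
  have "d \<le> (x + 1) / 3"
    unfolding d_def using assms by (intro divide_left_mono) auto
  moreover have "d > 0"
    unfolding d_def using assms by simp
  ultimately have "-1 < -1 + d \<and> -1 + d < x - d \<and> x - d < x"
    using assms by (auto simp: field_simps)
  then show "-1 < -1 + (x + 1) / real (n + 3)" "-1 + (x + 1) / real (n + 3) < x - (x + 1) / real (n + 3)"
    "x - (x + 1) / real (n + 3) < x"
    unfolding d_def by blast+
qed

text \<open>At a point of \<open>(-1, x)\<close> the product of the distances to the moving
  endpoints stays away from 0 while the parameter \<open>1 / (n + 1)\<close> vanishes, so the
  exponential tends to 1.\<close>

lemma bump_seq_tendsto:
  assumes x: "-1 < x"
  shows "(\<lambda>n. bump_seq x n t) \<longlonglongrightarrow> indicat_real {-1<..<x} t"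
proof -
  have d0: "(\<lambda>n. (x + 1) / real (n + 3)) \<longlonglongrightarrow> 0"
    using LIMSEQ_ignore_initial_segment[OF lim_const_over_n[of "x + 1"], of 3] by simp
  have an: "(\<lambda>n. -1 + (x + 1) / real (n + 3)) \<longlonglongrightarrow> -1"
    using tendsto_add[OF tendsto_const[of "-1"] d0] by simp
  have bn: "(\<lambda>n. x - (x + 1) / real (n + 3)) \<longlonglongrightarrow> x"
    using tendsto_diff[OF tendsto_const[of x] d0] by simp
  show ?thesis
  proof (cases "-1 < t \<and> t < x")
    case True
    have en: "(\<lambda>n. 1 / real (Suc n)) \<longlonglongrightarrow> 0"
      using LIMSEQ_Suc[OF lim_1_over_n[where ?'a = real]] by simp
    have "(\<lambda>n. exp (- (1 / real (Suc n)) / ((t - (-1 + (x + 1) / real (n + 3))) * (x - (x + 1) / real (n + 3) - t))))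
        \<longlonglongrightarrow> exp (- 0 / ((t - (-1)) * (x - t)))"
      by (intro tendsto_intros an bn en) (use True in auto)
    moreover have "\<forall>\<^sub>F n in sequentially. bump_seq x n t
        = exp (- (1 / real (Suc n)) / ((t - (-1 + (x + 1) / real (n + 3))) * (x - (x + 1) / real (n + 3) - t)))"
    proof -
      have "\<forall>\<^sub>F n in sequentially. -1 + (x + 1) / real (n + 3) < t"
        by (rule order_tendstoD(2)[OF an]) (use True in simp)
      moreover have "\<forall>\<^sub>F n in sequentially. t < x - (x + 1) / real (n + 3)"
        by (rule order_tendstoD(1)[OF bn]) (use True in simp)
      ultimately show ?thesis
        by eventually_elim (simp add: bump_seq_def bump_def)
    qed
    ultimately show ?thesis
      using True by (subst tendsto_cong) auto
  next
    case False
    have "bump_seq x n t = 0" for n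
      unfolding bump_seq_def
      by (rule bump_outside) (use False bump_seq_interval[OF x, of n] in linarith)
    then show ?thesis
      using False by simp
  qed
qed

text \<open>Derivatives of test functions include every bump corrected to mean zero by a multiple of
  one fixed bump \<eta>. Hence \<open>v - c\<close> is orthogonal to all bumps, in the limit to the
  indicators of \<open>(-1, x)\<close>, so its primitive vanishes.\<close>

lemma du_Bois_Reymond:
  assumes v: "integrable LI v" and orth: "\<And>\<phi>. test_fn \<phi> \<Longrightarrow> (LINT x|LI. v x * complex_of_real (deriv \<phi> x)) = 0"
  shows "\<exists>c. AE x in LI. v x = c"
proof -
  define \<eta> where "\<eta> = bump 1 (-1/2) (1/2) 1 0"
  define m where "m = (LINT x|LI. \<eta> x)"
  \<comment> \<open>The only possible constant: the mean of \<open>v\<close> weighted by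
    \<eta>.\<close>
  define c where "c = (LINT x|LI. v x * of_real (\<eta> x)) / of_real m"
  have \<eta>: "smooth_fun \<eta>"
    unfolding \<eta>_def by (rule smooth_bump) auto
  have vm: "v \<in> borel_measurable LI"
    using v by auto
  have \<eta>i: "integrable LI \<eta>"
    by (rule integrable_LI_continuous[OF smooth_fun_continuous[OF \<eta>]])
  have m: "m \<noteq> 0"
  proof
    assume "m = 0"
    then have "AE x in LI. \<eta> x = 0"
      using integral_nonneg_eq_0_iff_AE[OF \<eta>i] unfolding m_def by (auto simp: \<eta>_def bump_def)
    then have "AE x in lborel. x \<in> II \<longrightarrow> \<eta> x = 0"
      by (simp only: AE_LI_iff)
    then have "AE x in lborel. x \<notin> {-1/2<..<1/2::real}"
      by eventually_elim (auto simp: \<eta>_def bump_def)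
    then have "{-1/2<..<1/2::real} \<in> null_sets lborel"
      by (subst (asm) AE_iff_null_sets[symmetric]) auto
    then show False
      by (simp add: null_sets_def)
  qed
  have vb: "integrable LI (\<lambda>x. v x * of_real (f x))" if "f \<in> borel_measurable borel" "\<And>x. \<bar>f x\<bar> \<le> 1" for f
    using integrable_LI_mult_bounded[of "\<lambda>x. complex_of_real (f x)" 1 v] v that
    by (simp add: mult.commute borel_measurable_LI_of_borel)
  have key: "(LINT t|LI. v t * of_real (bump_seq x n t)) = c * of_real (LINT t|LI. bump_seq x n t)" if x: "-1 < x" "x \<le> 1" for x n
  proof -
    define \<beta> where "\<beta> = bump_seq x n"
    have \<beta>: "smooth_fun \<beta>"
      unfolding \<beta>_def bump_seq_def by (rule smooth_bump) (use bump_seq_interval[OF x(1)] in auto)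
    have \<beta>1: "\<bar>\<beta> t\<bar> \<le> 1" for t
      unfolding \<beta>_def bump_seq_def by (rule bump_le_1) auto
    have \<beta>i: "integrable LI \<beta>"
      by (rule integrable_LI_continuous[OF smooth_fun_continuous[OF \<beta>]])
    define q where "q = (LINT t|LI. \<beta> t) / m"
    define \<psi> where "\<psi> = (\<lambda>t. 1 * \<beta> t + (- q) * \<eta> t)"
    have "\<exists>\<phi>. test_fn \<phi> \<and> deriv \<phi> = \<psi>"
    proof (rule test_fn_antiderivative)
      show "smooth_fun \<psi>"
        unfolding \<psi>_def by (rule smooth_fun_lincomb[OF \<beta> \<eta>])
      let ?a = "min (-1/2) (-1 + (x + 1) / real (n + 3))" and ?b = "max (1/2) (x - (x + 1) / real (n + 3))"
      show "\<psi> t = 0" if "t < ?a \<or> ?b < t" for t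
        using that unfolding \<psi>_def \<beta>_def \<eta>_def bump_seq_def
        by (subst (1 2) bump_outside) auto
      show "-1 < ?a" "?a < ?b" "?b < 1"
        using bump_seq_interval[OF x(1), of n] x(2) by auto
      show "(LINT t|LI. \<psi> t) = 0"
        using \<beta>i \<eta>i m unfolding \<psi>_def by (simp add: q_def m_def[symmetric])
    qed
    then obtain \<phi> where "test_fn \<phi>" "deriv \<phi> = \<psi>"
      by blast
    from orth[OF this(1)] this(2) have "(LINT t|LI. v t * of_real (\<beta> t) - of_real q * (v t * of_real (\<eta> t))) = 0"
      by (simp add: \<psi>_def algebra_simps)
    moreover have "integrable LI (\<lambda>t. v t * of_real (\<beta> t))" "integrable LI (\<lambda>t. v t * of_real (\<eta> t))"
      by (rule vb[OF smooth_fun_measurable[OF \<beta>] \<beta>1], rule vb[OF smooth_fun_measurable[OF \<eta>]])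
         (simp add: \<eta>_def bump_le_1)
    ultimately have "(LINT t|LI. v t * of_real (\<beta> t)) = of_real q * (LINT t|LI. v t * of_real (\<eta> t))"
      by simp
    then show ?thesis
      using m by (simp add: \<beta>_def c_def q_def)
  qed
  \<comment> \<open>Dominated convergence in \<open>key\<close>, with \<open>|v|\<close> and 1 as
    majorants since the bumps are bounded by 1.\<close>
  have lim: "(LINT t|LI. v t * of_real (indicat_real {-1<..<x} t)) = c * of_real (LINT t|LI. indicat_real {-1<..<x} t)"
    if x: "-1 < x" "x \<le> 1" for x
  proof -
    have bm: "bump_seq x n \<in> borel_measurable borel" for n
      unfolding bump_seq_def
      by (rule smooth_fun_measurable[OF smooth_bump]) (use bump_seq_interval[OF x(1)] in auto)
    have b1: "\<bar>bump_seq x n t\<bar> \<le> 1" for n t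
      unfolding bump_seq_def by (rule bump_le_1) auto
    have "(\<lambda>n. LINT t|LI. v t * of_real (bump_seq x n t)) \<longlonglongrightarrow> (LINT t|LI. v t * of_real (indicat_real {-1<..<x} t))"
    proof (rule integral_dominated_convergence[where w = "\<lambda>t. cmod (v t)"])
      show "(\<lambda>t. v t * of_real (indicat_real {-1<..<x} t)) \<in> borel_measurable LI"
        using vb[of "indicat_real {-1<..<x}"] by (auto simp: indicator_def)
      show "(\<lambda>t. v t * of_real (bump_seq x n t)) \<in> borel_measurable LI" for n
        using vb[OF bm b1] by auto
      show "AE t in LI. (\<lambda>n. v t * of_real (bump_seq x n t)) \<longlonglongrightarrow> v t * of_real (indicat_real {-1<..<x} t)"
        by (intro AE_I2 tendsto_intros bump_seq_tendsto x)
      show "AE t in LI. cmod (v t * of_real (bump_seq x n t)) \<le> cmod (v t)" for n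
        using b1 by (intro AE_I2) (simp add: norm_mult mult_left_le)
    qed (use v in auto)
    moreover have "(\<lambda>n. LINT t|LI. bump_seq x n t) \<longlonglongrightarrow> (LINT t|LI. indicat_real {-1<..<x} t)"
    proof (rule integral_dominated_convergence[where w = "\<lambda>_. 1"])
      show "(\<lambda>t. indicat_real {-1<..<x} t) \<in> borel_measurable LI" "bump_seq x n \<in> borel_measurable LI" for n
        using bm by (auto intro: borel_measurable_LI_of_borel)
      show "AE t in LI. (\<lambda>n. bump_seq x n t) \<longlonglongrightarrow> indicat_real {-1<..<x} t"
        by (intro AE_I2 bump_seq_tendsto x)
    qed (use b1 in auto)
    then have "(\<lambda>n. c * of_real (LINT t|LI. bump_seq x n t)) \<longlonglongrightarrow> c * of_real (LINT t|LI. indicat_real {-1<..<x} t)"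
      by (intro tendsto_intros)
    ultimately show ?thesis
      unfolding key[OF x] by (rule LIMSEQ_unique)
  qed
  have u: "integrable LI (\<lambda>t. v t - c)"
    using v by simp
  have pz: "prim (\<lambda>t. v t - c) x = 0" if "x \<in> II" for x
  proof (cases "x = -1")
    case True
    then show ?thesis
      using prim_m1[OF u] by simp
  next
    case False
    then have x: "-1 < x" "x \<le> 1"
      using that by auto
    have i: "integrable LI (indicat_real {-1<..<x})"
      by (rule integrable_LI_bounded[where B = 1]) (auto intro: borel_measurable_LI_of_borel simp: indicator_def)
    have iv: "integrable LI (\<lambda>t. v t * of_real (indicat_real {-1<..<x} t))"
      by (rule vb) (auto simp: indicator_def)
    have "prim (\<lambda>t. v t - c) x = (LINT t|LI. v t * of_real (indicat_real {-1<..<x} t) - c * of_real (indicat_real {-1<..<x} t))"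
      unfolding prim_def
    proof (rule integral_cong_AE)
      show "(\<lambda>t. if t \<le> x then v t - c else 0) \<in> borel_measurable LI"
        using integrable_cut[OF u] by auto
      show "(\<lambda>t. v t * of_real (indicat_real {-1<..<x} t) - c * of_real (indicat_real {-1<..<x} t)) \<in> borel_measurable LI"
        by (intro borel_measurable_diff borel_measurable_integrable iv integrable_mult_right integrable_of_real i)
      have "AE t in LI. t \<noteq> -1 \<and> t \<noteq> x \<and> t \<in> II"
        using AE_LI_neq[of "-1"] AE_LI_neq[of x] AE_space[of LI] by eventually_elim simp
      then show "AE t in LI. (if t \<le> x then v t - c else 0) = v t * of_real (indicat_real {-1<..<x} t) - c * of_real (indicat_real {-1<..<x} t)"
        by eventually_elim (auto simp: indicator_def)
    qed
    also have "\<dots> = (LINT t|LI. v t * of_real (indicat_real {-1<..<x} t)) - c * of_real (LINT t|LI. indicat_real {-1<..<x} t)"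
      using i iv by simp
    finally show ?thesis
      using lim[OF x] by simp
  qed
  have "AE x in LI. v x - c = 0"
    by (rule AE_zero_of_prim_zero[OF u pz])
  then have "AE x in LI. v x = c"
    by eventually_elim simp
  then show ?thesis
    by blast
qed

text \<open>Integration by parts shows that \<open>prim g\<close> also has weak derivative
  \<open>g\<close>, the boundary terms vanishing with the test function; the difference is then
  constant.\<close>

lemma weak_derivative_prim:
  assumes w: "integrable LI w" and g: "integrable LI g"
    and weak: "\<And>\<phi>. test_fn \<phi> \<Longrightarrow> (LINT x|LI. w x * of_real (deriv \<phi> x)) = - (LINT x|LI. g x * of_real (\<phi> x))"
  shows "\<exists>c. AE x in LI. w x = c + prim g x"
proof -
  define v where "v = (\<lambda>x. w x - prim g x)"
  have pg: "integrable LI (prim g)"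
    by (rule prim_integrable[OF g])
  have "\<exists>c. AE x in LI. v x = c"
  proof (rule du_Bois_Reymond)
    show "integrable LI v"
      unfolding v_def using w pg by simp
    fix \<phi> assume \<phi>: "test_fn \<phi>"
    then have s: "smooth_fun \<phi>" and b: "\<phi> (-1) = 0" "\<phi> 1 = 0"
      unfolding test_fn_iff by auto
    let ?d = "\<lambda>x. complex_of_real (deriv \<phi> x)"
    have dc: "continuous_on II ?d"
      by (intro continuous_intros smooth_fun_continuous[OF smooth_fun_deriv[OF s]])
    have di: "integrable LI ?d"
      by (rule integrable_LI_continuous[OF dc])
    have p: "complex_of_real (\<phi> x) = prim ?d x" if "x \<in> II" for x
    proof -
      have "((\<lambda>x. complex_of_real (\<phi> x)) has_vector_derivative ?d x) (at x within II)" for x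
        by (rule has_vector_derivative_of_real)
           (simp add: has_real_derivative_iff_has_vector_derivative[symmetric] has_field_derivative_at_within smooth_fun_has_deriv[OF s])
      from prim_of_derivative[OF dc this that] show ?thesis
        using b by simp
    qed
    obtain D where D: "\<And>x. x \<in> II \<Longrightarrow> cmod (?d x) \<le> D"
    proof -
      have "compact (?d ` II)"
        by (intro compact_continuous_image dc) auto
      then show thesis
        using that by (metis bounded_iff compact_imp_bounded imageI)
    qed
    have i: "integrable LI (\<lambda>x. w x * ?d x)" "integrable LI (\<lambda>x. prim g x * ?d x)"
      using integrable_LI_mult_bounded[of ?d D, OF _ D w] integrable_LI_mult_bounded[of ?d D, OF _ D pg] di
      by (auto simp: mult.commute)
    have "(LINT x|LI. prim g x * ?d x) + (LINT x|LI. g x * prim ?d x) = 0"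
      using integration_by_parts[OF g di, of 0] p[of 1] b by simp
    moreover have "(LINT x|LI. g x * prim ?d x) = (LINT x|LI. g x * of_real (\<phi> x))"
      by (intro Bochner_Integration.integral_cong) (auto simp: p)
    moreover have "(LINT x|LI. v x * ?d x) = (LINT x|LI. w x * ?d x) - (LINT x|LI. prim g x * ?d x)"
      using i by (simp add: v_def left_diff_distrib)
    ultimately show "(LINT x|LI. v x * ?d x) = 0"
      using weak[OF \<phi>] by (simp add: add_eq_0_iff)
  qed
  then obtain c where "AE x in LI. v x = c"
    by blast
  then have "AE x in LI. w x = c + prim g x"
    by eventually_elim (auto simp: v_def algebra_simps)
  then show ?thesis
    by blast
qed

section \<open>Weak derivatives in a Sobolev witness as successive primitives\<close>

lemma sobolev_witness_L2: "sobolev_witness m u g \<Longrightarrow> j \<le> m \<Longrightarrow> L2_on (g j)"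
  by (simp add: sobolev_witness_def)

text \<open>The witness relates every \<open>g j\<close> to \<open>u\<close> only. Testing order
  \<open>j\<close> with the derivative of \<phi> and order \<open>j + 1\<close> with \<phi> itself
  compares neighbours.\<close>

lemma sobolev_witness_step:
  assumes g: "sobolev_witness m u g" and j: "j < m"
  shows "\<exists>c. AE x in LI. g j x = c + prim (g (Suc j)) x"
proof (rule weak_derivative_prim)
  show "integrable LI (g j)" "integrable LI (g (Suc j))"
    using sobolev_witness_L2[OF g] j by (auto intro: L2_integrable)
  fix \<phi> assume \<phi>: "test_fn \<phi>"
  have w: "(LINT x|LI. u x * of_real ((deriv ^^ i) \<phi> x)) = (-1)^i * (LINT x|LI. g i x * of_real (\<phi> x))"
    if "i \<le> m" "test_fn \<phi>" for i \<phi>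
    using g that unfolding sobolev_witness_def set_integral_LI by blast
  have "(-1)^j * (LINT x|LI. g j x * of_real (deriv \<phi> x)) = (LINT x|LI. u x * of_real ((deriv ^^ j) (deriv \<phi>) x))"
    using w[OF _ test_fn_deriv[OF \<phi>], of j] j by simp
  also have "(deriv ^^ j) (deriv \<phi>) = (deriv ^^ Suc j) \<phi>"
    by (simp only: funpow_Suc_right o_apply)
  also have "(LINT x|LI. u x * of_real ((deriv ^^ Suc j) \<phi> x)) = (-1)^j * - (LINT x|LI. g (Suc j) x * of_real (\<phi> x))"
    using w[OF _ \<phi>, of "Suc j"] j by simp
  finally show "(LINT x|LI. g j x * of_real (deriv \<phi> x)) = - (LINT x|LI. g (Suc j) x * of_real (\<phi> x))"
    by (subst (asm) mult_left_cancel) auto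
qed

section \<open>Functions orthogonal to splines\<close>

lemma partition_less:
  assumes "partition N t" "i < j" "j \<le> Suc N"
  shows "t i < t j"
  using assms(2,3)
proof (induction j)
  case (Suc j)
  have "t j < t (Suc j)"
    using assms(1) Suc.prems by (auto simp: partition_def)
  then show ?case
    using Suc by (cases "i = j") auto
qed simp

lemma partition_le: "partition N t \<Longrightarrow> i \<le> j \<Longrightarrow> j \<le> Suc N \<Longrightarrow> t i \<le> t j"
  using partition_less[of N t i j] by (cases "i = j") auto

lemma partition_range: "partition N t \<Longrightarrow> i \<le> Suc N \<Longrightarrow> t i \<in> II"
  using partition_le[of N t 0 i] partition_le[of N t i "Suc N"] by (auto simp: partition_def)

lemma mesh_ge: "j \<le> N \<Longrightarrow> t (Suc j) - t j \<le> mesh N t"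
  unfolding mesh_def by (intro Max_ge) auto

lemma mesh_pos: "partition N t \<Longrightarrow> mesh N t > 0"
  using mesh_ge[of 0 N t] partition_less[of N t 0 1] by auto

text \<open>The last knot not beyond \<open>a + h\<close> cannot lie before \<open>a\<close>, since
  its successor would then be within the window too.\<close>

lemma partition_knot_in_interval:
  assumes p: "partition N t" and a: "-1 \<le> a" "a + mesh N t \<le> 1"
  shows "\<exists>j\<le>Suc N. a \<le> t j \<and> t j \<le> a + mesh N t"
proof -
  let ?h = "mesh N t"
  define J where "J = {j. j \<le> Suc N \<and> t j \<le> a + ?h}"
  have J: "finite J" "0 \<in> J"
    using p a mesh_pos[OF p] by (auto simp: J_def partition_def)
  define j where "j = Max J"
  have "j \<in> J"
    unfolding j_def using J by (intro Max_in) auto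
  then have j: "j \<le> Suc N" "t j \<le> a + ?h"
    by (auto simp: J_def)
  have "a \<le> t j"
  proof (cases "j = Suc N")
    case True
    then show ?thesis
      using p a mesh_pos[OF p] by (auto simp: partition_def)
  next
    case False
    then have "Suc j \<notin> J"
      using Max_ge[OF J(1), of "Suc j"] by (auto simp: j_def)
    then have "t (Suc j) > a + ?h"
      using j False by (auto simp: J_def)
    then show ?thesis
      using mesh_ge[of j N t] j False by auto
  qed
  then show ?thesis
    using j by blast
qed

section \<open>Polynomials and truncated powers as splines\<close>

lemma spline_poly:
  assumes "degree p < m"
  shows "spline m N t (\<lambda>x. poly p (complex_of_real x))"
proof -
  have "Ck_on k II (\<lambda>x. poly p (complex_of_real x))" for k
    unfolding Ck_on_def
  proof (intro exI[of _ "\<lambda>i x. poly ((pderiv ^^ i) p) (complex_of_real x)"] conjI allI impI ballI)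
    show "continuous_on II (\<lambda>x. poly ((pderiv ^^ i) p) (complex_of_real x))" for i
      by (intro continuous_intros)
    show "((\<lambda>x. poly ((pderiv ^^ i) p) (complex_of_real x)) has_vector_derivative poly ((pderiv ^^ Suc i) p) (complex_of_real x)) (at x within II)" for i x
      using has_vector_derivative_real_field[OF poly_DERIV[of "(pderiv ^^ i) p" "of_real x"]] by simp
  qed simp
  then show ?thesis
    unfolding spline_def using assms by auto
qed

text \<open>Truncated to the left of \<open>c\<close>, matching primitives that start at -1. For
  \<open>n = 0\<close> the convention \<open>0^0 = 1\<close> makes it the indicator of
  \<open>x \<le> c\<close>.\<close>

definition trunc_power :: "real \<Rightarrow> nat \<Rightarrow> real \<Rightarrow> real" where
  "trunc_power c n x = (if x \<le> c then (c - x) ^ n else 0)"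

lemma trunc_power_continuous: "continuous_on S (trunc_power c (Suc n))"
proof -
  have "trunc_power c (Suc n) = (\<lambda>x. max 0 (c - x) ^ Suc n)"
    by (auto simp: trunc_power_def max_def fun_eq_iff)
  then show ?thesis
    by (auto intro!: continuous_intros)
qed

lemma trunc_power_has_derivative:
  "(trunc_power c (Suc (Suc n)) has_real_derivative - real (Suc (Suc n)) * trunc_power c (Suc n) x) (at x)"
proof -
  consider "x < c" | "c < x" | "x = c"
    by linarith
  then show ?thesis
  proof cases
    case 1
    have "((\<lambda>x. (c - x) ^ Suc (Suc n)) has_real_derivative - real (Suc (Suc n)) * (c - x) ^ Suc n) (at x)"
      by (rule DERIV_cong[OF DERIV_power_Suc[where D = "-1"]]) (auto intro!: derivative_eq_intros simp: algebra_simps)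
    then have "(trunc_power c (Suc (Suc n)) has_real_derivative - real (Suc (Suc n)) * (c - x) ^ Suc n) (at x)"
      by (rule has_field_derivative_transform_within_open[where S = "{..<c}"]) (use 1 in \<open>auto simp: trunc_power_def\<close>)
    then show ?thesis
      using 1 by (simp add: trunc_power_def)
  next
    case 2
    have "((\<lambda>x. 0) has_real_derivative 0) (at x)"
      by simp
    then have "(trunc_power c (Suc (Suc n)) has_real_derivative 0) (at x)"
      by (rule has_field_derivative_transform_within_open[where S = "{c<..}"]) (use 2 in \<open>auto simp: trunc_power_def\<close>)
    then show ?thesis
      using 2 by (simp add: trunc_power_def)
  next
    case 3
    \<comment> \<open>The exponent is at least 2, which gives the quadratic bound at the
      knot.\<close>
    have "(trunc_power c (Suc (Suc n)) has_real_derivative 0) (at c)"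
    proof (rule DERIV_zero_of_quadratic_bound[where d = 1 and C = 1])
      fix y :: real assume y: "\<bar>y - c\<bar> < 1"
      have "\<bar>c - y\<bar> ^ (n + 2) \<le> \<bar>c - y\<bar> ^ 2"
        using y by (intro power_decreasing) auto
      then show "\<bar>trunc_power c (Suc (Suc n)) y\<bar> \<le> 1 * (y - c)^2"
        by (auto simp: trunc_power_def power_abs power2_commute[of y c])
    qed (auto simp: trunc_power_def)
    then show ?thesis
      using 3 by (simp add: trunc_power_def)
  qed
qed

lemma spline_trunc_power:
  assumes p: "partition N t" and m: "m > 0" and i: "i \<le> Suc N"
  shows "spline m N t (\<lambda>x. complex_of_real (trunc_power (t i) (m - 1) x))"
  unfolding spline_def
proof (intro conjI allI impI)
  fix j assume j: "j \<le> N"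
  show "\<exists>q :: complex poly. degree q < m \<and> (\<forall>x\<in>{t j<..<t (Suc j)}. complex_of_real (trunc_power (t i) (m - 1) x) = poly q (complex_of_real x))"
  proof (cases "Suc j \<le> i")
    case True
    then have "t (Suc j) \<le> t i"
      using partition_le[OF p] i by blast
    moreover have "degree ([:complex_of_real (t i), -1:] ^ (m - 1)) < m"
      using m by (simp add: degree_power_eq)
    ultimately show ?thesis
      by (intro exI[of _ "[:complex_of_real (t i), -1:] ^ (m - 1)"]) (auto simp: trunc_power_def)
  next
    case False
    then have "t i \<le> t j"
      using partition_le[OF p, of i j] j by simp
    then show ?thesis
      using m by (intro exI[of _ 0]) (auto simp: trunc_power_def)
  qed
next
  assume m2: "2 \<le> m"
  \<comment> \<open>Signed falling factorial produced by differentiating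
    \<open>(c - x)^(m - 1)\<close> \<open>k\<close> times.\<close>
  define coef where "coef = (\<lambda>k. \<Prod>l<k. - real (m - 1 - l))"
  show "Ck_on (m - 2) II (\<lambda>x. complex_of_real (trunc_power (t i) (m - 1) x))"
    unfolding Ck_on_def
  proof (intro exI[of _ "\<lambda>k x. complex_of_real (coef k * trunc_power (t i) (m - 1 - k) x)"] conjI allI impI ballI)
    show "(\<lambda>x. complex_of_real (coef 0 * trunc_power (t i) (m - 1 - 0) x)) = (\<lambda>x. complex_of_real (trunc_power (t i) (m - 1) x))"
      by (simp add: coef_def)
  next
    fix k assume "k \<le> m - 2"
    then have "m - 1 - k = Suc (m - 2 - k)"
      using m2 by simp
    then show "continuous_on II (\<lambda>x. complex_of_real (coef k * trunc_power (t i) (m - 1 - k) x))"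
      by (auto intro!: continuous_intros trunc_power_continuous)
  next
    fix k x assume k: "k < m - 2" and x: "x \<in> II"
    define n where "n = m - 3 - k"
    have n: "m - 1 - k = Suc (Suc n)" "m - 1 - Suc k = Suc n"
      using k by (auto simp: n_def)
    have cS: "coef (Suc k) = coef k * - real (Suc (Suc n))"
      by (simp only: coef_def prod.lessThan_Suc n)
    have "((\<lambda>x. coef k * trunc_power (t i) (Suc (Suc n)) x) has_real_derivative
        coef k * (- real (Suc (Suc n)) * trunc_power (t i) (Suc n) x)) (at x within II)"
      by (intro DERIV_cmult has_field_derivative_at_within[OF trunc_power_has_derivative])
    then have "((\<lambda>x. coef k * trunc_power (t i) (Suc (Suc n)) x) has_real_derivative coef (Suc k) * trunc_power (t i) (Suc n) x) (at x within II)"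
      by (simp only: cS mult.assoc)
    then show "((\<lambda>x. complex_of_real (coef k * trunc_power (t i) (m - 1 - k) x)) has_vector_derivative
        complex_of_real (coef (Suc k) * trunc_power (t i) (m - 1 - Suc k) x)) (at x within II)"
      unfolding n by (intro has_vector_derivative_of_real) (simp add: has_real_derivative_iff_has_vector_derivative)
  qed
qed

lemma iterated_prim_integrable: "integrable LI g \<Longrightarrow> integrable LI ((prim ^^ k) g)"
  by (induction k) (auto intro: prim_integrable)

lemma iterated_prim_L2: "L2_on g \<Longrightarrow> L2_on ((prim ^^ k) g)"
  by (induction k) (auto intro: prim_L2 L2_integrable)

text \<open>The inner integral of the Fubini step in the next induction:
  \<open>(s - x)^j / j!\<close> integrated from \<open>x\<close> to \<open>c\<close>.\<close>

lemma power_cut_integral: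
  assumes x: "x \<in> II" and c: "c \<in> II"
  shows "(LINT s|LI. (if x \<le> s then complex_of_real ((s - x) ^ j / fact j) else 0) * (if s \<le> c then 1 else 0))
    = complex_of_real (trunc_power c (Suc j) x / fact (Suc j))"
proof -
  define a where "a = (\<lambda>s. complex_of_real ((s - x) ^ j / fact j))"
  define A where "A = (\<lambda>s. complex_of_real ((s - x) ^ Suc j / fact (Suc j)))"
  have ac: "continuous_on II a"
    unfolding a_def by (intro continuous_intros) auto
  have ai: "integrable LI a"
    by (rule integrable_LI_continuous[OF ac])
  have "(A has_vector_derivative a s) (at s within II)" for s
  proof -
    have "((\<lambda>s. (s - x) ^ Suc j / fact (Suc j)) has_real_derivative (s - x) ^ j / fact j) (at s within II)"
    proof (rule DERIV_cong)
      show "((\<lambda>s. (s - x) ^ Suc j / fact (Suc j)) has_real_derivative (1 + real j) * (1 * (s - x) ^ j) / fact (Suc j)) (at s within II)"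
        by (intro DERIV_cdivide DERIV_power_Suc) (auto intro!: derivative_eq_intros)
      have "(1 + real j) * (1 * (s - x) ^ j) / fact (Suc j) = ((1 + real j) * (s - x) ^ j) / ((1 + real j) * fact j)"
        by simp
      also have "\<dots> = (s - x) ^ j / fact j"
        by (rule mult_divide_mult_cancel_left) linarith
      finally show "(1 + real j) * (1 * (s - x) ^ j) / fact (Suc j) = (s - x) ^ j / fact j" .
    qed
    then show ?thesis
      unfolding A_def a_def by (intro has_vector_derivative_of_real) (simp add: has_real_derivative_iff_has_vector_derivative)
  qed
  then have A: "A y = A (-1) + prim a y" if "y \<in> II" for y
    using prim_of_derivative[OF ac _ that] by blast
  show ?thesis
  proof (cases "x \<le> c")
    case True
    have "(LINT s|LI. (if x \<le> s then a s else 0) * (if s \<le> c then 1 else 0))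
      = (LINT s|LI. (if s \<le> c then a s else 0) - (if s \<le> x then a s else 0))"
    proof (rule integral_cong_AE)
      have [measurable]: "a \<in> borel_measurable LI"
        using ai by auto
      show "(\<lambda>s. (if x \<le> s then a s else 0) * (if s \<le> c then 1 else 0)) \<in> borel_measurable LI"
        by measurable
      show "(\<lambda>s. (if s \<le> c then a s else 0) - (if s \<le> x then a s else 0)) \<in> borel_measurable LI"
        by measurable
      show "AE s in LI. (if x \<le> s then a s else 0) * (if s \<le> c then 1 else 0) = (if s \<le> c then a s else 0) - (if s \<le> x then a s else 0)"
        by (rule AE_mp[OF AE_LI_neq[of x]], rule AE_I2) (use True in auto)
    qed
    also have "\<dots> = prim a c - prim a x"
      unfolding prim_def by (rule Bochner_Integration.integral_diff[OF integrable_cut[OF ai] integrable_cut[OF ai]])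
    also have "\<dots> = A c - A x"
      using A[OF c] A[OF x] by simp
    also have "\<dots> = complex_of_real (trunc_power c (Suc j) x / fact (Suc j))"
      using True by (simp add: A_def trunc_power_def)
    finally show ?thesis
      unfolding a_def .
  next
    case False
    have "(LINT s|LI. (if x \<le> s then complex_of_real ((s - x) ^ j / fact j) else 0) * (if s \<le> c then 1 else 0)) = (LINT s|LI. 0)"
      using False by (intro Bochner_Integration.integral_cong) auto
    then show ?thesis
      using False by (simp add: trunc_power_def)
  qed
qed

text \<open>Cauchy's formula for repeated integration: \<open>j + 1\<close> primitives correspond to
  a truncated power of exponent \<open>j\<close>.\<close>

lemma iterated_prim_formula:
  assumes g: "integrable LI g" and c: "c \<in> II"
  shows "(prim ^^ Suc j) g c = (LINT x|LI. complex_of_real (trunc_power c j x / fact j) * g x)"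
  using c
proof (induction j arbitrary: c)
  case 0
  show ?case
    by (auto simp: prim_def trunc_power_def intro!: Bochner_Integration.integral_cong)
next
  case (Suc j)
  let ?k = "\<lambda>s x. if x \<le> s then complex_of_real ((s - x) ^ j / fact j) else 0"
  have km: "case_prod ?k \<in> borel_measurable (LI \<Otimes>\<^sub>M LI)"
    unfolding case_prod_beta' by measurable
  have kb: "cmod (?k s x) \<le> 2 ^ j" if "s \<in> II" "x \<in> II" for s x
  proof (cases "x \<le> s")
    case True
    have "(s - x) ^ j / fact j \<le> (s - x) ^ j / 1"
      using True by (intro divide_left_mono) (auto simp: fact_ge_1)
    also have "\<dots> \<le> 2 ^ j"
      using True that by (auto intro!: power_mono)
    finally show ?thesis
      unfolding if_P[OF True] norm_of_real using True by simp
  qed simp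
  let ?v = "\<lambda>s. if s \<le> c then 1 else (0::complex)"
  have vi: "integrable LI ?v"
    by (rule integrable_LI_bounded[where B = 1]) auto
  have "(prim ^^ Suc (Suc j)) g c = (LINT s|LI. ?v s * (prim ^^ Suc j) g s)"
    by (simp add: prim_kernel)
  also have "\<dots> = (LINT s|LI. ?v s * (LINT x|LI. ?k s x * g x))"
  proof (intro Bochner_Integration.integral_cong refl)
    fix s assume "s \<in> space LI"
    then have "(prim ^^ Suc j) g s = (LINT x|LI. complex_of_real (trunc_power s j x / fact j) * g x)"
      by (intro Suc.IH) simp
    also have "\<dots> = (LINT x|LI. ?k s x * g x)"
      by (intro Bochner_Integration.integral_cong) (auto simp: trunc_power_def)
    finally show "?v s * (prim ^^ Suc j) g s = ?v s * (LINT x|LI. ?k s x * g x)"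
      by simp
  qed
  also have "\<dots> = (LINT x|LI. g x * (LINT s|LI. ?k s x * ?v s))"
    by (rule kernel_swap[OF km kb g vi])
  also have "\<dots> = (LINT x|LI. complex_of_real (trunc_power c (Suc j) x / fact (Suc j)) * g x)"
  proof (intro Bochner_Integration.integral_cong refl)
    fix x assume "x \<in> space LI"
    then have "x \<in> II"
      by simp
    from power_cut_integral[OF this Suc.prems, of j]
    show "g x * (LINT s|LI. ?k s x * ?v s) = complex_of_real (trunc_power c (Suc j) x / fact (Suc j)) * g x"
      by (simp only: mult.commute[of "g x"])
  qed
  finally show ?case .
qed

text \<open>The pairing is bilinear, so that conjugation happens only once, when the conjugate
  residual or an oscillating multiple of it is inserted for \<open>g\<close>.\<close>

definition spline_orth :: "nat \<Rightarrow> nat \<Rightarrow> (nat \<Rightarrow> real) \<Rightarrow> (real \<Rightarrow> complex) \<Rightarrow> bool" where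
  "spline_orth m N t g \<longleftrightarrow> (\<forall>s. spline m N t s \<longrightarrow> (LINT x|LI. s x * g x) = 0)"

text \<open>At the endpoint 1 no truncation takes place: Cauchy's kernel is a polynomial of degree
  below \<open>m\<close> for every order up to \<open>m\<close>.\<close>

lemma spline_orth_prim_1:
  assumes o: "spline_orth m N t g" and g: "integrable LI g" and k: "1 \<le> k" "k \<le> m"
  shows "(prim ^^ k) g 1 = 0"
proof -
  obtain j where j: "k = Suc j" "j < m"
    using k by (cases k) auto
  have "degree ([:1, -1:] ^ j :: complex poly) < m"
    using j by (simp add: degree_power_eq)
  from spline_poly[OF this] have "(LINT x|LI. poly ([:1, -1:] ^ j) (complex_of_real x) * g x) = 0"
    using o unfolding spline_orth_def by blast
  moreover have "(prim ^^ k) g 1 = (LINT x|LI. (1 / fact j) * (poly ([:1, -1:] ^ j) (complex_of_real x) * g x))"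
    unfolding j(1) by (subst iterated_prim_formula[OF g]) (auto intro!: Bochner_Integration.integral_cong simp: trunc_power_def)
  ultimately show ?thesis
    by simp
qed

text \<open>At a knot the kernel is a genuine truncated power. It has spline smoothness for exponent
  \<open>m - 1\<close>, which is why this concerns the \<open>m\<close>-th primitive alone.\<close>

lemma spline_orth_prim_knot:
  assumes o: "spline_orth m N t g" and g: "integrable LI g" and m: "m > 0"
    and p: "partition N t" and i: "i \<le> Suc N"
  shows "(prim ^^ m) g (t i) = 0"
proof -
  have "(LINT x|LI. complex_of_real (trunc_power (t i) (m - 1) x) * g x) = 0"
    using o spline_trunc_power[OF p m i] unfolding spline_orth_def by blast
  moreover have "(prim ^^ m) g (t i) = (LINT x|LI. (1 / fact (m - 1)) * (complex_of_real (trunc_power (t i) (m - 1) x) * g x))"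
    using iterated_prim_formula[OF g partition_range[OF p i], of "m - 1"] m by simp
  ultimately show ?thesis
    by simp
qed

text \<open>By Rolle, zeros that are dense at scale \<open>d\<close> force zeros of the derivative at scale \<open>3 d\<close>.\<close>

definition zeros_at_scale :: "(real \<Rightarrow> real) \<Rightarrow> real \<Rightarrow> bool" where
  "zeros_at_scale \<phi> d \<longleftrightarrow> (\<forall>a. -1 \<le> a \<and> a + d \<le> 1 \<longrightarrow> (\<exists>z\<in>{a..a + d}. \<phi> z = 0))"

lemma zeros_at_scale_deriv:
  assumes z: "zeros_at_scale \<phi> d" and d: "d > 0"
    and der: "\<And>x. x \<in> II \<Longrightarrow> (\<phi> has_real_derivative \<phi>' x) (at x within II)"
  shows "zeros_at_scale \<phi>' (3 * d)"
  unfolding zeros_at_scale_def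
proof (intro allI impI)
  fix a assume a: "-1 \<le> a \<and> a + 3 * d \<le> 1"
  \<comment> \<open>Taking zeros in the first and the last third keeps them distinct, as Rolle
    requires.\<close>
  have "-1 \<le> a \<and> a + d \<le> 1" "-1 \<le> a + 2 * d \<and> (a + 2 * d) + d \<le> 1"
    using a d by auto
  then obtain z1 z2 where z1: "z1 \<in> {a..a + d}" "\<phi> z1 = 0" and z2: "z2 \<in> {a + 2 * d..a + 2 * d + d}" "\<phi> z2 = 0"
    using z unfolding zeros_at_scale_def by meson
  have "z1 < z2"
    using z1 z2 d by auto
  have sub: "{z1..z2} \<subseteq> II"
    using z1 z2 a by auto
  have "\<exists>z>z1. z < z2 \<and> (\<lambda>h. \<phi>' z * h) = (\<lambda>v. 0)"
  proof (rule Rolle_deriv[OF \<open>z1 < z2\<close>])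
    show "\<phi> z1 = \<phi> z2"
      using z1 z2 by simp
    have "continuous_on II \<phi>"
      using der by (rule DERIV_continuous_on)
    then show "continuous_on {z1..z2} \<phi>"
      using sub by (rule continuous_on_subset)
    fix x assume x: "z1 < x" "x < z2"
    then have "x \<in> interior II"
      using sub by (auto simp: interior_atLeastAtMost_real)
    then have "at x within II = at x"
      by (rule at_within_interior)
    moreover have "x \<in> II"
      using x sub by auto
    ultimately have "(\<phi> has_real_derivative \<phi>' x) (at x)"
      using der by metis
    then show "(\<phi> has_derivative (\<lambda>h. \<phi>' x * h)) (at x)"
      by (simp add: has_field_derivative_def)
  qed
  then obtain z where "z1 < z" "z < z2" "(\<lambda>h. \<phi>' z * h) = (\<lambda>v. 0)"
    by blast
  moreover from this(3) have "\<phi>' z = 0"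
    by (metis mult.right_neutral)
  ultimately show "\<exists>z\<in>{a..a + 3 * d}. \<phi>' z = 0"
    using z1 z2 by (intro bexI[of _ z]) auto
qed

lemma has_real_derivative_bounded_linear:
  assumes "bounded_linear \<rho>" "(F has_vector_derivative f) (at x within S)"
  shows "((\<lambda>x. \<rho> (F x)) has_real_derivative \<rho> f) (at x within S)"
  using bounded_linear.has_vector_derivative[OF assms]
  by (simp add: has_real_derivative_iff_has_vector_derivative)

text \<open>Rolle fails for complex values, hence the real functional \<rho>, later
  \<open>Re\<close> and \<open>Im\<close>, whose zeros may differ. The \<open>m\<close>-th primitive
  vanishes at the knots, and each derivative taken triples the scale.\<close>

lemma spline_orth_zeros:
  assumes o: "spline_orth m N t g" and g: "integrable LI g" and m: "m > 0"
    and p: "partition N t" and \<rho>: "bounded_linear (\<rho> :: complex \<Rightarrow> real)"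
    and k: "k < m"
  shows "zeros_at_scale (\<lambda>x. \<rho> ((prim ^^ (m - k)) g x)) (3 ^ k * mesh N t)"
  using k
proof (induction k)
  case 0
  show ?case
    unfolding zeros_at_scale_def
  proof (intro allI impI)
    fix a assume "-1 \<le> a \<and> a + 3 ^ 0 * mesh N t \<le> 1"
    then obtain j where "j \<le> Suc N" "a \<le> t j" "t j \<le> a + mesh N t"
      using partition_knot_in_interval[OF p, of a] by auto
    then show "\<exists>z\<in>{a..a + 3 ^ 0 * mesh N t}. \<rho> ((prim ^^ (m - 0)) g z) = 0"
      using spline_orth_prim_knot[OF o g m p] bounded_linear.linear[OF \<rho>]
      by (intro bexI[of _ "t j"]) (auto simp: linear_0)
  qed
next
  case (Suc k)
  obtain n where n: "m - Suc k = Suc n" "m - k = Suc (Suc n)"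
    using Suc.prems by (metis Suc_diff_Suc Suc_lessD)
  have c: "continuous_on II ((prim ^^ Suc n) g)"
    using prim_continuous_on[OF iterated_prim_integrable[OF g, of n]] by simp
  have "zeros_at_scale (\<lambda>x. \<rho> ((prim ^^ Suc n) g x)) (3 * (3 ^ k * mesh N t))"
  proof (rule zeros_at_scale_deriv)
    show "zeros_at_scale (\<lambda>x. \<rho> ((prim ^^ Suc (Suc n)) g x)) (3 ^ k * mesh N t)"
      using Suc n by simp
    show "((\<lambda>x. \<rho> ((prim ^^ Suc (Suc n)) g x)) has_real_derivative \<rho> ((prim ^^ Suc n) g x)) (at x within II)"
      if "x \<in> II" for x
      using has_real_derivative_bounded_linear[OF \<rho> prim_has_vector_derivative[OF c that]] by simp
  qed (use mesh_pos[OF p] in simp)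
  then show ?case
    by (simp only: n) (simp add: mult.assoc)
qed

text \<open>Near every \<open>x\<close> there is a zero of each of the two parts, so
  \<open>|prim f x|\<close> is at most twice the integral of \<open>|f|\<close> over a window of
  radius \<open>d\<close>. Squaring gives 4, Cauchy-Schwarz contributes one window length
  \<open>2 d\<close> and Fubini another, in total \<open>(4 d)^2\<close>.\<close>

lemma poincare_zeros:
  assumes f: "L2_on f" and d: "0 < d" "d \<le> 2"
    and z: "zeros_at_scale (\<lambda>x. Re (prim f x)) d" "zeros_at_scale (\<lambda>x. Im (prim f x)) d"
  shows "l2norm (prim f) \<le> 4 * d * l2norm f"
proof -
  define \<theta> where "\<theta> = (\<lambda>x t::real. if \<bar>t - x\<bar> \<le> d then 1 else (0::real))"
  have fi: "integrable LI f"
    by (rule L2_integrable[OF f])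
  have fm: "f \<in> borel_measurable LI"
    by (rule L2_measurable[OF f])
  have \<theta>m: "case_prod \<theta> \<in> borel_measurable (LI \<Otimes>\<^sub>M LI)"
    unfolding \<theta>_def case_prod_beta' by measurable
  have \<theta>1: "norm (\<theta> x t) \<le> 1" for x t
    by (simp add: \<theta>_def)
  have \<theta>x: "(\<lambda>t. \<theta> x t) \<in> borel_measurable LI" for x
    unfolding \<theta>_def by measurable
  have len: "(LINT t|LI. \<theta> x t) \<le> 2 * d" for x
  proof -
    have "(LINT t|LI. \<theta> x t) = (LINT t:II|lborel. \<theta> x t)"
      by (simp add: set_integral_LI)
    also have "\<dots> = (LINT t|lborel. indicator (II \<inter> {x - d..x + d}) t)"
      unfolding set_lebesgue_integral_def \<theta>_def
      by (intro Bochner_Integration.integral_cong) (auto split: split_indicator)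
    also have "\<dots> = measure lborel (II \<inter> {x - d..x + d})"
      by simp
    also have "\<dots> \<le> measure lborel {x - d..x + d}"
      by (rule measure_mono_fmeasurable) (auto simp: fmeasurable_def emeasure_lborel_Icc_eq)
    also have "\<dots> = 2 * d"
      using d by simp
    finally show ?thesis .
  qed
  have pt: "cmod (prim f x) \<le> 2 * (LINT t|LI. \<theta> x t * cmod (f t))" if x: "x \<in> II" for x
  proof -
    \<comment> \<open>The window starting at \<open>a\<close> stays inside the interval, which uses
      \<open>d \<le> 2\<close>, and each of its points is within \<open>d\<close> of
      \<open>x\<close>.\<close>
    define a where "a = min x (1 - d)"
    have a: "-1 \<le> a \<and> a + d \<le> 1"
      using x d by (auto simp: a_def)
    have ax: "\<bar>x - y\<bar> \<le> d" if "y \<in> {a..a + d}" for y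
      using that x by (auto simp: a_def min_def split: if_splits)
    obtain z1 z2 where z1: "z1 \<in> {a..a + d}" "Re (prim f z1) = 0" and z2: "z2 \<in> {a..a + d}" "Im (prim f z2) = 0"
      using z a unfolding zeros_at_scale_def by meson
    have diff: "cmod (prim f x - prim f y) \<le> (LINT t|LI. \<theta> x t * cmod (f t))" if y: "y \<in> {a..a + d}" for y
    proof -
      have "cmod (prim f x - prim f y) \<le> (LINT t|LI. (if \<bar>t - x\<bar> \<le> \<bar>x - y\<bar> then cmod (f t) else 0))"
        by (rule prim_diff_bound[OF fi])
      also have "\<dots> \<le> (LINT t|LI. \<theta> x t * cmod (f t))"
      proof (rule integral_mono')
        show "integrable LI (\<lambda>t. \<theta> x t * cmod (f t))"
          by (rule integrable_LI_mult_bounded[OF \<theta>x \<theta>1]) (use fi in auto)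
      qed (use ax[OF y] in \<open>auto simp: \<theta>_def\<close>)
      finally show ?thesis .
    qed
    have "\<bar>Re (prim f x)\<bar> \<le> (LINT t|LI. \<theta> x t * cmod (f t))"
      using order_trans[OF abs_Re_le_cmod diff[OF z1(1)]] z1(2) by simp
    moreover have "\<bar>Im (prim f x)\<bar> \<le> (LINT t|LI. \<theta> x t * cmod (f t))"
      using order_trans[OF abs_Im_le_cmod diff[OF z2(1)]] z2(2) by simp
    ultimately show ?thesis
      using cmod_le[of "prim f x"] by simp
  qed
  have sqi: "integrable LI (\<lambda>t. (cmod (f t))^2)"
    by (rule L2_sq_integrable[OF f])
  \<comment> \<open>The indicator is its own square, so one copy is given to each Cauchy-Schwarz
    factor.\<close>
  have cs: "(LINT t|LI. \<theta> x t * cmod (f t))^2 \<le> 2 * d * (LINT t|LI. \<theta> x t * (cmod (f t))^2)" for x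
  proof -
    have \<theta>sq: "(\<theta> x t)^2 = \<theta> x t" "cmod (complex_of_real (\<theta> x t)) = \<theta> x t" for t
      by (auto simp: \<theta>_def)
    have L: "L2_on (\<lambda>t. complex_of_real (\<theta> x t))" "L2_on (\<lambda>t. complex_of_real (\<theta> x t) * f t)"
      using \<theta>x[of x] \<theta>1[of x] by (intro L2_bounded[where B = 1] L2_mult_bounded[OF _ _ f, where B = 1]; simp)+
    have "(LINT t|LI. \<theta> x t * cmod (f t)) = (LINT t|LI. cmod (complex_of_real (\<theta> x t)) * cmod (complex_of_real (\<theta> x t) * f t))"
      by (intro Bochner_Integration.integral_cong) (auto simp: \<theta>_def)
    also have "\<dots> \<le> l2norm (\<lambda>t. complex_of_real (\<theta> x t)) * l2norm (\<lambda>t. complex_of_real (\<theta> x t) * f t)"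
      by (rule l2_Cauchy_Schwarz_abs[OF L])
    finally have "(LINT t|LI. \<theta> x t * cmod (f t))^2 \<le> (l2norm (\<lambda>t. complex_of_real (\<theta> x t)) * l2norm (\<lambda>t. complex_of_real (\<theta> x t) * f t))^2"
      by (rule power_mono) (auto intro!: integral_nonneg_AE simp: \<theta>_def)
    also have "\<dots> = (LINT t|LI. \<theta> x t) * (LINT t|LI. \<theta> x t * (cmod (f t))^2)"
      unfolding power_mult_distrib l2norm_sq norm_mult \<theta>sq ..
    also have "\<dots> \<le> 2 * d * (LINT t|LI. \<theta> x t * (cmod (f t))^2)"
      by (intro mult_right_mono len integral_nonneg_AE) (auto simp: \<theta>_def)
    finally show ?thesis .
  qed
  have "(l2norm (prim f))^2 \<le> (LINT x|LI. 8 * d * (LINT t|LI. \<theta> x t * (cmod (f t))^2))"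
    unfolding l2norm_sq
  proof (rule integral_mono')
    show "integrable LI (\<lambda>x. 8 * d * (LINT t|LI. \<theta> x t * (cmod (f t))^2))"
      by (intro integrable_mult_right kernel_integrable[OF \<theta>m \<theta>1 sqi])
    fix x assume "x \<in> space LI"
    then have "(cmod (prim f x))^2 \<le> (2 * (LINT t|LI. \<theta> x t * cmod (f t)))^2"
      by (intro power_mono pt) auto
    also have "\<dots> = 4 * (LINT t|LI. \<theta> x t * cmod (f t))^2"
      by (simp only: power_mult_distrib) simp
    also have "\<dots> \<le> 4 * (2 * d * (LINT t|LI. \<theta> x t * (cmod (f t))^2))"
      by (intro mult_left_mono cs) simp
    finally show "(cmod (prim f x))^2 \<le> 8 * d * (LINT t|LI. \<theta> x t * (cmod (f t))^2)"
      by simp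
    show "0 \<le> 8 * d * (LINT t|LI. \<theta> x t * (cmod (f t))^2)"
      using d by (intro mult_nonneg_nonneg integral_nonneg_AE) (auto simp: \<theta>_def)
  qed
  also have "\<dots> = 8 * d * (LINT x|LI. 1 * (LINT t|LI. \<theta> x t * (cmod (f t))^2))"
    by simp
  also have "\<dots> = 8 * d * (LINT t|LI. (cmod (f t))^2 * (LINT x|LI. \<theta> x t * 1))"
    by (subst kernel_swap[OF \<theta>m \<theta>1 sqi]) auto
  also have "\<dots> \<le> 8 * d * (LINT t|LI. (cmod (f t))^2 * (2 * d))"
  proof (intro mult_left_mono integral_mono')
    show "integrable LI (\<lambda>t. (cmod (f t))^2 * (2 * d))"
      using sqi by (rule integrable_mult_left)
    have sym: "\<theta> x t = \<theta> t x" for x t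
      by (simp add: \<theta>_def abs_minus_commute)
    show "(LINT x|LI. \<theta> x t * 1) \<le> 2 * d" for t
      using len[of t] sym[of _ t] by simp
  qed (use d in auto)
  also have "\<dots> = (4 * d * l2norm f)^2"
    by (simp add: power_mult_distrib l2norm_sq power2_eq_square[of d])
  finally show ?thesis
    by (rule power2_le_imp_le) (use d in simp)
qed

section \<open>Duality bound for Sobolev functions\<close>

lemma spline_orth_prim_norm:
  assumes o: "spline_orth m N t g" and g: "L2_on g" and p: "partition N t"
    and h: "3 ^ m * mesh N t \<le> 2" and k: "1 \<le> k" "k \<le> m"
  shows "l2norm ((prim ^^ k) g) \<le> 4 * 3 ^ m * mesh N t * l2norm ((prim ^^ (k - 1)) g)"
proof -
  \<comment> \<open>The \<open>k\<close>-th primitive is reached from the \<open>m\<close>-th by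
    \<open>m - k\<close> Rolle steps; the uniform majorant \<open>3^m h\<close> is used for all
    \<open>k\<close>.\<close>
  define d where "d = 3 ^ (m - k) * mesh N t"
  have gi: "integrable LI g"
    by (rule L2_integrable[OF g])
  have "(3::real) ^ (m - k) \<le> 3 ^ m"
    by (intro power_increasing) auto
  then have d: "d \<le> 3 ^ m * mesh N t" "d > 0"
    using mesh_pos[OF p] by (auto simp: d_def intro!: mult_right_mono)
  have k': "(prim ^^ k) g = prim ((prim ^^ (k - 1)) g)"
    using k by (cases k) auto
  have mk: "m - (m - k) = k" "m - k < m" "m > 0"
    using k by auto
  have "zeros_at_scale (\<lambda>x. Re ((prim ^^ k) g x)) d" "zeros_at_scale (\<lambda>x. Im ((prim ^^ k) g x)) d"
    using spline_orth_zeros[OF o gi mk(3) p bounded_linear_Re mk(2)]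
      spline_orth_zeros[OF o gi mk(3) p bounded_linear_Im mk(2)] unfolding mk(1) d_def by auto
  then have "l2norm (prim ((prim ^^ (k - 1)) g)) \<le> 4 * d * l2norm ((prim ^^ (k - 1)) g)"
    unfolding k' using d h by (intro poincare_zeros iterated_prim_L2 g) auto
  also have "\<dots> \<le> 4 * (3 ^ m * mesh N t) * l2norm ((prim ^^ (k - 1)) g)"
    by (intro mult_right_mono mult_left_mono d) auto
  finally show ?thesis
    unfolding k' by (simp add: mult.assoc)
qed

lemma spline_orth_iterated_prim_norm:
  assumes o: "spline_orth m N t g" and g: "L2_on g" and p: "partition N t"
    and h: "3 ^ m * mesh N t \<le> 2" and k: "k \<le> m"
  shows "l2norm ((prim ^^ k) g) \<le> (4 * 3 ^ m * mesh N t) ^ k * l2norm g"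
  using k
proof (induction k)
  case (Suc k)
  have "l2norm ((prim ^^ Suc k) g) \<le> 4 * 3 ^ m * mesh N t * l2norm ((prim ^^ k) g)"
    using spline_orth_prim_norm[OF o g p h, of "Suc k"] Suc.prems by simp
  also have "\<dots> \<le> 4 * 3 ^ m * mesh N t * ((4 * 3 ^ m * mesh N t) ^ k * l2norm g)"
    using Suc mesh_pos[OF p] by (intro mult_left_mono) auto
  finally show ?case
    by (simp add: mult_ac)
qed simp

text \<open>Each integration by parts is applied to the absolutely continuous representative of
  \<open>G j\<close>. The boundary term vanishes because the next primitive of \<open>g\<close> is 0
  at the endpoint 1.\<close>

lemma sobolev_pairing:
  assumes G: "sobolev_witness m w G" and g: "L2_on g" and o: "spline_orth m N t g" and j: "j \<le> m"
  shows "(LINT x|LI. w x * g x) = (-1) ^ j * (LINT x|LI. G j x * (prim ^^ j) g x)"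
  using j
proof (induction j)
  case 0
  show ?case
    using G by (simp add: sobolev_witness_def)
next
  case (Suc j)
  obtain c where c: "AE x in LI. G j x = c + prim (G (Suc j)) x"
    using sobolev_witness_step[OF G, of j] Suc.prems by auto
  have Gj: "L2_on (G j)" and GS: "integrable LI (G (Suc j))"
    using sobolev_witness_L2[OF G] Suc.prems by (auto intro: L2_integrable)
  have F: "L2_on ((prim ^^ j) g)"
    by (rule iterated_prim_L2[OF g])
  have Fi: "integrable LI ((prim ^^ j) g)"
    by (rule L2_integrable[OF F])
  have "(LINT x|LI. G j x * (prim ^^ j) g x) = (LINT x|LI. (c + prim (G (Suc j)) x) * (prim ^^ j) g x)"
  proof (rule integral_cong_AE)
    show "(\<lambda>x. G j x * (prim ^^ j) g x) \<in> borel_measurable LI"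
      using L2_measurable[OF Gj] L2_measurable[OF F] by simp
    show "(\<lambda>x. (c + prim (G (Suc j)) x) * (prim ^^ j) g x) \<in> borel_measurable LI"
      using prim_measurable[OF GS] L2_measurable[OF F] by simp
    show "AE x in LI. G j x * (prim ^^ j) g x = (c + prim (G (Suc j)) x) * (prim ^^ j) g x"
      using c by eventually_elim simp
  qed
  also have "\<dots> = - (LINT x|LI. G (Suc j) x * prim ((prim ^^ j) g) x)"
  proof -
    have "prim ((prim ^^ j) g) 1 = 0"
      using spline_orth_prim_1[OF o L2_integrable[OF g], of "Suc j"] Suc.prems by simp
    then show ?thesis
      using integration_by_parts[OF GS Fi, of c] by (simp add: eq_neg_iff_add_eq_0)
  qed
  finally show ?case
    using Suc by simp
qed

text \<open>All \<open>m\<close> powers of the mesh size come from the primitives of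
  \<open>g\<close>; of the witness only its top derivative enters. The bound holds for each witness,
  and division by \<open>q\<close> passes it to the infimum, with \<open>q = 0\<close> treated
  apart.\<close>

lemma sobolev_orth_bound:
  assumes w: "in_H m w" and g: "L2_on g" and o: "spline_orth m N t g" and p: "partition N t"
    and h: "3 ^ m * mesh N t \<le> 2"
  shows "cmod (LINT x|LI. w x * g x) \<le> (4 * 3 ^ m * mesh N t) ^ m * l2norm g * H_norm m w"
proof -
  define q where "q = (4 * 3 ^ m * mesh N t) ^ m * l2norm g"
  have q: "q \<ge> 0"
    using mesh_pos[OF p] by (simp add: q_def)
  have *: "cmod (LINT x|LI. w x * g x) \<le> q * sqrt (\<Sum>j\<le>m. (l2norm (G j))^2)" if G: "sobolev_witness m w G" for G
  proof -
    have "cmod (LINT x|LI. w x * g x) = cmod (LINT x|LI. G m x * (prim ^^ m) g x)"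
      unfolding sobolev_pairing[OF G g o order_refl] by (simp add: norm_mult norm_power)
    also have "\<dots> \<le> l2norm (G m) * l2norm ((prim ^^ m) g)"
      by (intro l2_Cauchy_Schwarz sobolev_witness_L2[OF G] iterated_prim_L2 g order_refl)
    also have "\<dots> \<le> sqrt (\<Sum>j\<le>m. (l2norm (G j))^2) * q"
    proof (rule mult_mono)
      have "(l2norm (G m))^2 \<le> (\<Sum>j\<le>m. (l2norm (G j))^2)"
        by (rule member_le_sum) auto
      then show "l2norm (G m) \<le> sqrt (\<Sum>j\<le>m. (l2norm (G j))^2)"
        by (rule real_le_rsqrt)
      show "l2norm ((prim ^^ m) g) \<le> q"
        unfolding q_def by (rule spline_orth_iterated_prim_norm[OF o g p h order_refl])
    qed (auto intro: sum_nonneg)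
    finally show ?thesis
      by (simp add: mult.commute)
  qed
  show ?thesis
    unfolding q_def[symmetric]
  proof (cases "q = 0")
    case True
    then show "cmod (LINT x|LI. w x * g x) \<le> q * H_norm m w"
      using * w unfolding in_H_def by auto
  next
    case False
    then have q0: "q > 0"
      using q by simp
    have "cmod (LINT x|LI. w x * g x) / q \<le> H_norm m w"
      unfolding H_norm_def
    proof (rule cInf_greatest)
      show "{sqrt (\<Sum>j\<le>m. (l2norm (g j))^2) |g. sobolev_witness m w g} \<noteq> {}"
        using w unfolding in_H_def by auto
    qed (use * q0 in \<open>auto simp: pos_divide_le_eq mult.commute\<close>)
    then show "cmod (LINT x|LI. w x * g x) \<le> q * H_norm m w"
      using q0 by (simp add: pos_divide_le_eq mult.commute)
  qed
qed

section \<open>Integral operator and Galerkin space\<close>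

context C1_kernel
begin

lemma cut_pairing:
  assumes g: "integrable LI g" and x: "x \<in> II" and t: "t \<in> II"
  shows "(LINT s|LI. (if s \<le> x then K s t * g s else 0))
    = K x t * prim g x - (LINT s|LI. (if s \<le> x then Ks s t * prim g s else 0))"
proof -
  have K: "K s t = K (-1) t + prim (\<lambda>s. Ks s t) s" if "s \<in> II" for s
    by (rule prim_of_derivative[OF cont_section(3)[OF t] deriv_s[OF _ t] that])
  have "(LINT s|LI. (if s \<le> x then K s t * g s else 0))
      = (LINT s|LI. (if s \<le> x then (K (-1) t + prim (\<lambda>s. Ks s t) s) * g s else 0))"
    by (intro Bochner_Integration.integral_cong refl) (simp add: K[symmetric])
  then show ?thesis
    using integration_by_parts_cut[OF integrable_LI_continuous[OF cont_section(3)[OF t]] g, of x "K (-1) t"] K[OF x]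
    by (simp add: eq_diff_eq)
qed

lemma cut_remainder_bound:
  assumes g: "integrable LI g" and t: "t \<in> II"
  shows "cmod (LINT s|LI. (if s \<le> x then Ks s t * prim g s else 0)) \<le> B * (LINT s|LI. cmod (prim g s))"
proof -
  have "cmod (LINT s|LI. (if s \<le> x then Ks s t * prim g s else 0)) \<le> (LINT s|LI. cmod (if s \<le> x then Ks s t * prim g s else 0))"
    by (rule integral_norm_bound)
  also have "\<dots> \<le> (LINT s|LI. B * cmod (prim g s))"
  proof (rule integral_mono')
    show "integrable LI (\<lambda>s. B * cmod (prim g s))"
      by (intro integrable_mult_right integrable_norm prim_integrable g)
    fix s assume "s \<in> space LI"
    then have "cmod (Ks s t) * cmod (prim g s) \<le> B * cmod (prim g s)"
      using bounds(2)[of s t] t by (intro mult_right_mono) auto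
    then show "cmod (if s \<le> x then Ks s t * prim g s else 0) \<le> B * cmod (prim g s)"
      using B_pos by (simp add: norm_mult)
  qed (use B_pos in auto)
  finally show ?thesis
    by simp
qed

text \<open>The kernel jumps at the diagonal once it is split, so integrating by parts leaves the
  boundary term \<open>K t t * prim g t\<close>. This is why the bound depends on \<open>t\<close>
  through \<open>prim g t\<close> and is not merely a norm.\<close>

lemma cut_pairing_bound:
  assumes g: "L2_on g" and t: "t \<in> II" and g1: "prim g 1 = 0"
  shows "cmod (LINT s|LI. (if s \<le> t then K s t * g s else 0)) \<le> B * cmod (prim g t) + 4 * B * l2norm (prim g)"
    and "cmod (LINT s|LI. (if s \<le> t then 0 else K s t * g s)) \<le> B * cmod (prim g t) + 4 * B * l2norm (prim g)"
proof -
  have gi: "integrable LI g"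
    by (rule L2_integrable[OF g])
  define R where "R = (\<lambda>x. LINT s|LI. (if s \<le> x then Ks s t * prim g s else 0))"
  have "B * (LINT s|LI. cmod (prim g s)) \<le> B * (2 * l2norm (prim g))"
    using B_pos by (intro mult_left_mono integral_abs_le_l2norm prim_L2 gi) auto
  then have R: "cmod (R x) \<le> 2 * B * l2norm (prim g)" for x
    using cut_remainder_bound[OF gi t, of x] by (simp add: R_def)
  have Kt: "cmod (K t t * prim g t) \<le> B * cmod (prim g t)"
    unfolding norm_mult using bounds(1)[OF t t] by (rule mult_right_mono) simp
  have le: "(LINT s|LI. (if s \<le> t then K s t * g s else 0)) = K t t * prim g t - R t"
    unfolding R_def by (rule cut_pairing[OF gi t t])
  have nn: "0 \<le> 2 * B * l2norm (prim g)"
    using B_pos by simp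
  have "cmod (K t t * prim g t - R t) \<le> cmod (K t t * prim g t) + cmod (R t)"
    by (rule norm_triangle_ineq4)
  then show "cmod (LINT s|LI. (if s \<le> t then K s t * g s else 0)) \<le> B * cmod (prim g t) + 4 * B * l2norm (prim g)"
    unfolding le using R[of t] Kt nn by linarith
  have Kgi: "integrable LI (\<lambda>s. K s t * g s)"
    by (rule integrable_LI_mult_bounded[OF continuous_on_borel_measurable_LI[OF cont_section(1)[OF t]] bounds(1)[OF _ t] gi])
  have "(LINT s|LI. (if s \<le> t then 0 else K s t * g s)) = (LINT s|LI. K s t * g s - (if s \<le> t then K s t * g s else 0))"
    by (intro Bochner_Integration.integral_cong) auto
  also have "\<dots> = (LINT s|LI. K s t * g s) - (LINT s|LI. (if s \<le> t then K s t * g s else 0))"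
    by (rule Bochner_Integration.integral_diff[OF Kgi integrable_cut[OF Kgi]])
  \<comment> \<open>The full integral is the cut at 1, where the boundary term disappears with
    \<open>prim g 1\<close>.\<close>
  also have "(LINT s|LI. K s t * g s) = (LINT s|LI. (if s \<le> 1 then K s t * g s else 0))"
    by (intro Bochner_Integration.integral_cong) auto
  also have "\<dots> = - R 1"
    using cut_pairing[OF gi _ t, of 1] g1 by (simp add: R_def)
  finally have "(LINT s|LI. (if s \<le> t then 0 else K s t * g s)) = - R 1 - (K t t * prim g t - R t)"
    unfolding le .
  also have "cmod \<dots> \<le> cmod (R 1) + (cmod (K t t * prim g t) + cmod (R t))"
    using norm_triangle_ineq4[of "- R 1" "K t t * prim g t - R t"] norm_triangle_ineq4[of "K t t * prim g t" "R t"] by simp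
  finally show "cmod (LINT s|LI. (if s \<le> t then 0 else K s t * g s)) \<le> B * cmod (prim g t) + 4 * B * l2norm (prim g)"
    using R[of t] R[of 1] Kt by linarith
qed

text \<open>The 9 is 1 from Cauchy-Schwarz on the boundary term plus \<open>4 * 2\<close> from the
  L1 norm of \<open>u\<close>.\<close>

lemma pairing_bound:
  assumes u: "L2_on u" and g: "L2_on g"
    and J: "\<And>t. t \<in> II \<Longrightarrow> cmod (J t) \<le> B * cmod (prim g t) + 4 * B * l2norm (prim g)"
  shows "cmod (LINT t|LI. u t * J t) \<le> 9 * B * l2norm u * l2norm (prim g)"
proof -
  let ?p = "l2norm (prim g)"
  have pL: "L2_on (prim g)"
    by (rule prim_L2[OF L2_integrable[OF g]])
  have i1: "integrable LI (\<lambda>t. cmod (u t) * cmod (prim g t))"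
    by (rule integrable_prod_aux[OF u pL])
  have i2: "integrable LI (\<lambda>t. cmod (u t))"
    by (intro integrable_norm L2_integrable u)
  have "cmod (LINT t|LI. u t * J t) \<le> (LINT t|LI. cmod (u t * J t))"
    by (rule integral_norm_bound)
  also have "\<dots> \<le> (LINT t|LI. B * (cmod (u t) * cmod (prim g t)) + 4 * B * ?p * cmod (u t))"
  proof (rule integral_mono')
    show "integrable LI (\<lambda>t. B * (cmod (u t) * cmod (prim g t)) + 4 * B * ?p * cmod (u t))"
      by (intro Bochner_Integration.integrable_add integrable_mult_right i1 i2)
    fix t assume "t \<in> space LI"
    then have "cmod (u t) * cmod (J t) \<le> cmod (u t) * (B * cmod (prim g t) + 4 * B * ?p)"
      by (intro mult_left_mono J) auto
    then show "cmod (u t * J t) \<le> B * (cmod (u t) * cmod (prim g t)) + 4 * B * ?p * cmod (u t)"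
      by (simp add: norm_mult algebra_simps)
  qed (use B_pos in auto)
  also have "\<dots> = B * (LINT t|LI. cmod (u t) * cmod (prim g t)) + 4 * B * ?p * (LINT t|LI. cmod (u t))"
    using i1 i2 by simp
  also have "\<dots> \<le> B * (l2norm u * ?p) + 4 * B * ?p * (2 * l2norm u)"
    using B_pos by (intro add_mono mult_left_mono l2_Cauchy_Schwarz_abs integral_abs_le_l2norm u pL) auto
  also have "\<dots> = 9 * B * l2norm u * ?p"
    by simp
  finally show ?thesis .
qed

text \<open>The phase separates: for \<open>s > t\<close> it is
  \<open>cis (- \<kappa> t) * cis (\<kappa> s)\<close>, for \<open>s \<le> t\<close> the conjugate.
  The factor in \<open>s\<close> is joined to \<rho>, giving functions orthogonal to splines, so the
  integration by parts differentiates only the smooth kernel and the gain of one mesh size is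
  uniform in \<kappa>.\<close>

lemma Kop_orth_bound:
  assumes u: "L2_on u" and \<rho>: "L2_on \<rho>" and m: "m > 0" and p: "partition N t" and h: "3 ^ m * mesh N t \<le> 2"
    and o: "spline_orth m N t (\<lambda>x. cis (\<kappa> * x) * \<rho> x)" "spline_orth m N t (\<lambda>x. cis (- \<kappa> * x) * \<rho> x)"
  shows "cmod (LINT s|LI. Kop K \<kappa> u s * \<rho> s) \<le> 72 * 3 ^ m * B * mesh N t * l2norm u * l2norm \<rho>"
proof -
  have ui: "integrable LI u" and \<rho>i: "integrable LI \<rho>"
    using L2_integrable u \<rho> by auto
  define g1 g2 where "g1 = (\<lambda>x. cis (\<kappa> * x) * \<rho> x)" and "g2 = (\<lambda>x. cis (- \<kappa> * x) * \<rho> x)"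
  have g: "L2_on g1" "L2_on g2" "l2norm g1 = l2norm \<rho>" "l2norm g2 = l2norm \<rho>"
    unfolding g1_def g2_def by (rule l2norm_cis_mult[OF \<rho>])+
  have o': "spline_orth m N t g1" "spline_orth m N t g2"
    using o by (simp_all add: g1_def g2_def)
  have p1: "prim g1 1 = 0" "prim g2 1 = 0"
    using spline_orth_prim_1[OF o'(1) L2_integrable[OF g(1)], of 1] spline_orth_prim_1[OF o'(2) L2_integrable[OF g(2)], of 1] m
    by auto
  have pn: "l2norm (prim g1) \<le> 4 * 3 ^ m * mesh N t * l2norm \<rho>" "l2norm (prim g2) \<le> 4 * 3 ^ m * mesh N t * l2norm \<rho>"
    using spline_orth_prim_norm[OF o'(1) g(1) p h, of 1] spline_orth_prim_norm[OF o'(2) g(2) p h, of 1] m g(3,4) by auto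
  have kap: "(9 * B * l2norm u) * l2norm (prim g1) \<le> (9 * B * l2norm u) * (4 * 3 ^ m * mesh N t * l2norm \<rho>)"
    "(9 * B * l2norm u) * l2norm (prim g2) \<le> (9 * B * l2norm u) * (4 * 3 ^ m * mesh N t * l2norm \<rho>)"
    by (rule mult_left_mono[OF pn(1)], simp add: B_pos less_imp_le, rule mult_left_mono[OF pn(2)], simp add: B_pos less_imp_le)
  have "(LINT s|LI. \<rho> s * T1 \<kappa> u s) = (LINT t|LI. u t * (LINT s|LI. k1 \<kappa> s t * \<rho> s))"
    unfolding T1_def by (rule kernel_swap[OF k_measurable(1) k_bound(1) ui \<rho>i])
  also have "cmod \<dots> \<le> 9 * B * l2norm u * l2norm (prim g1)"
  proof (rule pairing_bound[OF u g(1)])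
    fix t :: real assume t: "t \<in> II"
    have "(LINT s|LI. k1 \<kappa> s t * \<rho> s) = (LINT s|LI. cis (- \<kappa> * t) * (if s \<le> t then 0 else K s t * g1 s))"
    proof (intro Bochner_Integration.integral_cong refl)
      fix s
      have "cis (\<kappa> * (s - t)) = cis (- \<kappa> * t) * cis (\<kappa> * s)"
        by (simp add: cis_mult algebra_simps)
      then show "k1 \<kappa> s t * \<rho> s = cis (- \<kappa> * t) * (if s \<le> t then 0 else K s t * g1 s)"
        by (simp add: k1_def g1_def mult_ac)
    qed
    then show "cmod (LINT s|LI. k1 \<kappa> s t * \<rho> s) \<le> B * cmod (prim g1 t) + 4 * B * l2norm (prim g1)"
      using cut_pairing_bound(2)[OF g(1) t p1(1)] by (simp add: norm_mult)
  qed
  finally have b1: "cmod (LINT s|LI. \<rho> s * T1 \<kappa> u s) \<le> (9 * B * l2norm u) * (4 * 3 ^ m * mesh N t * l2norm \<rho>)"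
    using kap(1) by linarith
  have "(LINT s|LI. \<rho> s * T2 \<kappa> u s) = (LINT t|LI. u t * (LINT s|LI. k2 \<kappa> s t * \<rho> s))"
    unfolding T2_def by (rule kernel_swap[OF k_measurable(2) k_bound(2) ui \<rho>i])
  also have "cmod \<dots> \<le> 9 * B * l2norm u * l2norm (prim g2)"
  proof (rule pairing_bound[OF u g(2)])
    fix t :: real assume t: "t \<in> II"
    have "(LINT s|LI. k2 \<kappa> s t * \<rho> s) = (LINT s|LI. cis (\<kappa> * t) * (if s \<le> t then K s t * g2 s else 0))"
    proof (intro Bochner_Integration.integral_cong refl)
      fix s
      have "cis (\<kappa> * (t - s)) = cis (\<kappa> * t) * cis (- \<kappa> * s)"
        by (simp add: cis_mult algebra_simps)
      then show "k2 \<kappa> s t * \<rho> s = cis (\<kappa> * t) * (if s \<le> t then K s t * g2 s else 0)"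
        by (simp add: k2_def g2_def mult_ac)
    qed
    then show "cmod (LINT s|LI. k2 \<kappa> s t * \<rho> s) \<le> B * cmod (prim g2 t) + 4 * B * l2norm (prim g2)"
      using cut_pairing_bound(1)[OF g(2) t p1(2)] by (simp add: norm_mult)
  qed
  finally have b2: "cmod (LINT s|LI. \<rho> s * T2 \<kappa> u s) \<le> (9 * B * l2norm u) * (4 * 3 ^ m * mesh N t * l2norm \<rho>)"
    using kap(2) by linarith
  define X Y where "X = (LINT s|LI. \<rho> s * T1 \<kappa> u s)" and "Y = (LINT s|LI. \<rho> s * T2 \<kappa> u s)"
  define Q where "Q = (9 * B * l2norm u) * (4 * 3 ^ m * mesh N t * l2norm \<rho>)"
  have "(LINT s|LI. Kop K \<kappa> u s * \<rho> s) = (LINT s|LI. \<rho> s * T1 \<kappa> u s + \<rho> s * T2 \<kappa> u s)"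
    by (intro Bochner_Integration.integral_cong refl) (simp add: Kop_eq[OF ui] algebra_simps)
  also have "\<dots> = X + Y"
    unfolding X_def Y_def by (intro Bochner_Integration.integral_add L2_mult_integrable \<rho> T_L2 ui)
  finally have "cmod (LINT s|LI. Kop K \<kappa> u s * \<rho> s) \<le> cmod X + cmod Y"
    using norm_triangle_ineq[of X Y] by simp
  \<comment> \<open>Two Volterra parts, each with \<open>9 * 4\<close>: the origin of 72.\<close>
  also have "\<dots> \<le> 2 * Q"
    using b1 b2 unfolding X_def[symmetric] Y_def[symmetric] Q_def[symmetric] by simp
  also have "\<dots> = 72 * 3 ^ m * B * mesh N t * l2norm u * l2norm \<rho>"
    unfolding Q_def by algebra
  finally show ?thesis .
qed

lemma Kop_sum:
  assumes "\<And>i. i < n \<Longrightarrow> L2_on (b i)" and s: "s \<in> II"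
  shows "Kop K \<kappa> (\<lambda>t. \<Sum>i<n. x i * b i t) s = (\<Sum>i<n. x i * Kop K \<kappa> (b i) s)"
proof -
  have bi: "integrable LI (b i)" if "i < n" for i
    using assms(1)[OF that] by (rule L2_integrable)
  have "integrable LI (\<lambda>t. \<Sum>i<n. x i * b i t)"
    using bi by (intro Bochner_Integration.integrable_sum integrable_mult_right) auto
  from Kop_eq[OF this s] have "Kop K \<kappa> (\<lambda>t. \<Sum>i<n. x i * b i t) s
      = T1 \<kappa> (\<lambda>t. \<Sum>i<n. x i * b i t) s + T2 \<kappa> (\<lambda>t. \<Sum>i<n. x i * b i t) s" .
  also have "T1 \<kappa> (\<lambda>t. \<Sum>i<n. x i * b i t) s = (\<Sum>i<n. x i * T1 \<kappa> (b i) s)"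
  proof -
    have "T1 \<kappa> (\<lambda>t. \<Sum>i<n. x i * b i t) s = (LINT t|LI. (\<Sum>i<n. x i * (k1 \<kappa> s t * b i t)))"
      unfolding T1_def by (intro Bochner_Integration.integral_cong refl) (simp add: sum_distrib_left mult_ac)
    also have "\<dots> = (\<Sum>i<n. LINT t|LI. x i * (k1 \<kappa> s t * b i t))"
      by (intro Bochner_Integration.integral_sum integrable_mult_right kernel_section_integrable[OF k_measurable(1) k_bound(1) bi s]) auto
    finally show ?thesis
      by (simp add: T1_def)
  qed
  also have "T2 \<kappa> (\<lambda>t. \<Sum>i<n. x i * b i t) s = (\<Sum>i<n. x i * T2 \<kappa> (b i) s)"
  proof -
    have "T2 \<kappa> (\<lambda>t. \<Sum>i<n. x i * b i t) s = (LINT t|LI. (\<Sum>i<n. x i * (k2 \<kappa> s t * b i t)))"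
      unfolding T2_def by (intro Bochner_Integration.integral_cong refl) (simp add: sum_distrib_left mult_ac)
    also have "\<dots> = (\<Sum>i<n. LINT t|LI. x i * (k2 \<kappa> s t * b i t))"
      by (intro Bochner_Integration.integral_sum integrable_mult_right kernel_section_integrable[OF k_measurable(2) k_bound(2) bi s]) auto
    finally show ?thesis
      by (simp add: T2_def)
  qed
  also have "(\<Sum>i<n. x i * T1 \<kappa> (b i) s) + (\<Sum>i<n. x i * T2 \<kappa> (b i) s) = (\<Sum>i<n. x i * Kop K \<kappa> (b i) s)"
    using bi by (simp add: sum.distrib[symmetric] Kop_eq[OF _ s] distrib_left)
  finally show ?thesis .
qed

end

section \<open>Finite dimension of the Galerkin space\<close>

lemma partition_cover:
  assumes p: "partition N t" and x: "x \<in> II" "x \<notin> t ` {..Suc N}"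
  shows "\<exists>j\<le>N. x \<in> {t j<..<t (Suc j)}"
proof -
  define J where "J = {j. j \<le> Suc N \<and> t j \<le> x}"
  have J: "finite J" "0 \<in> J"
    using p x(1) by (auto simp: J_def partition_def)
  define j where "j = Max J"
  have "j \<in> J"
    unfolding j_def using J by (intro Max_in) auto
  then have j: "j \<le> Suc N" "t j \<le> x"
    by (auto simp: J_def)
  have ne: "t i \<noteq> x" if "i \<le> Suc N" for i
    using x(2) that by auto
  have "j \<noteq> Suc N"
    using p x(1) j ne[of "Suc N"] by (auto simp: partition_def)
  then have "Suc j \<notin> J" "j \<le> N"
    using Max_ge[OF J(1), of "Suc j"] j by (auto simp: j_def)
  then show ?thesis
    using j ne[of j] by (intro exI[of _ j]) (auto simp: J_def)
qed

text \<open>The index is a pair of mesh interval and exponent. These functions are discontinuous in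
  general; they only span the splines off the knots, which is enough to bound a dimension.\<close>

definition pw_monomial :: "(nat \<Rightarrow> real) \<Rightarrow> nat \<times> nat \<Rightarrow> real \<Rightarrow> complex" where
  "pw_monomial t a x = (if x \<in> {t (fst a)<..<t (Suc (fst a))} then complex_of_real x ^ snd a else 0)"

lemma spline_pw_monomial:
  assumes p: "partition N t" and s: "spline m N t s"
  shows "\<exists>c. \<forall>x\<in>II - t ` {..Suc N}. s x = (\<Sum>a\<in>{..N} \<times> {..<m}. c a * pw_monomial t a x)"
proof -
  obtain q where q: "\<And>j. j \<le> N \<Longrightarrow> degree (q j) < m"
    "\<And>j x. j \<le> N \<Longrightarrow> x \<in> {t j<..<t (Suc j)} \<Longrightarrow> s x = poly (q j) (complex_of_real x)"
  proof -
    have "\<forall>j\<in>{..N}. \<exists>p. degree p < m \<and> (\<forall>x\<in>{t j<..<t (Suc j)}. s x = poly p (complex_of_real x))"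
      using s by (simp add: spline_def)
    from bchoice[OF this] obtain q
      where "\<forall>j\<in>{..N}. degree (q j) < m \<and> (\<forall>x\<in>{t j<..<t (Suc j)}. s x = poly (q j) (complex_of_real x))" ..
    then show thesis
      by (intro that[of q]) auto
  qed
  have "s x = (\<Sum>a\<in>{..N} \<times> {..<m}. coeff (q (fst a)) (snd a) * pw_monomial t a x)" if x: "x \<in> II - t ` {..Suc N}" for x
  proof -
    obtain j where j: "j \<le> N" "x \<in> {t j<..<t (Suc j)}"
      using partition_cover[OF p] x by blast
    have other: "x \<notin> {t i<..<t (Suc i)}" if "i \<le> N" "i \<noteq> j" for i
    proof (cases "i < j")
      case True
      then have "t (Suc i) \<le> t j"
        using partition_le[OF p] j by auto
      then show ?thesis
        using j by auto
    next
      case False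
      then have "t (Suc j) \<le> t i"
        using partition_le[OF p] that by auto
      then show ?thesis
        using j by auto
    qed
    have "(\<Sum>a\<in>{..N} \<times> {..<m}. coeff (q (fst a)) (snd a) * pw_monomial t a x)
        = (\<Sum>i\<le>N. \<Sum>k<m. coeff (q i) k * pw_monomial t (i, k) x)"
      by (simp add: sum.cartesian_product case_prod_beta)
    also have "\<dots> = (\<Sum>i\<in>{j}. \<Sum>k<m. coeff (q i) k * pw_monomial t (i, k) x)"
    proof (rule sum.mono_neutral_right)
      show "\<forall>i\<in>{..N} - {j}. (\<Sum>k<m. coeff (q i) k * pw_monomial t (i, k) x) = 0"
      proof
        fix i assume "i \<in> {..N} - {j}"
        then have "x \<notin> {t i<..<t (Suc i)}"
          by (intro other) auto
        then have "pw_monomial t (i, k) x = 0" for k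
          unfolding pw_monomial_def fst_conv by (rule if_not_P)
        then show "(\<Sum>k<m. coeff (q i) k * pw_monomial t (i, k) x) = 0"
          by simp
      qed
    qed (use j in auto)
    also have "\<dots> = (\<Sum>k<m. coeff (q j) k * complex_of_real x ^ k)"
      using j by (simp add: pw_monomial_def)
    also have "\<dots> = (\<Sum>k\<le>degree (q j). coeff (q j) k * complex_of_real x ^ k)"
      using q(1)[OF j(1)] by (intro sum.mono_neutral_right) (auto simp: coeff_eq_0)
    also have "\<dots> = s x"
      using q(2)[OF j] by (simp add: poly_altdef)
    finally show ?thesis ..
  qed
  then show ?thesis
    by (intro exI[of _ "\<lambda>a. coeff (q (fst a)) (snd a)"] ballI)
qed

lemma spline_add:
  assumes s: "spline m N t s" and r: "spline m N t r"
  shows "spline m N t (\<lambda>x. c * s x + r x)"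
  unfolding spline_def
proof (intro conjI allI impI)
  fix j assume j: "j \<le> N"
  obtain p where p: "degree p < m" "\<forall>x\<in>{t j<..<t (Suc j)}. s x = poly p (complex_of_real x)"
    using s j unfolding spline_def by blast
  obtain q where q: "degree q < m" "\<forall>x\<in>{t j<..<t (Suc j)}. r x = poly q (complex_of_real x)"
    using r j unfolding spline_def by blast
  show "\<exists>p. degree p < m \<and> (\<forall>x\<in>{t j<..<t (Suc j)}. c * s x + r x = poly p (complex_of_real x))"
  proof (intro exI[of _ "smult c p + q"] conjI ballI)
    show "degree (smult c p + q) < m"
      using p(1) q(1) by (intro degree_add_less) (auto intro: le_less_trans[OF degree_smult_le])
  qed (use p q in auto)
next
  assume m: "2 \<le> m"
  obtain D where D: "D 0 = s" "\<forall>j\<le>m - 2. continuous_on II (D j)"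
    "\<forall>j<m - 2. \<forall>x\<in>II. (D j has_vector_derivative D (Suc j) x) (at x within II)"
  proof -
    have "Ck_on (m - 2) II s"
      using s m by (simp add: spline_def)
    then show thesis
      unfolding Ck_on_def by (elim exE conjE) (rule that)
  qed
  obtain E where E: "E 0 = r" "\<forall>j\<le>m - 2. continuous_on II (E j)"
    "\<forall>j<m - 2. \<forall>x\<in>II. (E j has_vector_derivative E (Suc j) x) (at x within II)"
  proof -
    have "Ck_on (m - 2) II r"
      using r m by (simp add: spline_def)
    then show thesis
      unfolding Ck_on_def by (elim exE conjE) (rule that)
  qed
  show "Ck_on (m - 2) II (\<lambda>x. c * s x + r x)"
    unfolding Ck_on_def
  proof (intro exI[of _ "\<lambda>j x. c * D j x + E j x"] conjI allI impI ballI)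
    show "(\<lambda>x. c * D 0 x + E 0 x) = (\<lambda>x. c * s x + r x)"
      using D E by simp
    show "continuous_on II (\<lambda>x. c * D j x + E j x)" if "j \<le> m - 2" for j
      using D(2) E(2) that by (intro continuous_intros) auto
    show "((\<lambda>x. c * D j x + E j x) has_vector_derivative c * D (Suc j) x + E (Suc j) x) (at x within II)"
      if "j < m - 2" "x \<in> II" for j x
      using D(3) E(3) that by (intro has_vector_derivative_add has_vector_derivative_mult_right) auto
  qed
qed

lemma spline_zero: "m > 0 \<Longrightarrow> spline m N t (\<lambda>x. 0)"
  using spline_poly[of 0 m N t] by simp

lemma Vspace_iff:
  "v \<in> Vspace m \<kappa> N t \<longleftrightarrow> (\<exists>w1 w2 w3. spline m N t w1 \<and> spline m N t w2 \<and> spline m N t w3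
     \<and> v = (\<lambda>x. w1 x * cis (\<kappa> * x) + w2 x * cis (- \<kappa> * x) + w3 x))"
  unfolding Vspace_def by (auto simp: cis_conv_exp mult_ac)

lemma Vspace_add:
  assumes "u \<in> Vspace m \<kappa> N t" "v \<in> Vspace m \<kappa> N t"
  shows "(\<lambda>x. c * u x + v x) \<in> Vspace m \<kappa> N t"
proof -
  obtain w1 w2 w3 where w: "spline m N t w1" "spline m N t w2" "spline m N t w3"
    "u = (\<lambda>x. w1 x * cis (\<kappa> * x) + w2 x * cis (- \<kappa> * x) + w3 x)"
    using assms(1) unfolding Vspace_iff by blast
  obtain z1 z2 z3 where z: "spline m N t z1" "spline m N t z2" "spline m N t z3"
    "v = (\<lambda>x. z1 x * cis (\<kappa> * x) + z2 x * cis (- \<kappa> * x) + z3 x)"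
    using assms(2) unfolding Vspace_iff by blast
  show ?thesis
    unfolding Vspace_iff
  proof (intro exI conjI)
    show "spline m N t (\<lambda>x. c * w1 x + z1 x)" "spline m N t (\<lambda>x. c * w2 x + z2 x)" "spline m N t (\<lambda>x. c * w3 x + z3 x)"
      using w z by (simp_all add: spline_add)
    show "(\<lambda>x. c * u x + v x) = (\<lambda>x. (c * w1 x + z1 x) * cis (\<kappa> * x) + (c * w2 x + z2 x) * cis (- \<kappa> * x) + (c * w3 x + z3 x))"
      unfolding w(4) z(4) by (simp add: algebra_simps)
  qed
qed

lemma Vspace_components:
  assumes m: "m > 0" and s: "spline m N t s"
  shows "s \<in> Vspace m \<kappa> N t" "(\<lambda>x. s x * cis (\<kappa> * x)) \<in> Vspace m \<kappa> N t" "(\<lambda>x. s x * cis (- \<kappa> * x)) \<in> Vspace m \<kappa> N t"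
proof -
  have V: "(\<lambda>x. w1 x * cis (\<kappa> * x) + w2 x * cis (- \<kappa> * x) + w3 x) \<in> Vspace m \<kappa> N t"
    if "spline m N t w1" "spline m N t w2" "spline m N t w3" for w1 w2 w3
    unfolding Vspace_iff using that by blast
  show "s \<in> Vspace m \<kappa> N t" "(\<lambda>x. s x * cis (\<kappa> * x)) \<in> Vspace m \<kappa> N t" "(\<lambda>x. s x * cis (- \<kappa> * x)) \<in> Vspace m \<kappa> N t"
    using V[OF spline_zero[OF m] spline_zero[OF m] s] V[OF s spline_zero[OF m] spline_zero[OF m]]
      V[OF spline_zero[OF m] s spline_zero[OF m]] by simp_all
qed

lemma Vspace_zero: "m > 0 \<Longrightarrow> (\<lambda>x. 0) \<in> Vspace m \<kappa> N t"
  using Vspace_components(1)[OF _ spline_zero] .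

lemma Vspace_sum:
  fixes n :: nat
  assumes m: "m > 0" and b: "\<And>i. i < n \<Longrightarrow> b i \<in> Vspace m \<kappa> N t"
  shows "(\<lambda>x. \<Sum>i<n. c i * b i x) \<in> Vspace m \<kappa> N t"
  using b
proof (induction n)
  case (Suc n)
  then show ?case
    using Vspace_add[of "b n" m \<kappa> N t "\<lambda>x. \<Sum>i<n. c i * b i x" "c n"] by (simp add: add.commute)
qed (simp add: Vspace_zero[OF m])

definition osc_factor :: "real \<Rightarrow> nat \<Rightarrow> real \<Rightarrow> complex" where
  "osc_factor \<kappa> l x = (if l = 0 then cis (\<kappa> * x) else if l = 1 then cis (- \<kappa> * x) else 1)"

lemma Vspace_finite_dim:
  assumes p: "partition N t" and v: "v \<in> Vspace m \<kappa> N t"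
  shows "\<exists>c. \<forall>x\<in>II - t ` {..Suc N}. v x = (\<Sum>a\<in>({..N} \<times> {..<m}) \<times> {..<3}. c a * (pw_monomial t (fst a) x * osc_factor \<kappa> (snd a) x))"
proof -
  let ?I = "{..N} \<times> {..<m}"
  obtain w1 w2 w3 where w: "spline m N t w1" "spline m N t w2" "spline m N t w3"
    "v = (\<lambda>x. w1 x * cis (\<kappa> * x) + w2 x * cis (- \<kappa> * x) + w3 x)"
    using v unfolding Vspace_iff by blast
  obtain c1 where c1: "\<forall>x\<in>II - t ` {..Suc N}. w1 x = (\<Sum>a\<in>?I. c1 a * pw_monomial t a x)"
    using spline_pw_monomial[OF p w(1)] by blast
  obtain c2 where c2: "\<forall>x\<in>II - t ` {..Suc N}. w2 x = (\<Sum>a\<in>?I. c2 a * pw_monomial t a x)"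
    using spline_pw_monomial[OF p w(2)] by blast
  obtain c3 where c3: "\<forall>x\<in>II - t ` {..Suc N}. w3 x = (\<Sum>a\<in>?I. c3 a * pw_monomial t a x)"
    using spline_pw_monomial[OF p w(3)] by blast
  define c where "c = (\<lambda>a. (if snd a = (0::nat) then c1 (fst a) else if snd a = 1 then c2 (fst a) else c3 (fst a)))"
  have "v x = (\<Sum>a\<in>?I \<times> {..<3}. c a * (pw_monomial t (fst a) x * osc_factor \<kappa> (snd a) x))"
    if x: "x \<in> II - t ` {..Suc N}" for x
  proof -
    have "(\<Sum>a\<in>?I \<times> {..<3}. c a * (pw_monomial t (fst a) x * osc_factor \<kappa> (snd a) x))
        = (\<Sum>a\<in>?I. \<Sum>l<3. c (a, l) * (pw_monomial t a x * osc_factor \<kappa> l x))"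
      unfolding sum.cartesian_product by (simp add: case_prod_beta)
    also have "\<dots> = (\<Sum>a\<in>?I. c1 a * pw_monomial t a x * cis (\<kappa> * x) + c2 a * pw_monomial t a x * cis (- \<kappa> * x) + c3 a * pw_monomial t a x)"
      by (intro sum.cong refl) (simp add: c_def osc_factor_def eval_nat_numeral lessThan_Suc)
    also have "\<dots> = v x"
      unfolding w(4) using c1 c2 c3 x by (simp add: sum.distrib sum_distrib_right)
    finally show ?thesis ..
  qed
  then show ?thesis
    by (intro exI[of _ c] ballI)
qed

lemma Vspace_L2:
  assumes p: "partition N t" and v: "v \<in> Vspace m \<kappa> N t"
  shows "L2_on v"
proof -
  let ?I = "({..N} \<times> {..<m}) \<times> {..<3::nat}"
  obtain c where c: "\<forall>x\<in>II - t ` {..Suc N}. v x = (\<Sum>a\<in>?I. c a * (pw_monomial t (fst a) x * osc_factor \<kappa> (snd a) x))"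
    using Vspace_finite_dim[OF p v] by blast
  let ?v = "\<lambda>x. \<Sum>a\<in>?I. c a * (pw_monomial t (fst a) x * osc_factor \<kappa> (snd a) x)"
  have "L2_on ?v"
  proof (intro L2_sum L2_cmult L2_bounded[where B = 1])
    fix a
    have [measurable]: "(\<lambda>x. cis (r * x)) \<in> borel_measurable LI" for r
      by (intro continuous_on_borel_measurable_LI continuous_intros)
    show "(\<lambda>x. pw_monomial t (fst a) x * osc_factor \<kappa> (snd a) x) \<in> borel_measurable LI"
      unfolding pw_monomial_def osc_factor_def greaterThanLessThan_iff by measurable
    fix x :: real assume "x \<in> II"
    then have "cmod (pw_monomial t (fst a) x) \<le> 1"
      by (auto simp: pw_monomial_def norm_power intro!: power_le_one)
    moreover have "cmod (osc_factor \<kappa> (snd a) x) = 1"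
      by (simp add: osc_factor_def)
    ultimately show "cmod (pw_monomial t (fst a) x * osc_factor \<kappa> (snd a) x) \<le> 1"
      by (simp add: norm_mult)
  qed
  \<comment> \<open>The values of \<open>v\<close> at the knots are not determined by the
    representation (for \<open>m = 1\<close> they are arbitrary), so finitely many points are
    changed.\<close>
  moreover have "v \<in> borel_measurable LI"
  proof (rule measurable_discrete_difference[OF L2_measurable[OF \<open>L2_on ?v\<close>]])
    show "countable (t ` {..Suc N})"
      by (intro countable_finite finite_imageI) simp
    show "{x} \<in> sets LI" if "x \<in> t ` {..Suc N}" for x
      using that partition_range[OF p] by (auto simp: sets_LI sets_restrict_space_iff)
  qed (use c in auto)
  moreover have "AE x in LI. ?v x = v x"
  proof (rule AE_mp[OF AE_LI_finite[of "t ` {..Suc N}"] AE_I2])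
    show "x \<notin> t ` {..Suc N} \<longrightarrow> ?v x = v x" if "x \<in> space LI" for x
      using c that by simp
  qed simp
  ultimately show ?thesis
    by (rule L2_cong_AE)
qed

section \<open>Solvability of the Galerkin equations\<close>

text \<open>Gaussian elimination as an induction on the set of equations; a homogeneous system with
  more unknowns than equations has a nontrivial solution.\<close>

lemma homogeneous_system:
  fixes A :: "'i \<Rightarrow> 'j \<Rightarrow> complex"
  assumes "finite I" "finite J" "card I < card J"
  shows "\<exists>x. (\<exists>j\<in>J. x j \<noteq> 0) \<and> (\<forall>i\<in>I. (\<Sum>j\<in>J. A i j * x j) = 0)"
  using assms
proof (induction I arbitrary: J A rule: finite_induct)
  case empty
  then obtain j where "j \<in> J"
    by fastforce
  then show ?case
    by (intro exI[of _ "\<lambda>_. 1"]) auto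
next
  case (insert i0 I)
  show ?case
  proof (cases "\<forall>j\<in>J. A i0 j = 0")
    case True
    have "card I < card J"
      using insert by simp
    then obtain x where "\<exists>j\<in>J. x j \<noteq> 0" "\<forall>i\<in>I. (\<Sum>j\<in>J. A i j * x j) = 0"
      using insert.IH[of J A] insert.prems by blast
    then show ?thesis
      using True by (intro exI[of _ x]) auto
  next
    case False
    then obtain j0 where j0: "j0 \<in> J" "A i0 j0 \<noteq> 0"
      by blast
    \<comment> \<open>Elimination of the unknown \<open>j0\<close> by the pivot row
      \<open>i0\<close>; \<open>y\<close> below restores it by back substitution.\<close>
    define A' where "A' = (\<lambda>i j. A i j - A i j0 * A i0 j / A i0 j0)"
    have "card I < card (J - {j0})"
      using insert j0 by simp
    then obtain x where x: "\<exists>j\<in>J - {j0}. x j \<noteq> 0" "\<forall>i\<in>I. (\<Sum>j\<in>J - {j0}. A' i j * x j) = 0"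
      using insert.IH[of "J - {j0}" A'] insert.prems by blast
    define s where "s = (\<Sum>j\<in>J - {j0}. A i0 j * x j)"
    define y where "y = x(j0 := - s / A i0 j0)"
    have y: "(\<Sum>j\<in>J. A i j * y j) = (\<Sum>j\<in>J - {j0}. A i j * x j) - A i j0 * s / A i0 j0" for i
    proof -
      have "(\<Sum>j\<in>J. A i j * y j) = A i j0 * y j0 + (\<Sum>j\<in>J - {j0}. A i j * y j)"
        using insert.prems j0 by (intro sum.remove) auto
      also have "(\<Sum>j\<in>J - {j0}. A i j * y j) = (\<Sum>j\<in>J - {j0}. A i j * x j)"
        by (intro sum.cong) (auto simp: y_def)
      finally show ?thesis
        by (simp add: y_def)
    qed
    have "(\<Sum>j\<in>J. A i j * y j) = 0" if "i \<in> insert i0 I" for i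
    proof (cases "i = i0")
      case True
      then show ?thesis
        unfolding y using j0 by (simp add: s_def)
    next
      case False
      have "(\<Sum>j\<in>J - {j0}. A' i j * x j) = (\<Sum>j\<in>J - {j0}. A i j * x j) - A i j0 / A i0 j0 * s"
        by (simp add: A'_def s_def left_diff_distrib right_diff_distrib sum_subtractf sum_distrib_left mult_ac)
      then show ?thesis
        unfolding y using x(2) False that by simp
    qed
    moreover have "\<exists>j\<in>J. y j \<noteq> 0"
      using x(1) by (auto simp: y_def)
    ultimately show ?thesis
      by blast
  qed
qed

text \<open>Linear independence modulo null functions: the Galerkin space consists of functions,
  whereas inner products see only classes.\<close>

definition AE_independent :: "nat \<Rightarrow> (nat \<Rightarrow> real \<Rightarrow> complex) \<Rightarrow> bool" where
  "AE_independent n b \<longleftrightarrow> (\<forall>x. (AE t in LI. (\<Sum>i<n. x i * b i t) = 0) \<longrightarrow> (\<forall>i<n. x i = 0))"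

lemma AE_independent_card:
  fixes \<beta> :: "'k \<Rightarrow> real \<Rightarrow> complex"
  assumes I: "finite I" and rep: "\<And>i. i < n \<Longrightarrow> \<exists>c. AE t in LI. b i t = (\<Sum>k\<in>I. c k * \<beta> k t)"
    and ind: "AE_independent n b"
  shows "n \<le> card I"
proof (rule ccontr)
  assume n: "\<not> n \<le> card I"
  have "\<forall>i\<in>{..<n}. \<exists>c. AE t in LI. b i t = (\<Sum>k\<in>I. c k * \<beta> k t)"
    using rep by auto
  from bchoice[OF this] obtain c where c: "\<forall>i\<in>{..<n}. AE t in LI. b i t = (\<Sum>k\<in>I. c i k * \<beta> k t)" ..
  have "card I < card {..<n}"
    using n by simp
  then obtain x where x: "\<exists>i\<in>{..<n}. x i \<noteq> 0" "\<forall>k\<in>I. (\<Sum>i\<in>{..<n}. c i k * x i) = 0"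
    using homogeneous_system[OF I, of "{..<n}" "\<lambda>k i. c i k"] by auto
  have "AE t in LI. \<forall>i\<in>{..<n}. b i t = (\<Sum>k\<in>I. c i k * \<beta> k t)"
    using c by (intro eventually_ball_finite) auto
  then have "AE t in LI. (\<Sum>i<n. x i * b i t) = 0"
  proof (rule AE_mp, intro AE_I2 impI)
    fix t assume "\<forall>i\<in>{..<n}. b i t = (\<Sum>k\<in>I. c i k * \<beta> k t)"
    then have "(\<Sum>i<n. x i * b i t) = (\<Sum>i<n. \<Sum>k\<in>I. x i * (c i k * \<beta> k t))"
      by (simp add: sum_distrib_left)
    also have "\<dots> = (\<Sum>k\<in>I. \<Sum>i<n. x i * (c i k * \<beta> k t))"
      by (rule sum.swap)
    also have "\<dots> = (\<Sum>k\<in>I. (\<Sum>i<n. c i k * x i) * \<beta> k t)"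
      by (simp add: sum_distrib_left sum_distrib_right mult_ac)
    also have "\<dots> = 0"
      using x(2) by simp
    finally show "(\<Sum>i<n. x i * b i t) = 0" .
  qed
  then show False
    using ind x(1) unfolding AE_independent_def by blast
qed

text \<open>An independent family of maximal length exists because lengths are bounded by the size
  of the spanning set. Appending \<open>v\<close> creates a relation in which \<open>v\<close> must
  have a nonzero coefficient.\<close>

lemma finite_dim_basis:
  fixes \<beta> :: "'k \<Rightarrow> real \<Rightarrow> complex" and V :: "(real \<Rightarrow> complex) set"
  assumes I: "finite I" and rep: "\<And>v. v \<in> V \<Longrightarrow> \<exists>c. AE t in LI. v t = (\<Sum>k\<in>I. c k * \<beta> k t)"
  obtains n b where "\<And>i. i < n \<Longrightarrow> b i \<in> V" "AE_independent n b"
    "\<And>v. v \<in> V \<Longrightarrow> \<exists>x. AE t in LI. v t = (\<Sum>i<n. x i * b i t)"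
proof -
  define P where "P = (\<lambda>n. \<exists>b. (\<forall>i<n. b i \<in> V) \<and> AE_independent n b)"
  have "P 0"
    by (simp add: P_def AE_independent_def)
  moreover have bound: "n \<le> card I" if "P n" for n
    using that AE_independent_card[OF I] rep unfolding P_def by blast
  ultimately obtain n where n: "P n" "\<And>k. P k \<Longrightarrow> k \<le> n"
    using Nat.ex_has_greatest_nat[of P 0 "card I"] by blast
  obtain b where b: "\<forall>i<n. b i \<in> V" "AE_independent n b"
    using n(1) unfolding P_def by blast
  have "\<exists>x. AE t in LI. v t = (\<Sum>i<n. x i * b i t)" if v: "v \<in> V" for v
  proof -
    have "\<not> P (Suc n)"
      using n(2)[of "Suc n"] by auto
    moreover have "\<forall>i<Suc n. (b(n := v)) i \<in> V"
      using b(1) v by auto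
    ultimately have "\<not> AE_independent (Suc n) (b(n := v))"
      unfolding P_def by blast
    then obtain x j where x: "AE t in LI. (\<Sum>i<Suc n. x i * (b(n := v)) i t) = 0" and j: "j < Suc n" "x j \<noteq> 0"
      unfolding AE_independent_def by blast
    have e: "(\<Sum>i<Suc n. x i * (b(n := v)) i t) = (\<Sum>i<n. x i * b i t) + x n * v t" for t
      by simp
    have xn: "x n \<noteq> 0"
    proof
      assume "x n = 0"
      then have "AE t in LI. (\<Sum>i<n. x i * b i t) = 0"
        using x unfolding e by simp
      then have "\<forall>i<n. x i = 0"
        using b(2) unfolding AE_independent_def by blast
      then show False
        using j \<open>x n = 0\<close> less_Suc_eq by auto
    qed
    have "AE t in LI. v t = (\<Sum>i<n. (- x i / x n) * b i t)"
    proof (rule AE_mp[OF x], intro AE_I2 impI)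
      fix t assume "(\<Sum>i<Suc n. x i * (b(n := v)) i t) = 0"
      then have "x n * v t = - (\<Sum>i<n. x i * b i t)"
        unfolding e by (simp add: eq_neg_iff_add_eq_0 add.commute)
      moreover have "v t = (x n * v t) / x n"
        using xn by simp
      ultimately have "v t = - (\<Sum>i<n. x i * b i t) / x n"
        by simp
      then show "v t = (\<Sum>i<n. (- x i / x n) * b i t)"
        by (simp add: sum_negf[symmetric] sum_divide_distrib)
    qed
    then show ?thesis
      by (rule exI[of _ "\<lambda>i. - x i / x n"])
  qed
  then show thesis
    using that b by blast
qed

text \<open>Existence from injectivity. An extra unknown multiplies the right-hand side, so the
  \<open>n\<close> equations have \<open>n + 1\<close> unknowns and a nontrivial solution; dividing
  by the extra unknown solves the problem.\<close>

lemma finite_dim_solvable: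
  fixes \<beta> :: "'k \<Rightarrow> real \<Rightarrow> complex" and V :: "(real \<Rightarrow> complex) set"
    and \<Phi> :: "(real \<Rightarrow> complex) \<Rightarrow> (real \<Rightarrow> complex)"
  assumes I: "finite I" and rep: "\<And>v. v \<in> V \<Longrightarrow> \<exists>c. AE t in LI. v t = (\<Sum>k\<in>I. c k * \<beta> k t)"
    and V: "\<And>v. v \<in> V \<Longrightarrow> L2_on v" "\<And>(n::nat) x b. (\<And>i. i < n \<Longrightarrow> b i \<in> V) \<Longrightarrow> (\<lambda>t. \<Sum>i<n. x i * b i t) \<in> V"
    and \<Phi>: "\<And>v. v \<in> V \<Longrightarrow> L2_on (\<Phi> v)"
      "\<And>(n::nat) x b s. (\<And>i. i < n \<Longrightarrow> b i \<in> V) \<Longrightarrow> s \<in> II \<Longrightarrow> \<Phi> (\<lambda>t. \<Sum>i<n. x i * b i t) s = (\<Sum>i<n. x i * \<Phi> (b i) s)"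
    and f: "L2_on f"
    and nondeg: "\<And>u. u \<in> V \<Longrightarrow> (\<And>v. v \<in> V \<Longrightarrow> l2inner (\<Phi> u) v = 0) \<Longrightarrow> AE t in LI. u t = 0"
  shows "\<exists>u\<in>V. \<forall>v\<in>V. l2inner (\<Phi> u) v = l2inner f v"
proof -
  obtain n b where b: "\<And>i. i < n \<Longrightarrow> b i \<in> V" "AE_independent n b"
    and span: "\<And>v. v \<in> V \<Longrightarrow> \<exists>x. AE t in LI. v t = (\<Sum>i<n. x i * b i t)"
    using finite_dim_basis[OF I rep] by blast
  have left: "l2inner (\<Phi> (\<lambda>t. \<Sum>i<n. x i * b i t)) v = (\<Sum>i<n. x i * l2inner (\<Phi> (b i)) v)" if v: "v \<in> V" for x v
  proof -
    have "l2inner (\<Phi> (\<lambda>t. \<Sum>i<n. x i * b i t)) v = (LINT s|LI. (\<Sum>i<n. x i * (\<Phi> (b i) s * cnj (v s))))"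
      unfolding l2inner_LI by (intro Bochner_Integration.integral_cong refl)
        (simp add: \<Phi>(2)[OF b(1)] sum_distrib_right mult.assoc)
    also have "\<dots> = (\<Sum>i<n. LINT s|LI. x i * (\<Phi> (b i) s * cnj (v s)))"
      by (intro Bochner_Integration.integral_sum integrable_mult_right L2_mult_integrable \<Phi>(1) b(1) L2_cnj V(1) v) auto
    finally show ?thesis
      by (simp add: l2inner_LI)
  qed
  have right: "l2inner g v = (\<Sum>i<n. cnj (x i) * l2inner g (b i))"
    if g: "L2_on g" and v: "v \<in> V" "AE t in LI. v t = (\<Sum>i<n. x i * b i t)" for g v x
  proof -
    have vb: "v \<in> borel_measurable LI" "L2_on (\<lambda>t. \<Sum>i<n. x i * b i t)"
      using L2_measurable[OF V(1)[OF v(1)]] V(1)[OF V(2)[OF b(1)]] by auto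
    have "l2inner g v = (LINT s|LI. g s * cnj (\<Sum>i<n. x i * b i s))"
      unfolding l2inner_LI
    proof (rule integral_cong_AE)
      show "(\<lambda>t. g t * cnj (v t)) \<in> borel_measurable LI"
        by (intro borel_measurable_integrable L2_mult_integrable g L2_cnj V v)
      show "(\<lambda>s. g s * cnj (\<Sum>i<n. x i * b i s)) \<in> borel_measurable LI"
        by (intro borel_measurable_integrable L2_mult_integrable g L2_cnj vb)
      show "AE s in LI. g s * cnj (v s) = g s * cnj (\<Sum>i<n. x i * b i s)"
        using v(2) by eventually_elim simp
    qed
    also have "\<dots> = (LINT s|LI. (\<Sum>i<n. cnj (x i) * (g s * cnj (b i s))))"
      by (intro Bochner_Integration.integral_cong refl) (simp add: sum_distrib_left mult_ac)
    also have "\<dots> = (\<Sum>i<n. LINT s|LI. cnj (x i) * (g s * cnj (b i s)))"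
      by (intro Bochner_Integration.integral_sum integrable_mult_right L2_mult_integrable g L2_cnj V(1) b(1)) auto
    finally show ?thesis
      by (simp add: l2inner_LI)
  qed
  \<comment> \<open>Column \<open>n\<close> holds the right-hand side.\<close>
  define A where "A = (\<lambda>i j. if j < n then l2inner (\<Phi> (b j)) (b i) else - l2inner f (b i))"
  obtain x where x: "\<exists>j\<in>{..<Suc n}. x j \<noteq> 0" "\<forall>i\<in>{..<n}. (\<Sum>j<Suc n. A i j * x j) = 0"
    using homogeneous_system[of "{..<n}" "{..<Suc n}" A] by auto
  have eq: "(\<Sum>j<n. x j * l2inner (\<Phi> (b j)) (b i)) = x n * l2inner f (b i)" if "i < n" for i
  proof -
    have "(\<Sum>j<Suc n. A i j * x j) = (\<Sum>j<n. x j * l2inner (\<Phi> (b j)) (b i)) - x n * l2inner f (b i)"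
      by (simp add: A_def mult.commute)
    then show ?thesis
      using x(2) that by simp
  qed
  \<comment> \<open>If the extra unknown were 0, the others would give a solution of the homogeneous
    problem, hence vanish by \<open>nondeg\<close> and independence.\<close>
  have xn: "x n \<noteq> 0"
  proof
    assume 0: "x n = 0"
    let ?u = "\<lambda>t. \<Sum>i<n. x i * b i t"
    have u: "?u \<in> V"
      by (rule V(2)[OF b(1)])
    have "l2inner (\<Phi> ?u) v = 0" if v: "v \<in> V" for v
    proof -
      obtain y where y: "AE t in LI. v t = (\<Sum>i<n. y i * b i t)"
        using span[OF v] by blast
      have "l2inner (\<Phi> ?u) v = (\<Sum>i<n. cnj (y i) * l2inner (\<Phi> ?u) (b i))"
        by (rule right[OF \<Phi>(1)[OF u] v y])
      also have "\<dots> = 0"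
        using left[OF b(1)] eq 0 by (intro sum.neutral) simp
      finally show ?thesis .
    qed
    then have "AE t in LI. ?u t = 0"
      by (rule nondeg[OF u])
    then have "\<forall>i<n. x i = 0"
      using b(2) unfolding AE_independent_def by blast
    then show False
      using x(1) 0 less_Suc_eq by auto
  qed
  let ?u = "\<lambda>t. \<Sum>i<n. (x i / x n) * b i t"
  have u: "?u \<in> V"
    by (rule V(2)[OF b(1)])
  have "l2inner (\<Phi> ?u) v = l2inner f v" if v: "v \<in> V" for v
  proof -
    obtain y where y: "AE t in LI. v t = (\<Sum>i<n. y i * b i t)"
      using span[OF v] by blast
    have "l2inner (\<Phi> ?u) (b i) = l2inner f (b i)" if i: "i < n" for i
    proof -
      have "l2inner (\<Phi> ?u) (b i) = (\<Sum>j<n. x j * l2inner (\<Phi> (b j)) (b i)) / x n"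
        unfolding left[OF b(1)[OF i]] by (simp add: sum_divide_distrib)
      then show ?thesis
        using eq[OF i] xn by simp
    qed
    then show ?thesis
      unfolding right[OF \<Phi>(1)[OF u] v y] right[OF f v y] by simp
  qed
  then show ?thesis
    using u by blast
qed

section \<open>Stability and the error estimate\<close>

text \<open>A spline, and its product with either exponential, lies in the Galerkin space;
  conjugation turns the Hermitian product into the bilinear pairing.\<close>

lemma Vspace_orth_imp_spline_orth:
  assumes m: "m > 0" and o: "\<And>v. v \<in> Vspace m \<kappa> N t \<Longrightarrow> l2inner r v = 0"
  shows "spline_orth m N t (\<lambda>x. cnj (r x))" "spline_orth m N t (\<lambda>x. cis (\<kappa> * x) * cnj (r x))"
    "spline_orth m N t (\<lambda>x. cis (- \<kappa> * x) * cnj (r x))"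
proof -
  have o': "(LINT x|LI. v x * cnj (r x)) = 0" if "v \<in> Vspace m \<kappa> N t" for v
  proof -
    have "(LINT x|LI. v x * cnj (r x)) = (LINT x|LI. cnj (r x * cnj (v x)))"
      by (intro Bochner_Integration.integral_cong refl) (simp add: mult.commute)
    also have "\<dots> = cnj (l2inner r v)"
      unfolding l2inner_LI by (rule Bochner_Integration.integral_cnj)
    finally show ?thesis
      using o[OF that] by simp
  qed
  show "spline_orth m N t (\<lambda>x. cnj (r x))" "spline_orth m N t (\<lambda>x. cis (\<kappa> * x) * cnj (r x))"
    "spline_orth m N t (\<lambda>x. cis (- \<kappa> * x) * cnj (r x))"
    unfolding spline_orth_def using o'[OF Vspace_components(1)[OF m]] o'[OF Vspace_components(2)[OF m]] o'[OF Vspace_components(3)[OF m]]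
    by (simp_all add: mult.assoc)
qed

context C1_kernel
begin

text \<open>Here \<open>A\<close> is any bound on the pairing of \<open>z\<close> with its own
  residual. It is 0 when \<open>z\<close> lies in the Galerkin space, and of order
  \<open>h^m\<close> when \<open>z\<close> is the error, so one lemma yields both uniqueness and
  convergence.\<close>

lemma galerkin_stability:
  assumes m: "m > 0" and p: "partition N t" and h: "3 ^ m * mesh N t \<le> 2"
    and L: "\<And>u. L2_on u \<Longrightarrow> l2norm u \<le> L * l2norm (\<lambda>s. u s - Kop K \<kappa> u s)"
    and small: "L * (72 * 3 ^ m * B * mesh N t) \<le> 1 / 2" and L0: "L \<ge> 0"
    and z: "L2_on z"
    and o: "\<And>v. v \<in> Vspace m \<kappa> N t \<Longrightarrow> l2inner (\<lambda>s. z s - Kop K \<kappa> z s) v = 0"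
    and A: "cmod (LINT s|LI. z s * cnj (z s - Kop K \<kappa> z s)) \<le> A * l2norm (\<lambda>s. z s - Kop K \<kappa> z s)" "A \<ge> 0"
  shows "l2norm z \<le> 2 * L * A"
proof -
  define r where "r = (\<lambda>s. z s - Kop K \<kappa> z s)"
  have Kz: "L2_on (Kop K \<kappa> z)"
    by (rule Kop_L2[OF z])
  have r: "L2_on r"
    unfolding r_def by (rule L2_diff[OF z Kz])
  have rc: "L2_on (\<lambda>x. cnj (r x))"
    by (rule L2_cnj[OF r])
  have nrc: "l2norm (\<lambda>x. cnj (r x)) = l2norm r"
    by (simp add: l2norm_LI)
  define E where "E = 72 * 3 ^ m * B * mesh N t"
  have oV: "l2inner r v = 0" if "v \<in> Vspace m \<kappa> N t" for v
    unfolding r_def by (rule o[OF that])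
  have K: "cmod (LINT s|LI. Kop K \<kappa> z s * cnj (r s)) \<le> E * l2norm z * l2norm r"
    using Kop_orth_bound[OF z rc m p h Vspace_orth_imp_spline_orth(2,3)[OF m oV]] by (simp add: E_def nrc)
  have Az: "cmod (LINT s|LI. z s * cnj (r s)) \<le> A * l2norm r"
    using A(1) by (simp only: r_def)
  \<comment> \<open>Only the first factor is expanded as \<open>z - K z\<close>; the second stays
    \<open>r\<close>, which carries the orthogonality.\<close>
  have "complex_of_real ((l2norm r)^2) = (LINT s|LI. r s * cnj (r s))"
    unfolding l2norm_sq integral_complex_of_real[symmetric]
    by (intro Bochner_Integration.integral_cong refl) (simp only: complex_norm_square)
  also have "\<dots> = (LINT s|LI. z s * cnj (r s) - Kop K \<kappa> z s * cnj (r s))"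
    by (intro Bochner_Integration.integral_cong refl) (simp add: r_def algebra_simps)
  also have "\<dots> = (LINT s|LI. z s * cnj (r s)) - (LINT s|LI. Kop K \<kappa> z s * cnj (r s))"
    by (intro Bochner_Integration.integral_diff L2_mult_integrable z Kz rc)
  finally have eq: "complex_of_real ((l2norm r)^2) = (LINT s|LI. z s * cnj (r s)) - (LINT s|LI. Kop K \<kappa> z s * cnj (r s))" .
  have "(l2norm r)^2 = cmod (complex_of_real ((l2norm r)^2))"
    by (simp only: norm_of_real) simp
  also have "\<dots> \<le> cmod (LINT s|LI. z s * cnj (r s)) + cmod (LINT s|LI. Kop K \<kappa> z s * cnj (r s))"
    unfolding eq by (rule norm_triangle_ineq4)
  also have "\<dots> \<le> A * l2norm r + E * l2norm z * l2norm r"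
    by (rule add_mono[OF Az K])
  finally have sq: "l2norm r * l2norm r \<le> (A + E * l2norm z) * l2norm r"
    by (simp add: power2_eq_square algebra_simps)
  have E0: "E \<ge> 0"
    using B_pos mesh_pos[OF p] by (simp add: E_def)
  have "l2norm r \<le> A + E * l2norm z"
  proof (cases "l2norm r = 0")
    case True
    then show ?thesis
      using A(2) E0 by simp
  next
    case False
    then have "l2norm r > 0"
      using l2norm_nonneg[of r] by linarith
    then show ?thesis
      using mult_right_le_imp_le[OF sq] by blast
  qed
  \<comment> \<open>With the lower bound \<open>L\<close> the term \<open>E * l2norm z\<close> comes
    back multiplied by at most 1/2 and is absorbed.\<close>
  then have "L * l2norm r \<le> L * (A + E * l2norm z)"
    by (rule mult_left_mono[OF _ L0])
  also have "\<dots> = L * A + L * E * l2norm z"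
    by (simp add: algebra_simps)
  also have "\<dots> \<le> L * A + 1 / 2 * l2norm z"
    using small by (intro add_left_mono mult_right_mono) (auto simp: E_def)
  finally show ?thesis
    using L[OF z] unfolding r_def by simp
qed

lemma Kop_diff:
  assumes "L2_on u" "L2_on v" "s \<in> II"
  shows "Kop K \<kappa> (\<lambda>x. u x - v x) s = Kop K \<kappa> u s - Kop K \<kappa> v s"
proof -
  define b where "b = (\<lambda>i::nat. if i = 0 then u else v)"
  define x where "x = (\<lambda>i::nat. if i = 0 then 1 else - 1 :: complex)"
  have "Kop K \<kappa> (\<lambda>t. \<Sum>i<2. x i * b i t) s = (\<Sum>i<2. x i * Kop K \<kappa> (b i) s)"
    by (rule Kop_sum[OF _ assms(3)]) (auto simp: b_def assms)
  then show ?thesis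
    by (simp add: b_def x_def eval_nat_numeral)
qed

lemma residual_diff:
  assumes "L2_on u" "L2_on v" "L2_on w"
  shows "l2inner (\<lambda>s. (u s - v s) - Kop K \<kappa> (\<lambda>x. u x - v x) s) w
    = l2inner (\<lambda>s. u s - Kop K \<kappa> u s) w - l2inner (\<lambda>s. v s - Kop K \<kappa> v s) w"
proof -
  have "l2inner (\<lambda>s. (u s - v s) - Kop K \<kappa> (\<lambda>x. u x - v x) s) w
      = l2inner (\<lambda>s. (u s - Kop K \<kappa> u s) - (v s - Kop K \<kappa> v s)) w"
    unfolding l2inner_LI by (intro Bochner_Integration.integral_cong refl) (simp add: Kop_diff assms)
  then show ?thesis
    using assms by (simp add: l2inner_diff L2_diff Kop_L2)
qed

lemma galerkin_sol_iff:
  assumes p: "partition N t" and f: "L2_on f"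
  shows "galerkin_sol m K f \<kappa> N t u \<longleftrightarrow> u \<in> Vspace m \<kappa> N t \<and>
    (\<forall>v\<in>Vspace m \<kappa> N t. l2inner (\<lambda>s. u s - Kop K \<kappa> u s) v = l2inner f v)"
proof -
  have "l2inner u v = l2inner (Kop K \<kappa> u) v + l2inner f v \<longleftrightarrow> l2inner (\<lambda>s. u s - Kop K \<kappa> u s) v = l2inner f v"
    if "u \<in> Vspace m \<kappa> N t" "v \<in> Vspace m \<kappa> N t" for v
    using Vspace_L2[OF p that(1)] Vspace_L2[OF p that(2)] by (simp add: l2inner_diff Kop_L2 diff_eq_eq add.commute)
  then show ?thesis
    unfolding galerkin_sol_def by blast
qed

end

section \<open>Solvability and convergence of the Galerkin method\<close>

lemma in_H_L2: "in_H m w \<Longrightarrow> L2_on w"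
  unfolding in_H_def sobolev_witness_def by auto

lemma osc_sum_L2:
  assumes "L2_on w1" "L2_on w2" "L2_on w3"
  shows "L2_on (\<lambda>t. w1 t * cis (\<kappa> * t) + w2 t * cis (- \<kappa> * t) + w3 t)"
proof -
  have m: "(\<lambda>x. cis (a * x)) \<in> borel_measurable LI" for a
    by (intro continuous_on_borel_measurable_LI continuous_intros)
  have c: "L2_on (\<lambda>t. w t * cis (a * t))" if "L2_on w" for w a
    using L2_mult_bounded[OF m[of a] _ that, of 1] by (simp add: mult.commute)
  show ?thesis
    by (intro L2_add c assms)
qed

theorem theorem6p2:
  fixes m :: nat and K :: "real \<Rightarrow> real \<Rightarrow> complex"
    and f y :: "real \<Rightarrow> real \<Rightarrow> complex"
  assumes m_pos: "m > 0"
    and K_reg: "C_mixed m K"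
    and f_reg: "in_Ht m f"
    and not_eig: "\<forall>\<kappa>>1. \<forall>u. L2_on u \<and> (AE s in lborel. s \<in> II \<longrightarrow> u s - Kop K \<kappa> u s = 0)
                      \<longrightarrow> (AE s in lborel. s \<in> II \<longrightarrow> u s = 0)"
    and y_L2: "\<forall>\<kappa>>1. L2_on (y \<kappa>)"
    and y_sol: "\<forall>\<kappa>>1. AE s in lborel. s \<in> II \<longrightarrow> y \<kappa> s - Kop K \<kappa> (y \<kappa>) s = f \<kappa> s"
  shows "\<exists>c>0. \<exists>\<kappa>1. \<forall>\<kappa>\<ge>\<kappa>1. \<exists>h0>0. \<forall>N t. partition N t \<and> mesh N t < h0 \<longrightarrow>
           (\<exists>yh. galerkin_sol m K (f \<kappa>) \<kappa> N t yh \<and>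
                 (\<forall>z. galerkin_sol m K (f \<kappa>) \<kappa> N t z \<longrightarrow> (AE x in lborel. x \<in> II \<longrightarrow> z x = yh x)) \<and>
                 ereal (l2norm (\<lambda>x. y \<kappa> x - yh x)) \<le> ereal (c * mesh N t ^ m) * Ht_norm m y \<kappa>)"
proof -
  obtain Ks Kt B where "C1_kernel K Ks Kt B"
    using C_mixed_imp_C1_kernel[OF K_reg m_pos] by blast
  then interpret C1_kernel K Ks Kt B .
  define C where "C = 2 * exp (8 * B^2)"
  define L where "L = 2 * C^2"
  have L0: "L > 0"
    by (simp add: L_def C_def)
  \<comment> \<open>The 2 keeps \<kappa> in the range above 1; the other bound is the threshold of
    \<open>Kop_lower_bound\<close>.\<close>
  define \<kappa>1 where "\<kappa>1 = max 2 (40 * B^2 * C^2)"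
  \<comment> \<open>\<open>2 L\<close> from stability, 3 from the three components of
    \<open>y\<close>, and the last factor from the duality bound.\<close>
  define c where "c = 6 * L * (4 * 3 ^ m) ^ m"
  \<comment> \<open>The first bound keeps the zero scale within the length 2 of the interval, the
    second allows the absorption in \<open>galerkin_stability\<close>. Neither involves
    \<kappa>.\<close>
  define h0 where "h0 = min (2 / 3 ^ m) (1 / (2 * L * (72 * 3 ^ m * B)))"
  have c0: "c > 0"
    using L0 by (simp add: c_def)
  have h00: "h0 > 0"
    using L0 B_pos by (simp add: h0_def)
  have main: "\<exists>yh. galerkin_sol m K (f \<kappa>) \<kappa> N t yh \<and>
                 (\<forall>z. galerkin_sol m K (f \<kappa>) \<kappa> N t z \<longrightarrow> (AE x in lborel. x \<in> II \<longrightarrow> z x = yh x)) \<and>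
                 ereal (l2norm (\<lambda>x. y \<kappa> x - yh x)) \<le> ereal (c * mesh N t ^ m) * Ht_norm m y \<kappa>"
    if \<kappa>: "\<kappa> \<ge> \<kappa>1" and p: "partition N t" and h: "mesh N t < h0" for \<kappa> N t
  proof -
    define V where "V = Vspace m \<kappa> N t"
    define h' where "h' = mesh N t"
    have \<kappa>1: "\<kappa> > 1"
      using \<kappa> by (simp add: \<kappa>1_def)
    have hp: "h' > 0"
      using mesh_pos[OF p] by (simp add: h'_def)
    have "h' < 2 / 3 ^ m"
      using h by (simp add: h0_def h'_def)
    then have h2: "3 ^ m * mesh N t \<le> 2"
      by (simp add: h'_def field_simps)
    have "h' < 1 / (2 * L * (72 * 3 ^ m * B))"
      using h by (simp add: h0_def h'_def)
    then have "h' * (2 * L * (72 * 3 ^ m * B)) < 1"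
      using L0 B_pos by (simp add: pos_less_divide_eq)
    then have small: "L * (72 * 3 ^ m * B * mesh N t) \<le> 1 / 2"
      by (simp add: h'_def mult_ac)
    have lb: "l2norm u \<le> L * l2norm (\<lambda>s. u s - Kop K \<kappa> u s)" if "L2_on u" for u
      using Kop_lower_bound[of \<kappa> u] that \<kappa> by (simp add: L_def C_def \<kappa>1_def)
    note stability = galerkin_stability[OF m_pos p h2 lb small less_imp_le[OF L0]]
    have VL2: "L2_on v" if "v \<in> V" for v
      using Vspace_L2[OF p] that by (simp add: V_def)
    have fL2: "L2_on (f \<kappa>)"
    proof -
      obtain w1 w2 w3 where w: "osc_decomp m f w1 w2 w3"
        using f_reg unfolding in_Ht_def by blast
      have wL: "L2_on (w1 \<kappa>)" "L2_on (w2 \<kappa>)" "L2_on (w3 \<kappa>)"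
        using w \<kappa>1 unfolding osc_decomp_def in_H0_def by (auto intro: in_H_L2)
      have "f \<kappa> x = w1 \<kappa> x * cis (\<kappa> * x) + w2 \<kappa> x * cis (- \<kappa> * x) + w3 \<kappa> x" if "x \<in> II" for x
        using w \<kappa>1 that unfolding osc_decomp_def by (simp add: cis_conv_exp mult_ac)
      then show ?thesis
        using osc_sum_L2[OF wL, of \<kappa>] L2_cong[of "f \<kappa>" "\<lambda>x. w1 \<kappa> x * cis (\<kappa> * x) + w2 \<kappa> x * cis (- \<kappa> * x) + w3 \<kappa> x"]
        by blast
    qed
    have yL2: "L2_on (y \<kappa>)"
      using y_L2 \<kappa>1 by blast
    \<comment> \<open>Here \<open>u\<close> itself belongs to the space its residual is orthogonal
      to, so stability applies with \<open>A = 0\<close>.\<close>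
    have inj: "AE x in LI. u x = 0"
      if u: "u \<in> V" and o: "\<And>v. v \<in> V \<Longrightarrow> l2inner (\<lambda>s. u s - Kop K \<kappa> u s) v = 0" for u
    proof -
      have "(LINT s|LI. u s * cnj (u s - Kop K \<kappa> u s)) = cnj (l2inner (\<lambda>s. u s - Kop K \<kappa> u s) u)"
        unfolding l2inner_LI Bochner_Integration.integral_cnj[symmetric]
        by (intro Bochner_Integration.integral_cong refl) (simp add: mult.commute)
      also have "\<dots> = 0"
        using o[OF u] by simp
      finally have "l2norm u \<le> 2 * L * 0"
        using VL2[OF u] o by (intro stability) (auto simp: V_def)
      then show ?thesis
        using l2norm_nonneg[of u] by (intro l2norm_eq_0_AE VL2 u) auto
    qed
    have "\<exists>u\<in>V. \<forall>v\<in>V. l2inner ((\<lambda>u s. u s - Kop K \<kappa> u s) u) v = l2inner (f \<kappa>) v"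
    proof (rule finite_dim_solvable[where \<beta> = "\<lambda>a x. pw_monomial t (fst a) x * osc_factor \<kappa> (snd a) x" and I = "({..N} \<times> {..<m}) \<times> {..<3}"])
      fix v assume v: "v \<in> V"
      then obtain d where d: "\<forall>x\<in>II - t ` {..Suc N}. v x = (\<Sum>a\<in>({..N} \<times> {..<m}) \<times> {..<3}. d a * (pw_monomial t (fst a) x * osc_factor \<kappa> (snd a) x))"
        using Vspace_finite_dim[OF p] unfolding V_def by blast
      have "AE x in LI. v x = (\<Sum>a\<in>({..N} \<times> {..<m}) \<times> {..<3}. d a * (pw_monomial t (fst a) x * osc_factor \<kappa> (snd a) x))"
        by (rule AE_mp[OF AE_LI_finite[of "t ` {..Suc N}"] AE_I2]) (use d in auto)
      then show "\<exists>c. AE x in LI. v x = (\<Sum>a\<in>({..N} \<times> {..<m}) \<times> {..<3}. c a * (pw_monomial t (fst a) x * osc_factor \<kappa> (snd a) x))"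
        by blast
      show "L2_on v" "L2_on (\<lambda>s. v s - Kop K \<kappa> v s)"
        using VL2[OF v] by (auto intro: L2_diff Kop_L2)
    next
      fix n :: nat and x b assume b: "\<And>i. i < n \<Longrightarrow> b i \<in> V"
      show "(\<lambda>t. \<Sum>i<n. x i * b i t) \<in> V"
        using Vspace_sum[OF m_pos, of n b \<kappa> N t x] b by (simp add: V_def)
      show "(\<Sum>i<n. x i * b i s) - Kop K \<kappa> (\<lambda>t. \<Sum>i<n. x i * b i t) s = (\<Sum>i<n. x i * (b i s - Kop K \<kappa> (b i) s))"
        if "s \<in> II" for s
        using Kop_sum[of n b s \<kappa> x] VL2 b that by (simp add: sum_subtractf right_diff_distrib)
    qed (use inj fL2 in auto)
    then obtain yh where yh: "yh \<in> V" "\<forall>v\<in>V. l2inner (\<lambda>s. yh s - Kop K \<kappa> yh s) v = l2inner (f \<kappa>) v"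
      by blast
    have sol: "galerkin_sol m K (f \<kappa>) \<kappa> N t yh"
      using yh by (simp add: galerkin_sol_iff[OF p fL2] V_def)
    have unique: "AE x in lborel. x \<in> II \<longrightarrow> z x = yh x" if "galerkin_sol m K (f \<kappa>) \<kappa> N t z" for z
    proof -
      have z: "z \<in> V" "\<forall>v\<in>V. l2inner (\<lambda>s. z s - Kop K \<kappa> z s) v = l2inner (f \<kappa>) v"
        using that by (simp_all add: galerkin_sol_iff[OF p fL2] V_def)
      have "(\<lambda>x. z x - yh x) \<in> V"
        using Vspace_add[of yh m \<kappa> N t z "-1"] yh(1) z(1) by (simp add: V_def)
      then have "AE x in LI. z x - yh x = 0"
        using yh z by (intro inj) (auto simp: residual_diff VL2)
      then have "AE x in LI. z x = yh x"
        by eventually_elim simp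
      then show ?thesis
        by (simp only: AE_LI_iff)
    qed
    define z where "z = (\<lambda>x. y \<kappa> x - yh x)"
    have yhL2: "L2_on yh"
      by (rule VL2[OF yh(1)])
    have zL2: "L2_on z"
      unfolding z_def by (rule L2_diff[OF yL2 yhL2])
    \<comment> \<open>Galerkin orthogonality: \<open>y\<close> and \<open>yh\<close> have the same
      residual pairings against \<open>V\<close>.\<close>
    have zo: "l2inner (\<lambda>s. z s - Kop K \<kappa> z s) v = 0" if v: "v \<in> V" for v
    proof -
      have "AE s in LI. y \<kappa> s - Kop K \<kappa> (y \<kappa>) s = f \<kappa> s"
        using y_sol \<kappa>1 unfolding AE_LI_iff by blast
      then have "l2inner (\<lambda>s. y \<kappa> s - Kop K \<kappa> (y \<kappa>) s) v = l2inner (f \<kappa>) v"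
        by (intro l2inner_cong L2_diff Kop_L2 yL2 fL2 VL2 v)
      then show ?thesis
        unfolding z_def residual_diff[OF yL2 yhL2 VL2[OF v]] using yh(2) v by simp
    qed
    define r where "r = (\<lambda>s. z s - Kop K \<kappa> z s)"
    have rL2: "L2_on r"
      unfolding r_def by (intro L2_diff Kop_L2 zL2)
    have rc: "L2_on (\<lambda>x. cnj (r x))"
      by (rule L2_cnj[OF rL2])
    have nrc: "l2norm (\<lambda>x. cnj (r x)) = l2norm r"
      by (simp add: l2norm_LI)
    have ro: "l2inner r v = 0" if "v \<in> Vspace m \<kappa> N t" for v
      using zo that by (simp add: V_def r_def)
    have orth: "spline_orth m N t (\<lambda>x. cnj (r x))" "spline_orth m N t (\<lambda>x. cis (\<kappa> * x) * cnj (r x))"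
      "spline_orth m N t (\<lambda>x. cis (- \<kappa> * x) * cnj (r x))"
      by (rule Vspace_orth_imp_spline_orth[where \<kappa> = \<kappa>, OF m_pos], rule ro, assumption)+
    \<comment> \<open>For an arbitrary decomposition of \<open>y\<close>: each exponential is moved
      from its component onto the conjugate residual, where the matching spline orthogonality
      applies.\<close>
    have bound: "l2norm z \<le> c * h' ^ m * sqrt ((H_norm m (w1 \<kappa>))^2 + (H_norm m (w2 \<kappa>))^2 + (H_norm m (w3 \<kappa>))^2)"
      if w: "osc_decomp m y w1 w2 w3" for w1 w2 w3
    proof -
      have wH: "in_H m (w1 \<kappa>)" "in_H m (w2 \<kappa>)" "in_H m (w3 \<kappa>)"
        using w \<kappa>1 unfolding osc_decomp_def in_H0_def by auto
      note wL = in_H_L2[OF wH(1)] in_H_L2[OF wH(2)] in_H_L2[OF wH(3)]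
      define S where "S = sqrt ((H_norm m (w1 \<kappa>))^2 + (H_norm m (w2 \<kappa>))^2 + (H_norm m (w3 \<kappa>))^2)"
      define q where "q = (4 * 3 ^ m * h') ^ m"
      have q0: "q \<ge> 0"
        using hp by (simp add: q_def)
      have S: "H_norm m (w1 \<kappa>) \<le> S" "H_norm m (w2 \<kappa>) \<le> S" "H_norm m (w3 \<kappa>) \<le> S" "S \<ge> 0"
        unfolding S_def by (auto intro!: real_le_rsqrt)
      let ?r1 = "\<lambda>x. cis (\<kappa> * x) * cnj (r x)" and ?r2 = "\<lambda>x. cis (- \<kappa> * x) * cnj (r x)" and ?r3 = "\<lambda>x. cnj (r x)"
      have r12: "L2_on ?r1" "L2_on ?r2" "l2norm ?r1 = l2norm r" "l2norm ?r2 = l2norm r"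
        using l2norm_cis_mult[OF rc, of \<kappa>] l2norm_cis_mult[OF rc, of "- \<kappa>"] nrc by auto
      have qS: "q * l2norm r * H \<le> q * S * l2norm r" if "H \<le> S" for H
        using mult_left_mono[OF that, of "q * l2norm r"] q0 by (simp add: mult_ac)
      have b: "cmod (LINT x|LI. w1 \<kappa> x * ?r1 x) \<le> q * S * l2norm r"
        "cmod (LINT x|LI. w2 \<kappa> x * ?r2 x) \<le> q * S * l2norm r"
        "cmod (LINT x|LI. w3 \<kappa> x * ?r3 x) \<le> q * S * l2norm r"
        using order_trans[OF sobolev_orth_bound[OF wH(1) r12(1) orth(2) p h2] qS[OF S(1), folded r12(3), unfolded q_def h'_def]]
          order_trans[OF sobolev_orth_bound[OF wH(2) r12(2) orth(3) p h2] qS[OF S(2), folded r12(4), unfolded q_def h'_def]]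
          order_trans[OF sobolev_orth_bound[OF wH(3) rc orth(1) p h2] qS[OF S(3), folded nrc, unfolded q_def h'_def]]
        unfolding r12(3,4) nrc q_def h'_def .
      have "(LINT s|LI. z s * cnj (r s)) = (LINT s|LI. y \<kappa> s * cnj (r s) - yh s * cnj (r s))"
        by (simp add: z_def left_diff_distrib)
      also have "\<dots> = (LINT s|LI. y \<kappa> s * cnj (r s)) - (LINT s|LI. yh s * cnj (r s))"
        by (intro Bochner_Integration.integral_diff L2_mult_integrable yL2 yhL2 rc)
      \<comment> \<open>Since \<open>yh\<close> lies in the Galerkin space it drops out, and the
        pairing of the error with \<open>r\<close> equals that of \<open>y\<close>.\<close>
      also have "(LINT s|LI. yh s * cnj (r s)) = cnj (l2inner r yh)"
        unfolding l2inner_LI Bochner_Integration.integral_cnj[symmetric]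
        by (intro Bochner_Integration.integral_cong refl) (simp add: mult.commute)
      also have "\<dots> = 0"
        using ro yh(1) by (simp add: V_def)
      also have "(LINT s|LI. y \<kappa> s * cnj (r s)) = (LINT x|LI. (w1 \<kappa> x * ?r1 x + w2 \<kappa> x * ?r2 x) + w3 \<kappa> x * ?r3 x)"
      proof (intro Bochner_Integration.integral_cong refl)
        fix x assume "x \<in> space LI"
        then have "y \<kappa> x = w1 \<kappa> x * cis (\<kappa> * x) + w2 \<kappa> x * cis (- \<kappa> * x) + w3 \<kappa> x"
          using w \<kappa>1 unfolding osc_decomp_def by (simp add: cis_conv_exp mult_ac)
        then show "y \<kappa> x * cnj (r x) = (w1 \<kappa> x * ?r1 x + w2 \<kappa> x * ?r2 x) + w3 \<kappa> x * ?r3 x"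
          by (simp add: algebra_simps)
      qed
      also have "\<dots> = (LINT x|LI. w1 \<kappa> x * ?r1 x) + (LINT x|LI. w2 \<kappa> x * ?r2 x) + (LINT x|LI. w3 \<kappa> x * ?r3 x)"
      proof -
        have i: "integrable LI (\<lambda>x. w1 \<kappa> x * ?r1 x)" "integrable LI (\<lambda>x. w2 \<kappa> x * ?r2 x)" "integrable LI (\<lambda>x. w3 \<kappa> x * ?r3 x)"
          by (intro L2_mult_integrable wL r12 rc)+
        show ?thesis
          by (subst Bochner_Integration.integral_add[OF Bochner_Integration.integrable_add[OF i(1,2)] i(3)],
              subst Bochner_Integration.integral_add[OF i(1,2)]) (rule refl)
      qed
      finally have zr: "(LINT s|LI. z s * cnj (r s)) = (LINT x|LI. w1 \<kappa> x * ?r1 x) + (LINT x|LI. w2 \<kappa> x * ?r2 x) + (LINT x|LI. w3 \<kappa> x * ?r3 x)"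
        by simp
      have tri: "cmod (a + b + d) \<le> cmod a + cmod b + cmod d" for a b d
        using norm_triangle_ineq[of "a + b" d] norm_triangle_ineq[of a b] by linarith
      have "cmod (LINT s|LI. z s * cnj (r s)) \<le> 3 * q * S * l2norm r"
        unfolding zr by (rule order_trans[OF tri]) (use b in linarith)
      then have "l2norm z \<le> 2 * L * (3 * q * S)"
        unfolding r_def using q0 S(4) zo by (intro stability zL2) (auto simp: V_def)
      also have "\<dots> = c * h' ^ m * S"
        by (simp add: c_def q_def power_mult_distrib)
      finally show ?thesis
        by (simp only: S_def)
    qed
    have ch: "c * h' ^ m > 0"
      using c0 hp by simp
    \<comment> \<open>The positive factor is divided out before the infimum over decompositions is
      taken; if there is none, the right side is infinite and the claim holds.\<close>
    have "ereal (l2norm z / (c * h' ^ m)) \<le> Ht_norm m y \<kappa>"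
      unfolding Ht_norm_def
    proof (rule Inf_greatest)
      fix e assume "e \<in> {ereal (sqrt ((H_norm m (w1 \<kappa>))^2 + (H_norm m (w2 \<kappa>))^2 + (H_norm m (w3 \<kappa>))^2)) |w1 w2 w3. osc_decomp m y w1 w2 w3}"
      then obtain w1 w2 w3 where e: "e = ereal (sqrt ((H_norm m (w1 \<kappa>))^2 + (H_norm m (w2 \<kappa>))^2 + (H_norm m (w3 \<kappa>))^2))"
        and w: "osc_decomp m y w1 w2 w3"
        by blast
      show "ereal (l2norm z / (c * h' ^ m)) \<le> e"
        unfolding e ereal_less_eq(3) pos_divide_le_eq[OF ch] using bound[OF w] by (simp only: mult.commute)
    qed
    then have "ereal (c * h' ^ m) * ereal (l2norm z / (c * h' ^ m)) \<le> ereal (c * h' ^ m) * Ht_norm m y \<kappa>"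
      using ch by (intro ereal_mult_left_mono) auto
    moreover have "ereal (c * h' ^ m) * ereal (l2norm z / (c * h' ^ m)) = ereal (l2norm z)"
      using c0 hp by simp
    ultimately have "ereal (l2norm z) \<le> ereal (c * mesh N t ^ m) * Ht_norm m y \<kappa>"
      by (simp add: h'_def)
    then show ?thesis
      using sol unique unfolding z_def by blast
  qed
  show ?thesis
    using c0 h00 main by blast
qed

end
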